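(* Fix a real number $c>0$. Then, as $n\to\infty$, with $m=\lfloor c n^{5/4}\rfloor$, $$ d_{\mathrm{TV}}(\nu_{n,m},\nu_n)=1-2\Phi\left(-\frac{1}{12c^2\sqrt{10}}\right)+O_c\left(\frac{1}{\sqrt n}\right). $$ That is, there exist constants $C,N>0$ depending only on $c$ such that for all integers $n\ge N$ the absolute value of the difference between $d_{\mathrm{TV}}(\nu_{n,m},\nu_n)$ and $1-2\Phi\left(-\frac{1}{12c^2\sqrt{10}}\right)$ is at most $C/\sqrt n$.
   Context: $\Phi(x)=\frac{1}{\sqrt{2\pi}}\int_{-\infty}^x e^{-t^2/2}\,dt$ is the standard normal cumulative distribution function. $\nu_n$ is the uniform probability measure on the set $S_n$ of permutations of $\{1,\dots,n\}$. The total variation distance is $d_{\mathrm{TV}}(\nu_{n,m},\nu_n)=\frac12\sum_{\pi\in S_n}|\nu_n(\pi)-\nu_{n,m}(\pi)|$. For positive integers $n,m$, $\nu_{n,m}$ is the law on $S_n$ of an $m$-shelf shuffle of $n$ cards started from the identity, defined through its inverse as follows. Start with the deck in order $1,2,\dots,n$ from top to bottom. Cut it into $2m$ consecutive packets (possibly empty) of sizes $(N_1,\dots,N_{2m})$ distributed as a symmetric multinomial with $n$ trials and $2m$ equally likely outcomes (packet 1 consists of the first $N_1$ cards, packet 2 of the next $N_2$ cards, and so on). Reverse the order of the cards in each even-numbered packet. Then riffle the $2m$ packets together according to the Gilbert–Shannon–Reeds rule: drop cards sequentially, each time from a packet chosen with probability proportional to its current size (equivalently, conditionally on the cut, choose uniformly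 among all interleavings of the packets that preserve the order of the cards within each packet). Let $\sigma\in S_n$ be the resulting permutation, where $\sigma(i)$ is the label of the card in position $i$. Then $\nu_{n,m}$ is the law of $\sigma^{-1}$. *)

theory Defs
  imports "HOL-Probability.Probability" "HOL-Combinatorics.Permutations"
begin

text \<open>A deck is a list of cards, read from top to bottom; packets are decks indexed by \<open>1, \<dots>, 2m\<close>.\<close>

definition multinomial_pmf :: "nat \<Rightarrow> nat \<Rightarrow> (nat \<Rightarrow> nat) pmf" where
  "multinomial_pmf n k =
     map_pmf (\<lambda>f j. card {i \<in> {1..n}. f i = j}) (Pi_pmf {1..n} 0 (\<lambda>_. pmf_of_set {1..k}))"

definition packet :: "(nat \<Rightarrow> nat) \<Rightarrow> nat \<Rightarrow> nat list" where
  "packet N j = [(\<Sum>i=1..<j. N i) + 1 ..< (\<Sum>i=1..j. N i) + 1]"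

definition shelf_packet :: "(nat \<Rightarrow> nat) \<Rightarrow> nat \<Rightarrow> nat list" where
  "shelf_packet N j = (if even j then rev (packet N j) else packet N j)"

text \<open>A packet chosen with probability proportional to its size; meaningful only if \<open>J\<close> is finite
  and some packet is nonempty.\<close>

definition choose_packet :: "'i set \<Rightarrow> ('i \<Rightarrow> 'a list) \<Rightarrow> 'i pmf" where
  "choose_packet J P =
     embed_pmf (\<lambda>j. if j \<in> J then real (length (P j)) / real (\<Sum>i\<in>J. length (P i)) else 0)"

lemma pmf_choose_packet:
  assumes "finite J" "(\<Sum>i\<in>J. length (P i)) > 0"
  shows "pmf (choose_packet J P) j =
    (if j \<in> J then real (length (P j)) / real (\<Sum>i\<in>J. length (P i)) else 0)"
  unfolding choose_packet_def
proof (rule pmf_embed_pmf)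
  let ?p = "\<lambda>j. if j \<in> J then real (length (P j)) / real (\<Sum>i\<in>J. length (P i)) else 0"
  show "0 \<le> ?p x" for x by (simp add: sum_nonneg)
  have "(\<integral>\<^sup>+x. ennreal (?p x) \<partial>count_space UNIV) = (\<Sum>x\<in>J. ennreal (?p x))"
    by (rule nn_integral_count_space'[OF assms(1)]) auto
  also have "\<dots> = ennreal (\<Sum>x\<in>J. ?p x)"
    by (rule sum_ennreal) (auto simp: sum_nonneg)
  also have "(\<Sum>x\<in>J. ?p x) = (\<Sum>x\<in>J. real (length (P x))) / real (\<Sum>i\<in>J. length (P i))"
    unfolding sum_divide_distrib by (rule sum.cong) auto
  also have "\<dots> = 1"
    using assms(2) by (metis div_self of_nat_0_eq_iff of_nat_sum less_numeral_extra(3))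
  finally show "(\<integral>\<^sup>+x. ennreal (?p x) \<partial>count_space UNIV) = 1" by simp
qed

text \<open>Gilbert--Shannon--Reeds riffle of packets with \<open>k\<close> cards in total: the bottom card of the
  chosen packet is dropped, so the first card dropped ends up at the bottom of the deck.\<close>

primrec gsr_riffle :: "nat \<Rightarrow> 'i set \<Rightarrow> ('i \<Rightarrow> 'a list) \<Rightarrow> 'a list pmf" where
  "gsr_riffle 0 J P = return_pmf []"
| "gsr_riffle (Suc k) J P =
     bind_pmf (choose_packet J P) (\<lambda>j.
       map_pmf (\<lambda>d. d @ [last (P j)]) (gsr_riffle k J (P(j := butlast (P j)))))"

definition perm_of_deck :: "nat \<Rightarrow> nat list \<Rightarrow> nat \<Rightarrow> nat" where
  "perm_of_deck n d = (\<lambda>i. if i \<in> {1..n} then d ! (i - 1) else i)"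

definition inv_shelf_shuffle :: "nat \<Rightarrow> nat \<Rightarrow> (nat \<Rightarrow> nat) pmf" where
  "inv_shelf_shuffle n m =
     bind_pmf (multinomial_pmf n (2 * m)) (\<lambda>N.
       map_pmf (perm_of_deck n) (gsr_riffle n {1..2 * m} (shelf_packet N)))"

definition shelf_shuffle :: "nat \<Rightarrow> nat \<Rightarrow> (nat \<Rightarrow> nat) pmf" where
  "shelf_shuffle n m = map_pmf inv (inv_shelf_shuffle n m)"

definition uniform_perm :: "nat \<Rightarrow> (nat \<Rightarrow> nat) pmf" where
  "uniform_perm n = pmf_of_set {p. p permutes {1..n}}"

definition tv_dist :: "nat \<Rightarrow> (nat \<Rightarrow> nat) pmf \<Rightarrow> (nat \<Rightarrow> nat) pmf \<Rightarrow> real" where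
  "tv_dist n \<mu> \<nu> = (\<Sum>p | p permutes {1..n}. \<bar>pmf \<nu> p - pmf \<mu> p\<bar>) / 2"

abbreviation Phi :: "real \<Rightarrow> real" where
  "Phi \<equiv> cdf std_normal_distribution"

lemma Phi_eq_integral: "Phi x = 1 / sqrt (2 * pi) * (LINT t:{..x}|lborel. exp (- t\<^sup>2 / 2))"
proof -
  interpret prob_space std_normal_distribution
    by (rule prob_space_normal_density) simp
  have "Phi x = (LINT t|std_normal_distribution. indicator {..x} t)"
    by (simp add: cdf_def)
  also have "\<dots> = (LINT t|lborel. std_normal_density t *\<^sub>R indicator {..x} t)"
    by (rule integral_density) auto
  also have "\<dots> = (LINT t:{..x}|lborel. 1 / sqrt (2 * pi) * exp (- t\<^sup>2 / 2))"
    by (simp add: set_lebesgue_integral_def std_normal_density_def mult_ac)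
  finally show ?thesis by simp
qed

end

theory Submission
  imports Defs "HOL-Combinatorics.Multiset_Permutations" "HOL-Real_Asymp.Real_Asymp"
begin

text \<open>
  The mass that an \<open>m\<close>-shelf shuffle gives to a permutation \<open>\<pi>\<close> depends only on the number \<open>v\<close> of
  valleys of the word \<open>\<pi>(n), \<dots>, \<pi>(1)\<close>. Let \<open>L(v)\<close> be \<open>n!\<close> times this mass, the likelihood ratio
  against the uniform measure, and let \<open>V\<close> be the number of valleys of a uniform permutation. Then
  the total variation distance is the expectation of \<open>max 0 (1 - L(V))\<close>, and three facts determine it.

  First, \<open>ln L\<close> is almost affine. A permutation \<open>\<pi>\<close> is produced once for every weakly increasing
  labelling of the cards by the \<open>2m\<close> packets that is compatible with its ascents and descents
  (\<open>card_packets_monotone\<close>). The generating function of these numbers is rational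
  (\<open>even_gf_valleys\<close>) and exhibits \<open>L(v)\<close> as the average of a rising factorial over
  \<open>n - 1 - 2v\<close> fair coin flips. One more valley means two flips less, and two flips act as a second
  difference, which multiplies the rising factorial by about \<open>4a\<close> with \<open>a = n\<^sup>2 / (4m\<^sup>2)\<close>. So
  \<open>ln L(v) - ln L(v + 1) = a + O(1/n)\<close> (\<open>coin_avg_rising_ratio\<close>).

  Second, \<open>V\<close> is a sum of independent Bernoulli variables: its generating polynomial has only real
  roots (\<open>valley_poly_factor\<close>). Its mean is \<open>(n - 2)/3\<close> and its variance is \<open>2(n + 1)/45\<close>.
  Independence gives the Laplace transform of \<open>V\<close> up to a factor \<open>1 + O(n a\<^sup>3)\<close>
  (\<open>bernoulli_laplace\<close>). Since \<open>L(V)\<close> has expectation \<open>1\<close>, this fixes the multiplicative constant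
  that the first fact leaves open: \<open>L(V)\<close> is \<open>exp(-\<mu> W - \<mu>\<^sup>2/2)\<close> up to an error \<open>O(1/sqrt n)\<close> in mean,
  where \<open>\<mu> = 1/(6 c\<^sup>2 sqrt 10)\<close> and \<open>W\<close> is \<open>V\<close>, centred, times \<open>a/\<mu>\<close>, with variance close to \<open>1\<close>.

  Third, the function \<open>w \<mapsto> max 0 (1 - exp(-\<mu> w - \<mu>\<^sup>2/2))\<close> is Lipschitz, so Stein's method compares its
  expectations under \<open>W\<close> and under a standard normal variable with an error \<open>O(1/sqrt n)\<close>. The
  normal expectation is
  \<open>\<Phi>(\<mu>/2) - \<Phi>(-\<mu>/2) = 1 - 2\<Phi>(-\<mu>/2)\<close>. The solution of Stein's equation is explicit in terms of the
  Mills ratio (\<open>stein_solution\<close>), and the normal expectation enters as the constant that makes its two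
  pieces fit together.
\<close>

section \<open>Valleys of permutations\<close>

fun valleys :: "nat list \<Rightarrow> nat" where
  "valleys (x # y # z # r) = (if y < x \<and> y < z then 1 else 0) + valleys (y # z # r)"
| "valleys _ = 0"

primrec insert_at :: "'a \<Rightarrow> nat \<Rightarrow> 'a list \<Rightarrow> 'a list" where
  "insert_at a i [] = [a]"
| "insert_at a i (x # xs) = (case i of 0 \<Rightarrow> a # x # xs | Suc j \<Rightarrow> x # insert_at a j xs)"

lemma insert_at_0 [simp]: "insert_at a 0 xs = a # xs"
  by (cases xs) auto

lemma valleys_bound: "2 * valleys xs \<le> length xs - 1"
proof (induction xs rule: length_induct)
  case (1 xs)
  show ?case
  proof (cases "valleys xs = 0")
    case False
    then obtain x y z r where xs: "xs = x # y # z # r"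
      by (cases xs rule: valleys.cases) auto
    show ?thesis
    proof (cases "y < x \<and> y < z")
      case True
      have "valleys (y # z # r) = valleys (z # r)" using True by (cases r) auto
      moreover have "2 * valleys (z # r) \<le> length (z # r) - 1"
        by (rule 1[rule_format]) (simp add: xs)
      ultimately show ?thesis using True xs by simp
    next
      case F: False
      moreover have "2 * valleys (y # z # r) \<le> length (y # z # r) - 1"
        by (rule 1[rule_format]) (simp add: xs)
      moreover have "valleys xs = valleys (y # z # r)" using F xs by auto
      ultimately show ?thesis using xs by simp
    qed
  qed simp
qed

text \<open>
  Inserting a new minimum at one of the two ends, or next to an existing valley, keeps the number
  of valleys: in the second case the new card takes the place of that valley, and valleys are never
  adjacent. Every other gap creates one new valley. The equation counts the gaps of both kinds,
  weighted by a test function \<open>g\<close>.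
\<close>

lemma valleys_insert_sum:
  fixes g :: "nat \<Rightarrow> real"
  assumes "xs \<noteq> []" "\<And>x. x \<in> set xs \<Longrightarrow> a < x"
  shows "(\<Sum>i\<le>length xs. g (valleys (insert_at a i xs))) =
    (2 + 2 * real (valleys xs)) * g (valleys xs)
    + (real (length xs) - 1 - 2 * real (valleys xs)) * g (Suc (valleys xs))"
  using assms
proof (induction xs arbitrary: g rule: valleys.induct)
  case (1 x y z r)
  have a: "a < x" "a < y" "a < z" using 1(3) by auto
  have IH: "(\<Sum>i\<le>length (y # z # r). g (valleys (insert_at a i (y # z # r)))) =
    (2 + 2 * real (valleys (y # z # r))) * g (valleys (y # z # r))
    + (real (length (y # z # r)) - 1 - 2 * real (valleys (y # z # r))) * g (Suc (valleys (y # z # r)))" for g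
    by (rule 1(1)) (use 1(3) in auto)
  let ?v = "valleys (y # z # r)"
  have S: "(\<Sum>i\<le>length (x # y # z # r). g (valleys (insert_at a i (x # y # z # r)))) =
    g (valleys (a # x # y # z # r)) + g (valleys (x # a # y # z # r)) + g (valleys (x # y # a # z # r))
    + (\<Sum>i\<le>length r. g (valleys (x # y # z # insert_at a i r)))"
    by (simp only: length_Cons sum.atMost_Suc_shift) (simp add: sum.atMost_Suc_shift)
  have S': "(\<Sum>i\<le>length (y # z # r). g (valleys (insert_at a i (y # z # r)))) =
    g (valleys (a # y # z # r)) + g (valleys (y # a # z # r))
    + (\<Sum>i\<le>length r. g (valleys (y # z # insert_at a i r)))" for g
    by (simp only: length_Cons sum.atMost_Suc_shift) (simp add: sum.atMost_Suc_shift add.assoc)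
  have z: "valleys (a # z # r) = valleys (z # r)" using a by (cases r) auto
  show ?case
  proof (cases "y < x \<and> y < z")
    case True
    (* Here the gaps on both sides of the valley y keep the number of valleys, and the
       remaining gaps follow from the induction hypothesis for g composed with Suc. *)
    have v: "?v = valleys (z # r)" using True by (cases r) auto
    have "(\<Sum>i\<le>length r. g (valleys (x # y # z # insert_at a i r))) =
      (\<Sum>i\<le>length r. (\<lambda>v. g (Suc v)) (valleys (y # z # insert_at a i r)))"
      using True by (intro sum.cong) auto
    also have "\<dots> = (2 + 2 * real ?v) * g (Suc ?v)
      + (real (length (y # z # r)) - 1 - 2 * real ?v) * g (Suc (Suc ?v))
      - g (Suc ?v) - g (Suc (Suc ?v))"
      using IH[of "\<lambda>v. g (Suc v)"] S'[of "\<lambda>v. g (Suc v)"] a z v by simp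
    finally have "(\<Sum>i\<le>length (x # y # z # r). g (valleys (insert_at a i (x # y # z # r)))) =
       3 * g (Suc ?v) + ((2 + 2 * real ?v) * g (Suc ?v)
      + (real (length (y # z # r)) - 1 - 2 * real ?v) * g (Suc (Suc ?v))
      - g (Suc ?v) - g (Suc (Suc ?v)))" unfolding S using True a v z by simp
    then show ?thesis using True by (simp add: algebra_simps)
  next
    case False
    have "(\<Sum>i\<le>length r. g (valleys (x # y # z # insert_at a i r))) =
      (\<Sum>i\<le>length r. g (valleys (y # z # insert_at a i r)))"
      using False by (intro sum.cong) auto
    also have "\<dots> = (2 + 2 * real ?v) * g ?v
      + (real (length (y # z # r)) - 1 - 2 * real ?v) * g (Suc ?v) - g ?v - g (valleys (y # a # z # r))"
      using IH[of g] S'[of g] a by simp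
    finally show ?thesis unfolding S using False a z by (auto simp: algebra_simps)
  qed
next
  case ("2_2" v)
  show ?case by simp
next
  case ("2_3" x y)
  have "a < x" "a < y" using "2_3"(2) by auto
  then show ?case by (simp add: numeral_2_eq_2 algebra_simps)
qed simp

lemma permutations_of_set_insert_min:
  fixes S :: "nat set"
  assumes "finite S" "a \<notin> S"
  shows "bij_betw (\<lambda>(xs, i). insert_at a i xs) (permutations_of_set S \<times> {..card S})
    (permutations_of_set (insert a S))"
proof -
  have set: "set (insert_at a i xs) = insert a (set xs)" for i xs
    by (induction xs arbitrary: i) (auto split: nat.splits)
  have dist: "distinct (insert_at a i xs) \<longleftrightarrow> a \<notin> set xs \<and> distinct xs" for i xs
    by (induction xs arbitrary: i) (auto split: nat.splits simp: set)
  have rem: "a \<notin> set xs \<Longrightarrow> removeAll a (insert_at a i xs) = xs" for i xs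
    by (induction xs arbitrary: i) (auto split: nat.splits)
  have pos: "a \<notin> set xs \<Longrightarrow> i \<le> length xs \<Longrightarrow> takeWhile (\<lambda>x. x \<noteq> a) (insert_at a i xs) = take i xs" for i xs
    by (induction xs arbitrary: i) (auto split: nat.splits)
  have ex: "insert_at a (length (takeWhile (\<lambda>x. x \<noteq> a) ys)) (removeAll a ys) = ys"
    if "a \<in> set ys" "distinct ys" for ys using that by (induction ys) auto
  have len: "length xs = card S" if "xs \<in> permutations_of_set S" for xs
    using that by (simp add: length_finite_permutations_of_set)
  show ?thesis
  proof (rule bij_betwI')
    fix p q assume pq: "p \<in> permutations_of_set S \<times> {..card S}" "q \<in> permutations_of_set S \<times> {..card S}"
    obtain xs i ys j where [simp]: "p = (xs,i)" "q = (ys,j)" by fastforce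
    have x: "a \<notin> set xs" "i \<le> length xs" "a \<notin> set ys" "j \<le> length ys"
      using pq assms len by (auto simp: permutations_of_set_def)
    show "((\<lambda>(xs, i). insert_at a i xs) p = (\<lambda>(xs, i). insert_at a i xs) q) = (p = q)"
    proof
      assume e: "(\<lambda>(xs, i). insert_at a i xs) p = (\<lambda>(xs, i). insert_at a i xs) q"
      have "xs = ys" using e rem[OF x(1)] rem[OF x(3)] by (metis \<open>p = (xs, i)\<close> \<open>q = (ys, j)\<close> case_prod_conv)
      moreover have "take i xs = take j ys" using e pos[OF x(1,2)] pos[OF x(3,4)]
        by (metis \<open>p = (xs, i)\<close> \<open>q = (ys, j)\<close> case_prod_conv)
      ultimately show "p = q" using x by (metis \<open>p = (xs, i)\<close> \<open>q = (ys, j)\<close> length_take min.absorb2)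
    qed simp
  next
    fix p assume "p \<in> permutations_of_set S \<times> {..card S}"
    then show "(\<lambda>(xs, i). insert_at a i xs) p \<in> permutations_of_set (insert a S)"
      using assms by (auto simp: permutations_of_set_def set dist)
  next
    fix ys assume ys: "ys \<in> permutations_of_set (insert a S)"
    then have "a \<in> set ys" "distinct ys" "set ys = insert a S" by (auto simp: permutations_of_set_def)
    let ?i = "length (takeWhile (\<lambda>x. x \<noteq> a) ys)" and ?xs = "removeAll a ys"
    have "?xs \<in> permutations_of_set S" using \<open>distinct ys\<close> \<open>set ys = _\<close> assms
      by (auto simp: permutations_of_set_def distinct_removeAll)
    moreover have "?i < length ys" using \<open>a \<in> set ys\<close>
      by (induction ys) auto
    moreover have "length ys = Suc (card S)" using ys assms by (simp add: length_finite_permutations_of_set)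
    ultimately show "\<exists>p\<in>permutations_of_set S \<times> {..card S}. ys = (\<lambda>(xs, i). insert_at a i xs) p"
      using ex[OF \<open>a \<in> set ys\<close> \<open>distinct ys\<close>] by (intro bexI[of _ "(?xs, ?i)"]) auto
  qed
qed

text \<open>
  For a probability generating function \<open>P\<close>, this is the expectation of \<open>g\<close>.
\<close>

definition weighted :: "real poly \<Rightarrow> (nat \<Rightarrow> real) \<Rightarrow> real" where
  "weighted P g = (\<Sum>v\<le>degree P. coeff P v * g v)"

lemma weighted_eq: "degree P \<le> d \<Longrightarrow> weighted P g = (\<Sum>v\<le>d. coeff P v * g v)"
  unfolding weighted_def by (rule sum.mono_neutral_left) (auto simp: coeff_eq_0)

lemma weighted_add: "weighted (P + Q) g = weighted P g + weighted Q g"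
proof -
  let ?d = "max (degree P) (degree Q)"
  show ?thesis using degree_add_le_max[of P Q]
    by (simp add: weighted_eq[of _ ?d] sum.distrib algebra_simps)
qed

lemma weighted_smult: "weighted (smult c P) g = c * weighted P g"
proof -
  show ?thesis using degree_smult_le[of c P]
    by (simp add: weighted_eq[of _ "degree P"] sum_distrib_left algebra_simps)
qed

lemma weighted_diff: "weighted (P - Q) g = weighted P g - weighted Q g"
  using weighted_add[of P "smult (-1) Q" g] weighted_smult[of "-1" Q g] by simp

lemma weighted_0 [simp]: "weighted 0 g = 0" by (simp add: weighted_def)

lemma weighted_pCons: "weighted (pCons c P) g = c * g 0 + weighted P (\<lambda>v. g (Suc v))"
proof -
  have "degree (pCons c P) \<le> Suc (degree P)" by (rule degree_pCons_le)
  then show ?thesis unfolding weighted_eq[OF \<open>_ \<le> _\<close>]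
    by (simp add: sum.atMost_Suc_shift weighted_def del: sum.atMost_Suc)
qed

lemma weighted_X_pderiv: "weighted (pCons 0 (pderiv P)) g = weighted P (\<lambda>v. real v * g v)"
proof (induction P arbitrary: g)
  case (pCons c P)
  have "weighted (pCons 0 (pderiv (pCons c P))) g = weighted P (\<lambda>v. g (Suc v))
     + weighted P (\<lambda>v. real v * g (Suc v))"
    using pCons(2)[of "\<lambda>v. g (Suc v)"] by (simp add: pderiv_pCons weighted_pCons weighted_add)
  also have "\<dots> = weighted P (\<lambda>v. real (Suc v) * g (Suc v))"
    by (simp add: weighted_def algebra_simps sum.distrib)
  finally show ?case by (simp add: weighted_pCons)
qed simp

lemma weighted_add_fun: "weighted P (\<lambda>v. f v + g v) = weighted P f + weighted P g"
  by (simp add: weighted_def algebra_simps sum.distrib)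
lemma weighted_diff_fun: "weighted P (\<lambda>v. f v - g v) = weighted P f - weighted P g"
  by (simp add: weighted_def algebra_simps sum_subtractf)
lemma weighted_mult_fun: "weighted P (\<lambda>v. c * g v) = c * weighted P g"
  by (simp add: weighted_def algebra_simps sum_distrib_left)
lemma weighted_power: "weighted P (\<lambda>v. x ^ v) = poly P x"
  by (simp add: weighted_def poly_altdef)

text \<open>
  The recursion is the insertion of a new minimum, read on generating polynomials; the index is one
  less than the number of cards.
\<close>

primrec valley_poly :: "nat \<Rightarrow> real poly" where
  "valley_poly 0 = 1"
| "valley_poly (Suc k) = [:2, real k:] * valley_poly k + [:0, 2, -2:] * pderiv (valley_poly k)"

lemma weighted_valley_poly_Suc:
  "weighted (valley_poly (Suc k)) g = weighted (valley_poly k)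
     (\<lambda>v. (2 + 2 * real v) * g v + (real k - 2 * real v) * g (Suc v))"
proof -
  let ?V = "valley_poly k"
  have "[:0, 2, -2:] * pderiv ?V = smult 2 (pCons 0 (pderiv ?V)) - smult 2 (pCons 0 (pCons 0 (pderiv ?V)))"
    by simp
  then have "valley_poly (Suc k) = smult 2 ?V + smult (real k) (pCons 0 ?V) +
     (smult 2 (pCons 0 (pderiv ?V)) - smult 2 (pCons 0 (pCons 0 (pderiv ?V))))"
    by simp
  then show ?thesis
    using weighted_pCons[of 0 "?V" g] weighted_pCons[of 0 "pCons 0 (pderiv ?V)" g]
    by (simp only: weighted_add weighted_diff weighted_smult weighted_X_pderiv)
      (simp add: weighted_def algebra_simps sum.distrib sum_distrib_left sum_subtractf)
qed

theorem sum_valleys_permutations: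
  fixes g :: "nat \<Rightarrow> real"
  assumes "finite S" "card S = Suc k"
  shows "(\<Sum>xs\<in>permutations_of_set S. g (valleys xs)) = weighted (valley_poly k) g"
  using assms
proof (induction k arbitrary: S g)
  case 0
  then obtain a where "S = {a}" using card_1_singletonE by auto
  then show ?case by (simp add: weighted_def)
next
  case (Suc k)
  define a where "a = Min S"
  define S' where "S' = S - {a}"
  have "a \<in> S" unfolding a_def using Suc.prems by (intro Min_in) auto
  then have S: "S = insert a S'" "a \<notin> S'" "finite S'" "card S' = Suc k"
    using Suc.prems by (auto simp: S'_def)
  have less: "a < x" if "x \<in> S'" for x
    using that Suc.prems unfolding S'_def a_def by (simp add: order_less_le)
  have "(\<Sum>xs\<in>permutations_of_set S. g (valleys xs)) =
    (\<Sum>(xs, i)\<in>permutations_of_set S' \<times> {..card S'}. g (valleys (insert_at a i xs)))"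
    unfolding S(1) by (subst sum.reindex_bij_betw[OF permutations_of_set_insert_min[OF S(3,2)], symmetric])
      (simp add: case_prod_unfold)
  also have "\<dots> = (\<Sum>xs\<in>permutations_of_set S'. \<Sum>i\<le>card S'. g (valleys (insert_at a i xs)))"
    by (rule sum.cartesian_product[symmetric])
  also have "\<dots> = (\<Sum>xs\<in>permutations_of_set S'.
     (\<lambda>v. (2 + 2 * real v) * g v + (real k - 2 * real v) * g (Suc v)) (valleys xs))"
  proof (rule sum.cong[OF refl])
    fix xs assume "xs \<in> permutations_of_set S'"
    then have "xs \<noteq> []" "set xs = S'" "length xs = Suc k"
      using S by (auto simp: permutations_of_set_def distinct_card)
    then show "(\<Sum>i\<le>card S'. g (valleys (insert_at a i xs))) =
      (\<lambda>v. (2 + 2 * real v) * g v + (real k - 2 * real v) * g (Suc v)) (valleys xs)"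
      using valleys_insert_sum[of xs a g] less S(4) by simp
  qed
  finally show ?case unfolding weighted_valley_poly_Suc using Suc.IH[OF S(3,4)] by simp
qed

section \<open>Real-rootedness of the valley polynomials\<close>

text \<open>
  Rolle's theorem applied between consecutive roots.
\<close>

lemma rolle_roots:
  fixes p :: "real poly"
  assumes "finite A" "A \<noteq> {}" "\<And>x. x \<in> A \<Longrightarrow> poly p x = 0"
  shows "\<exists>B. finite B \<and> Suc (card B) = card A \<and> B \<subseteq> {Min A<..<Max A} \<and> (\<forall>x\<in>B. poly (pderiv p) x = 0)"
  using assms
proof (induction A rule: finite_linorder_max_induct)
  case (insert b A)
  show ?case
  proof (cases "A = {}")
    case True
    then show ?thesis by (intro exI[of _ "{}"]) auto
  next
    case False
    then obtain B where B: "finite B" "Suc (card B) = card A" "B \<subseteq> {Min A<..<Max A}"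
      "\<forall>x\<in>B. poly (pderiv p) x = 0" using insert by auto
    have mA: "Max A \<in> A" "Max A < b" "Min A \<in> A" using False insert by auto
    have "\<exists>x>Max A. x < b \<and> poly p b - poly p (Max A) = (b - Max A) * poly (pderiv p) x"
      using mA by (intro poly_MVT)
    then obtain x where x: "Max A < x" "x < b" "poly (pderiv p) x = 0"
      using insert.prems(2)[of b] insert.prems(2)[of "Max A"] mA by auto
    have "x \<notin> B" using B(3) x by auto
    moreover have "Max (insert b A) = b" using insert False by (auto intro!: Max_eqI less_imp_le)
    moreover have "Min (insert b A) = Min A"
      using insert(1,2) False mA by (metis Min_insert less_imp_le min.absorb2)
    moreover have "Min A \<le> Max A" using insert(1) mA by simp
    moreover have "b \<notin> A" using insert(2) by auto
    moreover have "Min A < x" using \<open>Min A \<le> Max A\<close> x by linarith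
    ultimately have "finite (insert x B) \<and> Suc (card (insert x B)) = card (insert b A) \<and>
      insert x B \<subseteq> {Min (insert b A)<..<Max (insert b A)} \<and> (\<forall>y\<in>insert x B. poly (pderiv p) y = 0)"
      using B x mA insert(1) by auto
    then show ?thesis by blast
  qed
qed simp

text \<open>
  The derivative of order \<open>k + 1\<close> of the hyperbolic tangent is \<open>(1 - y\<^sup>2) * tanh_poly k\<close>,
  written as a polynomial in \<open>y = tanh\<close>. In this form real-rootedness is immediate, because the factor
  \<open>1 - y\<^sup>2\<close> supplies the two extra roots that Rolle's theorem consumes.
\<close>

primrec tanh_poly :: "nat \<Rightarrow> real poly" where
  "tanh_poly 0 = 1"
| "tanh_poly (Suc k) = pderiv ([:1, 0, -1:] * tanh_poly k)"

lemma tanh_poly_roots: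
  "\<exists>B. finite B \<and> card B = k \<and> B \<subseteq> {-1<..<1} \<and> (\<forall>x\<in>B. poly (tanh_poly k) x = 0)"
proof (induction k)
  case (Suc k)
  then obtain B where B: "finite B" "card B = k" "B \<subseteq> {-1<..<1}" "\<forall>x\<in>B. poly (tanh_poly k) x = 0" by auto
  let ?A = "insert (-1) (insert 1 B)"
  have "1 \<notin> B" "-1 \<notin> insert 1 B" using B by auto
  then have c: "card ?A = Suc (Suc k)" using B by simp
  have mm: "Max ?A = 1" "Min ?A = -1" by (rule Max_eqI, use B in force, use B in force, simp)
    (rule Min_eqI, use B in force, use B in force, simp)
  have "\<exists>B'. finite B' \<and> Suc (card B') = card ?A \<and> B' \<subseteq> {Min ?A<..<Max ?A} \<and>
     (\<forall>x\<in>B'. poly (pderiv ([:1, 0, -1:] * tanh_poly k)) x = 0)"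
    by (rule rolle_roots) (use B in auto)
  then show ?case using c mm by auto
qed (auto intro!: exI[of _ "{}"])

text \<open>
  Both sides satisfy the same recursion: the substitution \<open>s = 1 - 1/y\<^sup>2\<close> turns differentiation of
  \<open>(1 - y\<^sup>2) * tanh_poly k\<close> into the insertion operator of \<open>valley_poly\<close>. A root \<open>y\<close> in \<open>(-1, 1)\<close> thus
  becomes a negative root \<open>s\<close>, and \<open>y\<^sup>2 = 1/(1 - s)\<close> is the matching Bernoulli parameter.
\<close>

lemma tanh_poly_valley_poly:
  "y \<noteq> 0 \<Longrightarrow> poly (tanh_poly k) y = (- y) ^ k * poly (valley_poly k) (1 - 1 / y\<^sup>2)"
proof (induction k arbitrary: y)
  case (Suc k)
  let ?V = "valley_poly k" and ?s = "1 - 1 / y\<^sup>2"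
  let ?Q = "[:1, 0, -1:] * tanh_poly k"
  have Q: "poly ?Q x = (1 - x\<^sup>2) * ((- x) ^ k * poly ?V (1 - 1 / x\<^sup>2))" if "x \<in> - {0}" for x
    using Suc.IH[of x] that by (simp add: algebra_simps power2_eq_square)
  define D where "D = - 2 * y * ((- y) ^ k * poly ?V ?s) + (1 - y\<^sup>2) *
      (- (real k * (- y) ^ (k - 1)) * poly ?V ?s + (- y) ^ k * (poly (pderiv ?V) ?s * (2 / y ^ 3)))"
  have "((\<lambda>x. (1 - x\<^sup>2) * ((- x) ^ k * poly ?V (1 - 1 / x\<^sup>2))) has_field_derivative D) (at y)"
    unfolding D_def using Suc.prems
    by (auto intro!: derivative_eq_intros DERIV_chain2[OF poly_DERIV] simp: power2_eq_square power3_eq_cube field_simps)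
  then have "(poly ?Q has_field_derivative D) (at y)"
    by (rule has_field_derivative_transform_within_open[of _ _ _ "- {0}"]) (use Suc.prems Q in auto)
  then have "poly (pderiv ?Q) y = D" using poly_DERIV DERIV_unique by blast
  also have "D = (- y) ^ Suc k * ((2 + real k * ?s) * poly ?V ?s + (2 * ?s * (1 - ?s)) * poly (pderiv ?V) ?s)"
  proof -
    have k: "real k * (- y) ^ (k - 1) * (1 - y\<^sup>2) = - ((-y) ^ Suc k * (real k * ?s))"
      using Suc.prems by (cases k) (simp_all add: field_simps power2_eq_square)
    have k2: "(1 - y\<^sup>2) * (2 / y ^ 3) * (-y) ^ k = (-y) ^ Suc k * (2 * ?s * (1 - ?s))"
      using Suc.prems by (simp add: field_simps power2_eq_square power3_eq_cube)
    have "D = (-y) ^ Suc k * 2 * poly ?V ?s - (real k * (- y) ^ (k - 1) * (1 - y\<^sup>2)) * poly ?V ?s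
        + ((1 - y\<^sup>2) * (2 / y ^ 3) * (-y) ^ k) * poly (pderiv ?V) ?s"
      unfolding D_def by (simp add: algebra_simps)
    also have "\<dots> = (-y) ^ Suc k * 2 * poly ?V ?s - (- ((-y) ^ Suc k * (real k * ?s))) * poly ?V ?s
        + ((-y) ^ Suc k * (2 * ?s * (1 - ?s))) * poly (pderiv ?V) ?s" unfolding k k2 ..
    finally have D: "D = \<dots>" .
    have "A * 2 * v - - (A * (real k * s)) * v + A * (2 * s * (1 - s)) * w =
      A * ((2 + real k * s) * v + (2 * s * (1 - s)) * w)" for A v s w :: real
      by (simp add: algebra_simps)
    then show ?thesis unfolding D .
  qed
  also have "(2 + real k * s) * poly ?V s + (2 * s * (1 - s)) * poly (pderiv ?V) s = poly (valley_poly (Suc k)) s" for s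
    by (simp add: algebra_simps)
  finally show ?case by simp
qed simp

lemma poly_valley_poly_1: "poly (valley_poly k) 1 = fact (Suc k)"
proof (induction k)
  case (Suc k)
  have "poly (valley_poly (Suc k)) 1 = (2 + real k) * fact (Suc k)"
    unfolding Suc[symmetric] by (simp add: algebra_simps)
  also have "\<dots> = fact (Suc (Suc k))" unfolding fact_Suc[of "Suc k"] by simp
  finally show ?case .
qed simp

text \<open>
  Two valleys are never adjacent. In the recursion the factor \<open>k - 2u\<close> vanishes exactly where the
  degree would grow too fast.
\<close>

lemma degree_valley_poly: "degree (valley_poly k) \<le> k div 2"
proof (induction k)
  case (Suc k)
  show ?case
  proof (rule degree_le, intro allI impI)
    fix v assume v: "Suc k div 2 < v"
    then obtain u where u: "v = Suc u" by (cases v) auto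
    have "degree (valley_poly k) < v" using Suc v by linarith
    then have 0: "coeff (valley_poly k) v = 0" "coeff (valley_poly k) (Suc u) = 0" using coeff_eq_0 u by auto
    have c: "coeff (valley_poly (Suc k)) v = (2 + 2 * real v) * coeff (valley_poly k) v + (real k - 2 * real u) * coeff (valley_poly k) u"
      unfolding u by (simp add: coeff_pderiv coeff_pCons algebra_simps split: nat.splits)
    show "coeff (valley_poly (Suc k)) v = 0"
    proof (cases "k = 2 * u")
      case False
      then have "k div 2 < u" using v u by auto
      then show ?thesis using c 0 Suc by (simp add: coeff_eq_0)
    qed (use c 0 in simp)
  qed
qed simp

lemma poly_eq_prod_roots:
  fixes p :: "'a :: field poly"
  assumes "finite S" "\<And>s. s \<in> S \<Longrightarrow> poly p s = 0"
  shows "\<exists>q. p = q * (\<Prod>s\<in>S. [:- s, 1:])"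
  using assms
proof (induction S rule: finite_induct)
  case (insert a S)
  then obtain q where q: "p = q * (\<Prod>s\<in>S. [:- s, 1:])" by auto
  have "poly (\<Prod>s\<in>S. [:- s, 1:]) a \<noteq> 0" using insert by (auto simp: poly_prod)
  then have "poly q a = 0" using insert.prems[of a] q by simp
  then obtain r where "q = [:- a, 1:] * r" by (auto simp: poly_eq_0_iff_dvd)
  then have "p = r * ([:- a, 1:] * (\<Prod>s\<in>S. [:- s, 1:]))" unfolding q by (simp only: mult_ac)
  then show ?case unfolding prod.insert[OF insert(1,2)] by blast
qed auto

text \<open>
  The \<open>k\<close> roots of \<open>tanh_poly k\<close> give at least \<open>k div 2\<close> different squares \<open>p = y\<^sup>2 > 0\<close>, hence as many
  roots \<open>1 - 1/p\<close> of \<open>valley_poly k\<close>, and its degree leaves no room for further factors. Normalised at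
  \<open>1\<close>, each linear factor is the generating function of a Bernoulli variable with parameter \<open>p\<close>.
\<close>

theorem valley_poly_factor:
  "\<exists>P. finite P \<and> P \<subseteq> {0<..<1} \<and> valley_poly k = smult (fact (Suc k)) (\<Prod>p\<in>P. [:1 - p, p:])"
proof -
  obtain B where B: "finite B" "card B = k" "B \<subseteq> {-1<..<1}" "\<forall>x\<in>B. poly (tanh_poly k) x = 0"
    using tanh_poly_roots by blast
  define P where "P = (\<lambda>y. y\<^sup>2) ` (B - {0})"
  have fP: "finite P" using B by (simp add: P_def)
  have P01: "P \<subseteq> {0<..<1}" using B(3) by (force simp: P_def abs_square_less_1)
  have root: "poly (valley_poly k) (1 - 1 / p) = 0" if p: "p \<in> P" for p
  proof -
    obtain y where y: "y \<in> B" "y \<noteq> 0" "p = y\<^sup>2" using p by (auto simp: P_def)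
    then show ?thesis using tanh_poly_valley_poly[of y k] B(4) by simp
  qed
  (* Squaring is at most two-to-one on the roots. *)
  have "B - {0} \<subseteq> sqrt ` P \<union> (\<lambda>p. - sqrt p) ` P"
  proof
    fix y assume y: "y \<in> B - {0}"
    show "y \<in> sqrt ` P \<union> (\<lambda>p. - sqrt p) ` P"
    proof (cases "y > 0")
      case True
      then have "y = sqrt (y\<^sup>2)" by simp
      then show ?thesis using y unfolding P_def by blast
    next
      case False
      then have "y = - sqrt (y\<^sup>2)" by simp
      then show ?thesis using y unfolding P_def by blast
    qed
  qed
  then have "card (B - {0}) \<le> card (sqrt ` P \<union> (\<lambda>p. - sqrt p) ` P)" using fP by (intro card_mono) auto
  also have "\<dots> \<le> card P + card P"
    by (rule order_trans[OF card_Un_le]) (intro add_mono card_image_le fP)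
  finally have "k - 1 \<le> 2 * card P" using B(1,2) by (cases "0 \<in> B") auto
  then have cP: "k div 2 \<le> card P" by linarith
  define S where "S = (\<lambda>p. 1 - 1 / p) ` P"
  have inj: "inj_on (\<lambda>p. 1 - 1 / p) P" using P01 by (auto simp: inj_on_def)
  obtain q where q: "valley_poly k = q * (\<Prod>s\<in>S. [:- s, 1:])"
    using poly_eq_prod_roots[of S "valley_poly k"] fP root by (auto simp: S_def)
  have nz: "valley_poly k \<noteq> 0" using poly_valley_poly_1[of k] by (metis fact_nonzero poly_0)
  have "degree (\<Prod>s\<in>S. [:- s, 1:]) = card P"
    using card_image[OF inj] by (subst degree_prod_eq_sum_degree) (auto simp: S_def)
  moreover have "degree (valley_poly k) = degree q + degree (\<Prod>s\<in>S. [:- s, 1:])"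
    unfolding q by (rule degree_mult_eq) (use nz q in auto)
  ultimately have "degree q = 0" using degree_valley_poly[of k] cP by linarith
  then obtain c where "q = [:c:]" by (metis degree_eq_zeroE)
  then have V: "valley_poly k = smult c (\<Prod>p\<in>P. [:- (1 - 1 / p), 1:])"
    using q prod.reindex[OF inj, of "\<lambda>s. [:- s, 1:]"] by (simp add: S_def o_def)
  also have "(\<Prod>p\<in>P. [:- (1 - 1 / p), 1:]) = (\<Prod>p\<in>P. smult (1 / p) [:1 - p, p:])"
    using P01 by (intro prod.cong) (auto simp: field_simps)
  also have "\<dots> = smult (\<Prod>p\<in>P. 1 / p) (\<Prod>p\<in>P. [:1 - p, p:])" by (rule prod_smult)
  finally have V: "valley_poly k = smult (c * (\<Prod>p\<in>P. 1 / p)) (\<Prod>p\<in>P. [:1 - p, p:])" by simp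
  have "poly (valley_poly k) 1 = c * (\<Prod>p\<in>P. 1 / p)"
    by (subst V) (simp add: poly_prod)
  then have c: "c * (\<Prod>p\<in>P. 1 / p) = fact (Suc k)" unfolding poly_valley_poly_1 by (rule sym)
  show ?thesis using V fP P01 unfolding c by blast
qed

section \<open>Sums of independent Bernoulli variables\<close>

text \<open>
  The generating function of a sum of independent Bernoulli variables. The parameters form a set, as
  those of the valley polynomials are pairwise different.
\<close>

definition bernoulli_poly :: "real set \<Rightarrow> real poly" where
  "bernoulli_poly P = (\<Prod>p\<in>P. [:1 - p, p:])"

lemma weighted_sum: "weighted (\<Sum>i\<in>I. P i) g = (\<Sum>i\<in>I. weighted (P i) g)"
  by (induction I rule: infinite_finite_induct) (auto simp: weighted_add)

lemma bernoulli_poly_remove: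
  "finite P \<Longrightarrow> p \<in> P \<Longrightarrow> bernoulli_poly P = [:1 - p, p:] * bernoulli_poly (P - {p})"
  unfolding bernoulli_poly_def by (rule prod.remove)

lemma weighted_bernoulli_remove:
  assumes "finite P" "p \<in> P"
  shows "weighted (bernoulli_poly P) g =
    (1 - p) * weighted (bernoulli_poly (P - {p})) g + p * weighted (bernoulli_poly (P - {p})) (\<lambda>v. g (Suc v))"
proof -
  have "bernoulli_poly P = smult (1 - p) (bernoulli_poly (P - {p})) + smult p (pCons 0 (bernoulli_poly (P - {p})))"
    by (subst bernoulli_poly_remove[OF assms]) simp
  then show ?thesis by (simp only: weighted_add weighted_smult weighted_pCons) simp
qed

lemma coeff_bernoulli_poly_nonneg:
  "finite P \<Longrightarrow> P \<subseteq> {0..1} \<Longrightarrow> coeff (bernoulli_poly P) v \<ge> 0"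
proof (induction P arbitrary: v rule: finite_induct)
  case (insert p P)
  have "bernoulli_poly (insert p P) = [:1 - p, p:] * bernoulli_poly P"
    using insert by (simp add: bernoulli_poly_def)
  then show ?case using insert by (cases v) (auto simp: coeff_pCons)
qed (simp add: bernoulli_poly_def)

lemma weighted_bernoulli_nonneg:
  "finite P \<Longrightarrow> P \<subseteq> {0..1} \<Longrightarrow> (\<And>v. v \<le> degree (bernoulli_poly P) \<Longrightarrow> g v \<ge> 0) \<Longrightarrow> weighted (bernoulli_poly P) g \<ge> 0"
  unfolding weighted_def by (intro sum_nonneg mult_nonneg_nonneg coeff_bernoulli_poly_nonneg) auto

lemma weighted_bernoulli_mono:
  assumes "finite P" "P \<subseteq> {0..1}" "\<And>v. v \<le> degree (bernoulli_poly P) \<Longrightarrow> f v \<le> g v"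
  shows "weighted (bernoulli_poly P) f \<le> weighted (bernoulli_poly P) g"
  using weighted_bernoulli_nonneg[OF assms(1,2), of "\<lambda>v. g v - f v"] assms(3)
  by (simp add: weighted_diff_fun)

lemma weighted_bernoulli_const [simp]: "weighted (bernoulli_poly P) (\<lambda>v. c) = c"
  using weighted_power[of "bernoulli_poly P" 1] weighted_mult_fun[of "bernoulli_poly P" c "\<lambda>_. 1"]
  by (simp add: bernoulli_poly_def poly_prod)

lemma weighted_bernoulli_abs_le:
  assumes "finite P" "P \<subseteq> {0..1}" "\<And>v. v \<le> degree (bernoulli_poly P) \<Longrightarrow> \<bar>f v\<bar> \<le> g v"
  shows "\<bar>weighted (bernoulli_poly P) f\<bar> \<le> weighted (bernoulli_poly P) g"
proof -
  have "weighted (bernoulli_poly P) f \<le> weighted (bernoulli_poly P) g"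
    by (rule weighted_bernoulli_mono[OF assms(1,2)]) (use assms(3) in force)
  moreover have "weighted (bernoulli_poly P) (\<lambda>v. - 1 * f v) \<le> weighted (bernoulli_poly P) g"
    by (rule weighted_bernoulli_mono[OF assms(1,2)]) (use assms(3) in force)
  ultimately show ?thesis unfolding weighted_mult_fun by linarith
qed

lemma degree_bernoulli_poly:
  assumes "finite P" "0 \<notin> P"
  shows "degree (bernoulli_poly P) = card P"
proof -
  have "degree (bernoulli_poly P) = (\<Sum>p\<in>P. degree [:1 - p, p:])"
    unfolding bernoulli_poly_def by (rule degree_prod_eq_sum_degree) auto
  also have "\<dots> = (\<Sum>p\<in>P. 1)" by (rule sum.cong) (use assms in auto)
  finally show ?thesis by simp
qed

text \<open>
  The discrete form of Gaussian integration by parts. It is the identity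
  \<open>X P' - \<lambda> P = (\<Sum>p. p (1 - p) (X - 1) P\<^sub>p)\<close> for \<open>P = bernoulli_poly\<close>, where \<open>P\<^sub>p\<close> omits the factor of
  \<open>p\<close> and \<open>\<lambda>\<close> is the sum of the parameters.
\<close>

theorem bernoulli_stein_identity:
  assumes "finite P"
  shows "weighted (bernoulli_poly P) (\<lambda>v. (real v - \<Sum>P) * g v) =
    (\<Sum>p\<in>P. p * (1 - p) * weighted (bernoulli_poly (P - {p})) (\<lambda>v. g (Suc v) - g v))"
proof -
  let ?B = bernoulli_poly
  have d: "pderiv (?B P) = (\<Sum>p\<in>P. smult p (?B (P - {p})))"
    unfolding bernoulli_poly_def by (simp add: pderiv_prod pderiv_pCons)
  have "weighted (?B P) (\<lambda>v. real v * g v) = (\<Sum>p\<in>P. p * weighted (?B (P - {p})) (\<lambda>v. g (Suc v)))"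
    unfolding weighted_X_pderiv[symmetric] weighted_pCons by (simp add: d weighted_sum weighted_smult)
  moreover have "weighted (?B P) (\<lambda>v. \<Sum>P * g v) = (\<Sum>p\<in>P. p * weighted (?B P) g)"
    unfolding weighted_mult_fun by (simp add: sum_distrib_right)
  ultimately have "weighted (?B P) (\<lambda>v. (real v - \<Sum>P) * g v) =
    (\<Sum>p\<in>P. p * weighted (?B (P - {p})) (\<lambda>v. g (Suc v)) - p * weighted (?B P) g)"
    by (simp add: left_diff_distrib weighted_diff_fun sum_subtractf)
  also have "\<dots> = (\<Sum>p\<in>P. p * (1 - p) * weighted (?B (P - {p})) (\<lambda>v. g (Suc v) - g v))"
  proof (intro sum.cong refl)
    fix p assume "p \<in> P"
    show "p * weighted (?B (P - {p})) (\<lambda>v. g (Suc v)) - p * weighted (?B P) g =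
       p * (1 - p) * weighted (?B (P - {p})) (\<lambda>v. g (Suc v) - g v)"
      unfolding weighted_bernoulli_remove[OF assms \<open>p \<in> P\<close>, of g] weighted_diff_fun
      by (simp add: algebra_simps)
  qed
  finally show ?thesis .
qed

lemma bernoulli_mean:
  assumes "finite P"
  shows "weighted (bernoulli_poly P) real = \<Sum>P"
  using bernoulli_stein_identity[OF assms, of "\<lambda>_. 1"] weighted_diff_fun[of "bernoulli_poly P" real "\<lambda>_. \<Sum>P"]
  by simp

lemma bernoulli_variance:
  assumes "finite P"
  shows "weighted (bernoulli_poly P) (\<lambda>v. (real v - \<Sum>P)\<^sup>2) = (\<Sum>p\<in>P. p * (1 - p))"
  using bernoulli_stein_identity[OF assms, of "\<lambda>v. real v - \<Sum>P"]
  by (simp add: power2_eq_square)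

lemma exp_taylor2_bound:
  fixes u :: real
  assumes "\<bar>u\<bar> \<le> 1 / 2"
  shows "\<bar>exp u - (1 + u + u\<^sup>2 / 2)\<bar> \<le> \<bar>u\<bar> ^ 3"
proof -
  obtain t where t: "\<bar>t\<bar> \<le> \<bar>u\<bar>" "exp u = (\<Sum>m<3. u ^ m / fact m) + exp t / fact 3 * u ^ 3"
    using Maclaurin_exp_le[of u 3] by auto
  have "exp t \<le> exp (1 / 2)" using t assms by simp
  also have "exp (1 / 2) \<le> (2::real)"
    using exp_bound[of "1 / 2 :: real"] by (simp add: power2_eq_square)
  finally have "exp t \<le> 6" by simp
  have "exp u - (1 + u + u\<^sup>2 / 2) = exp t / 6 * u ^ 3"
    using t by (simp add: eval_nat_numeral lessThan_Suc)
  then have "\<bar>exp u - (1 + u + u\<^sup>2 / 2)\<bar> = exp t / 6 * \<bar>u\<bar> ^ 3" by (simp only: abs_mult power_abs) simp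
  also have "\<dots> \<le> 1 * \<bar>u\<bar> ^ 3" using \<open>exp t \<le> 6\<close> by (intro mult_right_mono) auto
  finally show ?thesis by simp
qed

text \<open>
  Relative errors of at most \<open>\<delta>\<close> in each factor accumulate to at most \<open>(1 + \<delta>)\<^sup>n - 1\<close>.
\<close>

lemma prod_near_1:
  fixes \<rho> :: "'a \<Rightarrow> real"
  assumes "finite P" "\<And>p. p \<in> P \<Longrightarrow> \<bar>\<rho> p\<bar> \<le> \<delta>"
  shows "\<bar>(\<Prod>p\<in>P. 1 + \<rho> p) - 1\<bar> \<le> (1 + \<delta>) ^ card P - 1"
  using assms
proof (induction P rule: finite_induct)
  case (insert p P)
  let ?Q = "\<Prod>p\<in>P. 1 + \<rho> p"
  have IH: "\<bar>?Q - 1\<bar> \<le> (1 + \<delta>) ^ card P - 1" using insert by auto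
  have \<delta>: "\<bar>\<rho> p\<bar> \<le> \<delta>" "0 \<le> \<delta>" using insert.prems[of p] by auto
  have "(1 + \<rho> p) * ?Q - 1 = (1 + \<rho> p) * (?Q - 1) + \<rho> p" by (simp add: algebra_simps)
  also have "\<bar>\<dots>\<bar> \<le> \<bar>1 + \<rho> p\<bar> * \<bar>?Q - 1\<bar> + \<bar>\<rho> p\<bar>" by (metis abs_mult abs_triangle_ineq)
  also have "\<dots> \<le> (1 + \<delta>) * ((1 + \<delta>) ^ card P - 1) + \<delta>"
    using \<delta> IH by (intro add_mono mult_mono) auto
  also have "\<dots> = (1 + \<delta>) ^ Suc (card P) - 1" by (simp add: algebra_simps)
  finally show ?case using insert by simp
qed simp

text \<open>
  By independence the Laplace transform is a product. Each centred factor agrees with the factor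
  \<open>exp(a\<^sup>2 p (1 - p) / 2)\<close> of a normal variable up to the third-order term of the exponential series.
\<close>

theorem bernoulli_laplace:
  fixes a :: real
  assumes "finite P" "P \<subseteq> {0..1}" "0 \<le> a" "a \<le> 1 / 2"
  defines "q \<equiv> exp (a\<^sup>2 * (\<Sum>p\<in>P. p * (1 - p)) / 2)"
  shows "\<bar>weighted (bernoulli_poly P) (\<lambda>v. exp (- a * (real v - \<Sum>P))) - q\<bar> \<le> q * (exp (2 * real (card P) * a ^ 3) - 1)"
proof -
  define x where "x p = (1 - p) * exp (a * p) + p * exp (- a * (1 - p))" for p
  define y where "y p = exp (a\<^sup>2 * (p * (1 - p)) / 2)" for p
  have "weighted (bernoulli_poly P) (\<lambda>v. exp (- a * (real v - \<Sum>P)))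
     = exp (a * \<Sum>P) * weighted (bernoulli_poly P) (\<lambda>v. exp (- a) ^ v)"
    unfolding weighted_mult_fun[symmetric]
    by (simp add: algebra_simps exp_add exp_diff exp_minus exp_of_nat_mult[symmetric] divide_simps)
  also have "\<dots> = (\<Prod>p\<in>P. exp (a * p)) * (\<Prod>p\<in>P. 1 - p + p * exp (- a))"
    unfolding weighted_power by (simp add: bernoulli_poly_def poly_prod exp_sum[OF assms(1), symmetric] sum_distrib_left algebra_simps)
  also have "\<dots> = (\<Prod>p\<in>P. x p)"
    unfolding prod.distrib[symmetric] x_def
    by (intro prod.cong) (auto simp: algebra_simps exp_add exp_diff exp_minus divide_inverse)
  finally have M: "weighted (bernoulli_poly P) (\<lambda>v. exp (- a * (real v - \<Sum>P))) = (\<Prod>p\<in>P. x p)" .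
  have q: "q = (\<Prod>p\<in>P. y p)" unfolding q_def y_def
    by (simp add: exp_sum[OF assms(1), symmetric] sum_distrib_left sum_divide_distrib)
  have xy: "\<bar>x p / y p - 1\<bar> \<le> 2 * a ^ 3" if "p \<in> P" for p
  proof -
    have p: "0 \<le> p" "p \<le> 1" using that assms by auto
    have "\<bar>exp (a * p) - (1 + a * p + (a * p)\<^sup>2 / 2)\<bar> \<le> \<bar>a * p\<bar> ^ 3"
      using p assms mult_mono[of a "1/2" p 1] by (intro exp_taylor2_bound) auto
    also have "\<dots> \<le> a ^ 3" using p assms mult_left_le[of p a] by (intro power_mono) (auto simp: abs_mult)
    finally have e1: "\<bar>exp (a * p) - (1 + a * p + (a * p)\<^sup>2 / 2)\<bar> \<le> a ^ 3" .
    have "\<bar>exp (- a * (1 - p)) - (1 + - a * (1 - p) + (- a * (1 - p))\<^sup>2 / 2)\<bar> \<le> \<bar>- a * (1 - p)\<bar> ^ 3"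
      using p assms mult_mono[of a "1/2" "1-p" 1] by (intro exp_taylor2_bound) (auto simp: abs_mult)
    also have "\<dots> \<le> a ^ 3" using p assms mult_left_le[of "1-p" a] by (intro power_mono) (auto simp: abs_mult)
    finally have e2: "\<bar>exp (- a * (1 - p)) - (1 + - a * (1 - p) + (- a * (1 - p))\<^sup>2 / 2)\<bar> \<le> a ^ 3" .
    define w where "w = a\<^sup>2 * (p * (1 - p)) / 2"
    have pp: "0 \<le> p * (1 - p)" "p * (1 - p) \<le> 1" using p mult_mono[of p 1 "1-p" 1] by auto
    have a1: "a\<^sup>2 \<le> a / 2" using assms mult_left_mono[of a "1/2" a] by (auto simp: power2_eq_square)
    (* The remainder of exp w is of fourth order in a; for a <= 1/2 it is absorbed by a ^ 3. *)
    have w: "0 \<le> w" "w \<le> a\<^sup>2 / 2" unfolding w_def using pp mult_left_le[of "p * (1-p)" "a\<^sup>2"] by auto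
    then have "w \<le> 1" using a1 assms by linarith
    have "x p - (1 + w) = (1 - p) * (exp (a * p) - (1 + a * p + (a * p)\<^sup>2 / 2)) +
       p * (exp (- a * (1 - p)) - (1 + - a * (1 - p) + (- a * (1 - p))\<^sup>2 / 2))"
      unfolding x_def w_def by (simp add: field_simps power2_eq_square)
    also have "\<bar>\<dots>\<bar> \<le> (1 - p) * a ^ 3 + p * a ^ 3"
      using e1 e2 p by (intro order_trans[OF abs_triangle_ineq] add_mono) (auto simp: abs_mult intro!: mult_left_mono)
    finally have xw: "\<bar>x p - (1 + w)\<bar> \<le> a ^ 3" by (simp add: algebra_simps)
    have "exp w \<le> 1 + w + w\<^sup>2" using w \<open>w \<le> 1\<close> by (intro exp_bound) auto
    moreover have "1 + w \<le> exp w" by simp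
    moreover have "w\<^sup>2 \<le> a ^ 3"
    proof -
      have "w\<^sup>2 \<le> (a\<^sup>2 / 2)\<^sup>2" using w by (intro power_mono) auto
      also have "\<dots> = a ^ 3 * (a / 4)" by (simp add: power2_eq_square power3_eq_cube)
      also have "\<dots> \<le> a ^ 3 * 1" using assms by (intro mult_left_mono) auto
      finally show ?thesis by simp
    qed
    ultimately have "\<bar>x p - y p\<bar> \<le> 2 * a ^ 3" using xw unfolding y_def w_def[symmetric] by linarith
    moreover have "y p \<ge> 1" unfolding y_def w_def[symmetric] using w by simp
    moreover have "\<bar>x p / y p - 1\<bar> = \<bar>x p - y p\<bar> / y p" using \<open>y p \<ge> 1\<close> by (simp add: field_simps abs_divide)
    moreover have "\<bar>x p - y p\<bar> / y p \<le> \<bar>x p - y p\<bar> / 1" using \<open>y p \<ge> 1\<close> by (intro divide_left_mono) auto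
    ultimately show ?thesis by simp
  qed
  have "\<bar>(\<Prod>p\<in>P. 1 + (x p / y p - 1)) - 1\<bar> \<le> (1 + 2 * a ^ 3) ^ card P - 1"
    by (rule prod_near_1[OF assms(1) xy])
  also have "(1 + 2 * a ^ 3) ^ card P \<le> exp (2 * a ^ 3) ^ card P"
    using assms by (intro power_mono) auto
  also have "\<dots> = exp (2 * real (card P) * a ^ 3)" by (simp add: exp_of_nat_mult[symmetric] mult_ac)
  finally have r: "\<bar>(\<Prod>p\<in>P. x p / y p) - 1\<bar> \<le> exp (2 * real (card P) * a ^ 3) - 1" by simp
  have "(\<Prod>p\<in>P. x p) - q = q * ((\<Prod>p\<in>P. x p / y p) - 1)"
    unfolding q prod_dividef by (simp add: y_def algebra_simps assms(1))
  then show ?thesis unfolding M using r by (simp add: abs_mult q_def)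
qed

text \<open>
  The recursion of \<open>valley_poly\<close>, tested with \<open>1\<close>, \<open>v\<close> and \<open>v\<^sup>2\<close>, gives linear recursions for the moments.
  In that of the second moment the coefficient \<open>k - 2\<close> vanishes at \<open>k = 2\<close>, which is why the closed
  form starts at \<open>k = 3\<close>.
\<close>

lemma valley_moments:
  "weighted (valley_poly k) (\<lambda>_. 1) = fact (Suc k)"
  "k \<ge> 1 \<Longrightarrow> weighted (valley_poly k) real = (real k - 1) / 3 * fact (Suc k)"
  "k \<ge> 3 \<Longrightarrow> weighted (valley_poly k) (\<lambda>v. (real v)\<^sup>2) = (2 * (real k + 2) / 45 + ((real k - 1) / 3)\<^sup>2) * fact (Suc k)"
proof -
  show 0: "weighted (valley_poly k) (\<lambda>_. 1) = fact (Suc k)" for k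
    using weighted_power[of "valley_poly k" 1] poly_valley_poly_1[of k] by simp
  have s1: "weighted (valley_poly (Suc k)) real = real k * (weighted (valley_poly k) real + fact (Suc k))" for k
    unfolding weighted_valley_poly_Suc 0[symmetric] weighted_add_fun[symmetric] weighted_mult_fun[symmetric]
    by (intro arg_cong[of _ _ "weighted (valley_poly k)"] ext) (simp add: algebra_simps)
  show 1: "weighted (valley_poly k) real = (real k - 1) / 3 * fact (Suc k)" if "k \<ge> 1" for k
    using that
  proof (induction k rule: nat_induct_at_least)
    case base
    show ?case using s1[of 0] by simp
  next
    case (Suc k)
    have "weighted (valley_poly (Suc k)) real = real k / 3 * ((real k + 2) * fact (Suc k))"
      unfolding s1 Suc.IH by (simp add: field_simps)
    also have "(real k + 2) * fact (Suc k) = fact (Suc (Suc k))" by simp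
    finally show ?case by simp
  qed
  have s2: "weighted (valley_poly (Suc k)) (\<lambda>v. (real v)\<^sup>2) = (real k - 2) * weighted (valley_poly k) (\<lambda>v. (real v)\<^sup>2)
     + (2 * real k - 2) * weighted (valley_poly k) real + real k * fact (Suc k)" for k
    unfolding weighted_valley_poly_Suc 0[symmetric] weighted_add_fun[symmetric] weighted_mult_fun[symmetric]
    by (intro arg_cong[of _ _ "weighted (valley_poly k)"] ext) (simp add: algebra_simps power2_eq_square)
  show "weighted (valley_poly k) (\<lambda>v. (real v)\<^sup>2) = (2 * (real k + 2) / 45 + ((real k - 1) / 3)\<^sup>2) * fact (Suc k)" if "k \<ge> 3"
    using that
  proof (induction k rule: nat_induct_at_least)
    case base
    show ?case using s2[of 2] 1[of 2] by (simp add: eval_nat_numeral)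
  next
    case (Suc k)
    have "weighted (valley_poly (Suc k)) (\<lambda>v. (real v)\<^sup>2) =
      (2 * (real (Suc k) + 2) / 45 + ((real (Suc k) - 1) / 3)\<^sup>2) * ((real k + 2) * fact (Suc k))"
    proof -
      have "(r - 2) * ((2 * (r + 2) / 45 + ((r - 1) / 3)\<^sup>2) * F) + (2 * r - 2) * ((r - 1) / 3 * F) + r * F
        = (2 * (1 + r + 2) / 45 + ((1 + r - 1) / 3)\<^sup>2) * ((r + 2) * F)" for r F :: real
        by (simp add: field_simps power2_eq_square)
      moreover have "weighted (valley_poly k) real = (real k - 1) / 3 * fact (Suc k)"
        by (rule 1) (use Suc.hyps in simp)
      ultimately show ?thesis unfolding s2 Suc.IH by (simp only: of_nat_Suc)
    qed
    also have "(real k + 2) * fact (Suc k) = fact (Suc (Suc k))" by simp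
    finally show ?case .
  qed
qed

theorem valley_poly_bernoulli:
  assumes "k \<ge> 3"
  shows "\<exists>P. finite P \<and> P \<subseteq> {0<..<1} \<and> card P \<le> k \<and> valley_poly k = smult (fact (Suc k)) (bernoulli_poly P)
    \<and> \<Sum>P = (real k - 1) / 3 \<and> (\<Sum>p\<in>P. p * (1 - p)) = 2 * (real k + 2) / 45"
proof -
  obtain P where P: "finite P" "P \<subseteq> {0<..<1}" "valley_poly k = smult (fact (Suc k)) (bernoulli_poly P)"
    using valley_poly_factor[of k] unfolding bernoulli_poly_def by blast
  have f: "(fact (Suc k) :: real) \<noteq> 0" by (rule fact_nonzero)
  have w: "weighted (valley_poly k) g = fact (Suc k) * weighted (bernoulli_poly P) g" for g
    unfolding P(3) by (rule weighted_smult)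
  have m1: "\<Sum>P = (real k - 1) / 3"
    using valley_moments(2)[of k] assms f unfolding w bernoulli_mean[OF P(1)] by simp
  have m2: "weighted (bernoulli_poly P) (\<lambda>v. (real v)\<^sup>2) = 2 * (real k + 2) / 45 + ((real k - 1) / 3)\<^sup>2"
    using valley_moments(3)[of k] assms f unfolding w by simp
  have "(\<Sum>p\<in>P. p * (1 - p)) = weighted (bernoulli_poly P) (\<lambda>v. (real v)\<^sup>2 - 2 * \<Sum>P * real v + (\<Sum>P)\<^sup>2)"
    unfolding bernoulli_variance[OF P(1), symmetric]
    by (intro arg_cong[of _ _ "weighted (bernoulli_poly P)"] ext) (simp add: power2_eq_square algebra_simps)
  also have "\<dots> = 2 * (real k + 2) / 45"
    unfolding weighted_add_fun weighted_diff_fun weighted_mult_fun bernoulli_mean[OF P(1)] m2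
    by (simp add: m1 power2_eq_square field_simps)
  finally have v: "(\<Sum>p\<in>P. p * (1 - p)) = 2 * (real k + 2) / 45" .
  have "card P = degree (valley_poly k)" using P f by (subst degree_bernoulli_poly[symmetric]) auto
  also have "\<dots> \<le> k" using degree_valley_poly[of k] by linarith
  finally show ?thesis using P m1 v by blast
qed

section \<open>Stein's equation and the Mills ratio\<close>

lemma Phi_tendsto: "(Phi \<longlongrightarrow> 1) at_top" "(Phi \<longlongrightarrow> 0) at_bot"
proof -
  interpret real_distribution std_normal_distribution by (rule real_dist_normal_dist)
  show "(Phi \<longlongrightarrow> 1) at_top" by (rule cdf_lim_at_top_prob)
  show "(Phi \<longlongrightarrow> 0) at_bot" by (rule cdf_lim_at_bot)
qed

text \<open>
  Near \<open>x\<close>, \<open>Phi\<close> is a constant plus an integral of the density over a compact interval, to which the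
  fundamental theorem of calculus applies.
\<close>

lemma Phi_has_derivative: "(Phi has_real_derivative std_normal_density x) (at x)"
proof -
  let ?f = std_normal_density
  define a where "a = x - 1"
  interpret prob_space std_normal_distribution by (rule prob_space_normal_density) simp
  have int: "integrable lborel ?f" by (rule integrable_normal_density) simp
  have si: "set_integrable lborel S ?f" if "S \<in> sets borel" for S
    unfolding set_integrable_def by (rule integrable_mult_indicator) (use int that in auto)
  have Phi: "Phi y = integral {..y} ?f" for y
  proof -
    have "integral {..y} ?f = (LINT t:{..y}|lborel. ?f t)"
      by (rule set_borel_integral_eq_integral(2)[OF si, symmetric]) simp
    also have "\<dots> = (LINT t:{..y}|lborel. 1 / sqrt (2 * pi) * exp (- t\<^sup>2 / 2))"
      unfolding std_normal_density_def ..
    finally show ?thesis unfolding Phi_eq_integral by simp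
  qed
  have io: "?f integrable_on S" if "S \<in> sets borel" for S
    by (rule set_borel_integral_eq_integral(1)[OF si[OF that]])
  have split: "Phi y = Phi a + integral {a..y} ?f" if "y \<in> {a<..<x+1}" for y
  proof -
    have "{..y} = {..a} \<union> {a..y}" "{..a} \<inter> {a..y} = {a}" using that by auto
    then show ?thesis unfolding Phi by (simp add: io)
  qed
  have cont: "continuous_on {a..x+1} ?f" unfolding std_normal_density_def by (intro continuous_intros) auto
  have "((\<lambda>y. integral {a..y} ?f) has_real_derivative ?f x) (at x within {a..x+1})"
    by (rule integral_has_real_derivative[OF cont]) (auto simp: a_def)
  then have "((\<lambda>y. integral {a..y} ?f) has_real_derivative ?f x) (at x)"
    by (simp add: a_def at_within_Icc_at)
  then have "((\<lambda>y. Phi a + integral {a..y} ?f) has_real_derivative ?f x) (at x)"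
    by (auto intro!: derivative_eq_intros)
  then show ?thesis
    by (rule has_field_derivative_transform_within_open[of _ _ _ "{a<..<x+1}"]) (use split in \<open>auto simp: a_def\<close>)
qed

definition gauss :: "real \<Rightarrow> real" where
  "gauss x = std_normal_density x"

definition gauss_tail :: "real \<Rightarrow> real" where
  "gauss_tail x = 1 - Phi x"

lemma gauss_pos: "gauss x > 0"
  unfolding gauss_def by (rule normal_density_pos) simp

lemma gauss_uminus: "gauss (- x) = gauss x"
  by (simp add: gauss_def std_normal_density_def)

lemma gauss_has_derivative [derivative_intros]:
  assumes "(g has_real_derivative d) (at x)"
  shows "((\<lambda>x. gauss (g x)) has_real_derivative - g x * gauss (g x) * d) (at x)"
proof -
  define c where "c = 1 / sqrt (2 * pi)"
  have g: "gauss = (\<lambda>x. c * exp (- x\<^sup>2 / 2))"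
    unfolding c_def by (rule ext) (simp only: gauss_def std_normal_density_def)
  have "(gauss has_real_derivative - x * gauss x) (at x)" for x
    unfolding g by (auto intro!: derivative_eq_intros)
  then show ?thesis using assms by (rule DERIV_chain2)
qed

lemma gauss_tail_has_derivative [derivative_intros]:
  assumes "(g has_real_derivative d) (at x)"
  shows "((\<lambda>x. gauss_tail (g x)) has_real_derivative - gauss (g x) * d) (at x)"
proof -
  have "(gauss_tail has_real_derivative 0 - gauss x) (at x)" for x
    unfolding gauss_tail_def [abs_def] gauss_def
    by (intro derivative_intros Phi_has_derivative)
  then have "(gauss_tail has_real_derivative - gauss x) (at x)" for x by simp
  then show ?thesis using assms by (rule DERIV_chain2)
qed

lemma gauss_tendsto_0: "(gauss \<longlongrightarrow> 0) at_top"
proof -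
  have "((\<lambda>x::real. (1 / sqrt (2 * pi)) * exp (- x\<^sup>2 / 2)) \<longlongrightarrow> (1 / sqrt (2 * pi)) * 0) at_top"
    by (intro tendsto_mult tendsto_const) real_asymp
  moreover have "gauss = (\<lambda>x. (1 / sqrt (2 * pi)) * exp (- x\<^sup>2 / 2))"
    by (rule ext) (simp only: gauss_def std_normal_density_def)
  ultimately show ?thesis by simp
qed

lemma gauss_tail_tendsto_0: "(gauss_tail \<longlongrightarrow> 0) at_top"
proof -
  have "((\<lambda>x. 1 - Phi x) \<longlongrightarrow> 1 - 1) at_top" by (intro tendsto_diff tendsto_const Phi_tendsto)
  then show ?thesis by (simp add: gauss_tail_def [abs_def])
qed

text \<open>
  The sum of both tails has derivative \<open>0\<close> and tends to \<open>1\<close>.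
\<close>

lemma gauss_tail_uminus: "gauss_tail (- x) = 1 - gauss_tail x"
proof -
  have "((\<lambda>x. gauss_tail x + gauss_tail (- x)) has_real_derivative 0) (at x)" for x
    by (auto intro!: derivative_eq_intros simp: gauss_uminus)
  then have const: "gauss_tail y + gauss_tail (- y) = gauss_tail x + gauss_tail (- x)" for y
    using DERIV_isconst_all[of "\<lambda>x. gauss_tail x + gauss_tail (- x)" y x] by auto
  have "((\<lambda>y. Phi (- y)) \<longlongrightarrow> 0) at_top"
    by (rule filterlim_compose[OF Phi_tendsto(2) filterlim_uminus_at_bot_at_top])
  then have "((\<lambda>y. gauss_tail (- y)) \<longlongrightarrow> 1 - 0) at_top"
    unfolding gauss_tail_def by (intro tendsto_diff tendsto_const)
  then have "((\<lambda>y. gauss_tail y + gauss_tail (- y)) \<longlongrightarrow> 0 + (1 - 0)) at_top"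
    by (intro tendsto_add gauss_tail_tendsto_0)
  moreover have "(\<lambda>y. gauss_tail y + gauss_tail (- y)) = (\<lambda>y. gauss_tail x + gauss_tail (- x))"
    by (rule ext) (rule const)
  ultimately have "((\<lambda>y::real. gauss_tail x + gauss_tail (- x)) \<longlongrightarrow> 1) at_top" by simp
  then have "gauss_tail x + gauss_tail (- x) = 1" by (simp add: tendsto_const_iff)
  then show ?thesis by simp
qed

definition mills :: "real \<Rightarrow> real" where
  "mills x = gauss_tail x / gauss x"

lemma mills_has_derivative: "(mills has_real_derivative x * mills x - 1) (at x)"
proof -
  have "((\<lambda>x. gauss_tail x / gauss x) has_real_derivative
    (- gauss x * 1 * gauss x - gauss_tail x * (- x * gauss x * 1)) / (gauss x * gauss x)) (at x)"
    using gauss_pos[of x] by (intro derivative_intros DERIV_ident) auto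
  moreover have "(- gauss x * 1 * gauss x - gauss_tail x * (- x * gauss x * 1)) / (gauss x * gauss x) = x * mills x - 1"
    using gauss_pos[of x] by (simp add: mills_def field_simps)
  ultimately show ?thesis by (simp add: mills_def [abs_def])
qed

text \<open>
  Gordon's inequalities. In both cases the difference, multiplied by the density, is strictly
  decreasing and tends to \<open>0\<close>, hence is positive.
\<close>

lemma mills_bounds:
  assumes "x > 0"
  shows "x / (1 + x\<^sup>2) \<le> mills x" "mills x \<le> 1 / x"
proof -
  have "0 < gauss x / x - gauss_tail x"
  proof (rule DERIV_neg_imp_decreasing_at_top[where f = "\<lambda>y. gauss y / y - gauss_tail y"])
    fix y assume "x \<le> y"
    then have y: "y > 0" using assms by simp
    have "((\<lambda>y. gauss y / y - gauss_tail y) has_real_derivative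
      (- y * gauss y * 1 * y - gauss y * 1) / (y * y) - (- gauss y * 1)) (at y)"
      using y by (intro derivative_intros DERIV_ident) auto
    moreover have "(- y * gauss y * 1 * y - gauss y * 1) / (y * y) - (- gauss y * 1) = - (gauss y / y\<^sup>2)"
      using y by (simp add: field_simps power2_eq_square)
    ultimately show "\<exists>d. ((\<lambda>y. gauss y / y - gauss_tail y) has_real_derivative d) (at y) \<and> d < 0"
      using gauss_pos[of y] y by (intro exI[of _ "- (gauss y / y\<^sup>2)"]) auto
  next
    have "((\<lambda>y. gauss y * (1 / y) - gauss_tail y) \<longlongrightarrow> 0 * 0 - 0) at_top"
      by (intro tendsto_diff tendsto_mult gauss_tendsto_0 gauss_tail_tendsto_0) real_asymp
    then show "((\<lambda>y. gauss y / y - gauss_tail y) \<longlongrightarrow> 0) at_top" by simp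
  qed
  then show "mills x \<le> 1 / x" using gauss_pos[of x] assms by (simp add: mills_def field_simps)
  have "0 < gauss_tail x - x / (1 + x\<^sup>2) * gauss x"
  proof (rule DERIV_neg_imp_decreasing_at_top[where f = "\<lambda>y. gauss_tail y - y / (1 + y\<^sup>2) * gauss y"])
    fix y assume "x \<le> y"
    define q where "q = 1 + y\<^sup>2"
    have q: "q > 0" "y\<^sup>2 = q - 1" by (simp_all add: q_def add_pos_nonneg)
    have "((\<lambda>y. gauss_tail y - y / (1 + y\<^sup>2) * gauss y) has_real_derivative
       - gauss y - ((q - y * (2 * y)) / q\<^sup>2 * gauss y + y / q * (- y * gauss y))) (at y)"
    proof -
      have "((\<lambda>y. 1 + y\<^sup>2) has_real_derivative 2 * y) (at y)"
        by (auto intro!: derivative_eq_intros)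
      from DERIV_mult[OF DERIV_divide[OF DERIV_ident this] gauss_has_derivative[OF DERIV_ident]] q(1)
      have "((\<lambda>y. y / (1 + y\<^sup>2) * gauss y) has_real_derivative
          (q - y * (2 * y)) / q\<^sup>2 * gauss y + y / q * (- y * gauss y)) (at y)"
        by (simp add: q_def power2_eq_square mult_ac)
      from DERIV_diff[OF gauss_tail_has_derivative[OF DERIV_ident] this] show ?thesis by simp
    qed
    also have "- gauss y - ((q - y * (2 * y)) / q\<^sup>2 * gauss y + y / q * (- y * gauss y))
      = - gauss y - ((q - 2 * y\<^sup>2) / q\<^sup>2 * gauss y - y\<^sup>2 / q * gauss y)"
      by (simp add: power2_eq_square algebra_simps)
    also have "\<dots> = - (2 * gauss y / q\<^sup>2)"
      unfolding q(2) using q(1) by (simp add: divide_simps) (simp add: algebra_simps power2_eq_square)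
    finally show "\<exists>d. ((\<lambda>y. gauss_tail y - y / (1 + y\<^sup>2) * gauss y) has_real_derivative d) (at y) \<and> d < 0"
    proof (intro exI conjI)
      have "2 * gauss y / q\<^sup>2 > 0" using gauss_pos[of y] q(1) by simp
      then show "- (2 * gauss y / q\<^sup>2) < 0" by linarith
    qed
  next
    have "((\<lambda>y. gauss_tail y - y / (1 + y\<^sup>2) * gauss y) \<longlongrightarrow> 0 - 0 * 0) at_top"
      by (intro tendsto_diff tendsto_mult gauss_tendsto_0 gauss_tail_tendsto_0) real_asymp
    then show "((\<lambda>y. gauss_tail y - y / (1 + y\<^sup>2) * gauss y) \<longlongrightarrow> 0) at_top" by simp
  qed
  then show "x / (1 + x\<^sup>2) \<le> mills x" using gauss_pos[of x] by (simp add: mills_def field_simps)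
qed

text \<open>
  The last two expressions are the first and the second derivative of the Mills ratio. For \<open>x \<ge> 1\<close> the
  bounds come from Gordon's inequalities, where the leading terms cancel; on the rest of the half-line
  the functions are continuous on a compact interval.
\<close>

lemma mills_bounded:
  "\<exists>C\<ge>1. \<forall>x\<ge>b. \<bar>mills x\<bar> \<le> C \<and> \<bar>x * mills x - 1\<bar> \<le> C \<and> \<bar>(1 + x\<^sup>2) * mills x - x\<bar> \<le> C"
proof -
  have cm: "continuous_on S mills" for S
    by (rule DERIV_continuous_on, rule has_field_derivative_at_within, rule mills_has_derivative)
  have bd: "\<exists>C. \<forall>x\<in>{b..1}. \<bar>g x\<bar> \<le> C" if "continuous_on {b..1} g" for g :: "real \<Rightarrow> real"
  proof -
    have "bounded (g ` {b..1})" by (rule compact_imp_bounded[OF compact_continuous_image[OF that compact_Icc]])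
    then obtain C where "\<forall>y\<in>g ` {b..1}. norm y \<le> C" unfolding bounded_iff by blast
    then show ?thesis by (intro exI[of _ C]) simp
  qed
  obtain C1 where C1: "\<forall>x\<in>{b..1}. \<bar>mills x\<bar> \<le> C1" using bd[OF cm] by blast
  obtain C2 where C2: "\<forall>x\<in>{b..1}. \<bar>x * mills x - 1\<bar> \<le> C2"
    using bd[OF continuous_on_diff[OF continuous_on_mult[OF continuous_on_id cm] continuous_on_const]] by blast
  obtain C3 where C3: "\<forall>x\<in>{b..1}. \<bar>(1 + x\<^sup>2) * mills x - x\<bar> \<le> C3"
    using bd[OF continuous_on_diff[OF continuous_on_mult[OF continuous_on_add[OF continuous_on_const continuous_on_power[OF continuous_on_id]] cm] continuous_on_id]] by blast
  define C where "C = max 1 (max C1 (max C2 C3))"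
  have "\<bar>mills x\<bar> \<le> C \<and> \<bar>x * mills x - 1\<bar> \<le> C \<and> \<bar>(1 + x\<^sup>2) * mills x - x\<bar> \<le> C" if "x \<ge> b" for x
  proof (cases "x \<le> 1")
    case True
    then show ?thesis using that C1 C2 C3 by (auto simp: C_def le_max_iff_disj)
  next
    case False
    then have x: "x > 0" "1 \<le> x" by auto
    note B = mills_bounds[OF x(1)]
    have nz: "1 + x\<^sup>2 > 0" by (simp add: add_pos_nonneg)
    have i: "1 / x \<le> 1" using x by simp
    have m0: "0 \<le> mills x" using B(1) x nz by (meson divide_nonneg_pos less_imp_le order_trans)
    have "x * mills x \<le> 1" "0 \<le> x * mills x" using B(2) x m0 by (simp_all add: field_simps)
    moreover have "0 \<le> (1 + x\<^sup>2) * mills x - x" using B(1) nz by (simp add: field_simps)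
    moreover have "(1 + x\<^sup>2) * mills x \<le> (1 + x\<^sup>2) * (1 / x)" using B(2) nz by (intro mult_left_mono) auto
    moreover have "(1 + x\<^sup>2) * (1 / x) = 1 / x + x" using x by (simp add: field_simps power2_eq_square)
    moreover have "1 \<le> C" by (simp add: C_def)
    ultimately show ?thesis using i m0 B(2) unfolding abs_le_iff by linarith
  qed
  then show ?thesis by (intro exI[of _ C]) (auto simp: C_def)
qed

lemma lipschitz_glue:
  fixes g :: "real \<Rightarrow> real"
  assumes "\<And>x y. x \<le> c \<Longrightarrow> y \<le> c \<Longrightarrow> \<bar>g x - g y\<bar> \<le> B * \<bar>x - y\<bar>"
    and "\<And>x y. x \<ge> c \<Longrightarrow> y \<ge> c \<Longrightarrow> \<bar>g x - g y\<bar> \<le> B * \<bar>x - y\<bar>"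
  shows "\<bar>g x - g y\<bar> \<le> B * \<bar>x - y\<bar>"
proof -
  have *: "\<bar>g x - g y\<bar> \<le> B * \<bar>x - y\<bar>" if "x \<le> c" "c \<le> y" for x y
  proof -
    have "\<bar>g x - g y\<bar> \<le> \<bar>g x - g c\<bar> + \<bar>g c - g y\<bar>" by simp
    also have "\<dots> \<le> B * \<bar>x - c\<bar> + B * \<bar>c - y\<bar>"
      using that by (intro add_mono assms) simp_all
    also have "\<dots> = B * \<bar>x - y\<bar>" using that by (simp add: algebra_simps)
    finally show ?thesis .
  qed
  show ?thesis
    using assms *[of x y] *[of y x] by (cases "x \<le> c"; cases "y \<le> c") (auto simp: abs_minus_commute)
qed

text \<open>
  Stein's equation for the Lipschitz function \<open>H(w) = max 0 (1 - exp(-\<mu> w - \<mu>\<^sup>2/2))\<close>. As \<open>H\<close> is the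
  difference of an indicator and an exponentially tilted indicator, and tilting shifts the normal law
  by \<open>\<mu>\<close>, the bounded solution is a combination of Mills ratios on either side of the kink at
  \<open>-\<mu>/2\<close>. The constant \<open>1 - 2 Phi(-\<mu>/2)\<close> is the normal expectation of \<open>H\<close>; here it is characterised
  by the two pieces having the same value at the kink.
\<close>

theorem stein_solution:
  fixes \<mu> :: real
  assumes "\<mu> > 0"
  shows "\<exists>f f' B. (\<forall>w. (f has_real_derivative f' w) (at w)) \<and>
    (\<forall>w. f' w - w * f w = max 0 (1 - exp (- \<mu> * w - \<mu>\<^sup>2 / 2)) - (1 - 2 * Phi (- (\<mu> / 2)))) \<and>
    (\<forall>w u. \<bar>f' w - f' u\<bar> \<le> B * \<bar>w - u\<bar>) \<and> (\<forall>w. \<bar>f' w\<bar> \<le> B) \<and> B > 0"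
proof -
  define k where "k = \<mu> / 2"
  define T where "T = 1 - 2 * Phi (- k)"
  define e where "e w = exp (- \<mu> * w - \<mu>\<^sup>2 / 2)" for w :: real
  define M1 where "M1 x = x * mills x - 1" for x
  define M2 where "M2 x = (1 + x\<^sup>2) * mills x - x" for x
  have dM: "(mills has_real_derivative M1 x) (at x)" for x unfolding M1_def by (rule mills_has_derivative)
  have dM1: "(M1 has_real_derivative M2 x) (at x)" for x
    unfolding M1_def[abs_def] M2_def
    by (rule derivative_eq_intros dM | rule refl)+ (simp add: M1_def algebra_simps power2_eq_square)
  have de: "(e has_real_derivative - \<mu> * e x) (at x)" for x
    unfolding e_def[abs_def] by (auto intro!: derivative_eq_intros)
  (* Left of the kink H vanishes; right of it the second summand accounts for the tilted part. *)
  define fL where "fL w = - T * mills (- w)" for w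
  define fL' where "fL' w = T * M1 (- w)" for w
  define fL'' where "fL'' w = - T * M2 (- w)" for w
  define fR where "fR w = - (1 - T) * mills w + e w * mills (w + \<mu>)" for w
  define fR' where "fR' w = - (1 - T) * M1 w + e w * (M1 (w + \<mu>) - \<mu> * mills (w + \<mu>))" for w
  define fR'' where "fR'' w = - (1 - T) * M2 w + e w * (M2 (w + \<mu>) - 2 * \<mu> * M1 (w + \<mu>) + \<mu>\<^sup>2 * mills (w + \<mu>))" for w
  have dL: "(fL has_real_derivative fL' w) (at w)" for w
    unfolding fL_def[abs_def] fL'_def by (auto intro!: derivative_eq_intros DERIV_chain2[OF dM])
  have dL': "(fL' has_real_derivative fL'' w) (at w)" for w
    unfolding fL'_def[abs_def] fL''_def by (auto intro!: derivative_eq_intros DERIV_chain2[OF dM1])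
  have dR: "(fR has_real_derivative fR' w) (at w)" for w
    unfolding fR_def[abs_def] fR'_def
    by (auto intro!: derivative_eq_intros DERIV_chain2[OF dM] dM de simp: algebra_simps)
  have dR': "(fR' has_real_derivative fR'' w) (at w)" for w
    unfolding fR'_def[abs_def] fR''_def
    by (auto intro!: derivative_eq_intros DERIV_chain2[OF dM] DERIV_chain2[OF dM1] dM1 de simp: algebra_simps power2_eq_square)
  have odeL: "fL' w - w * fL w = - T" for w
    by (simp add: fL_def fL'_def M1_def algebra_simps)
  have odeR: "fR' w - w * fR w = 1 - e w - T" for w
    by (simp add: fR_def fR'_def M1_def algebra_simps)
  have ek: "e (- k) = 1" by (simp add: e_def k_def power2_eq_square)
  have glue: "fL (- k) = fR (- k)"
  proof -
    have T: "T = 2 * gauss_tail (- k) - 1" by (simp add: T_def gauss_tail_def)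
    have m: "mills (- k) = gauss_tail (- k) / gauss k" "mills k = (1 - gauss_tail (- k)) / gauss k"
      using gauss_tail_uminus[of k] by (simp_all add: mills_def gauss_uminus)
    have "- k + \<mu> = k" "- (- k) = k" by (simp_all add: k_def)
    then show ?thesis unfolding fL_def fR_def ek m T using gauss_pos[of k]
      by (simp add: m field_simps)
  qed
  have glue': "fL' (- k) = fR' (- k)"
    using odeL[of "- k"] odeR[of "- k"] glue ek by simp
  define f where "f w = (if w \<le> - k then fL w else fR w)" for w
  define f' where "f' w = (if w \<le> - k then fL' w else fR' w)" for w
  have "(f has_real_derivative f' w) (at w)" for w
  proof -
    have "((\<lambda>x. if x \<in> {..- k} then fL x else fR x) has_vector_derivative
      (if w \<in> {..- k} then fL' w else fR' w)) (at w within UNIV)"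
    proof (rule has_vector_derivative_If_within_closures[where T = "{- k<..}"])
      show "w \<in> {..- k} \<union> {- k<..}" by auto
      show "UNIV = {..- k} \<union> {- k<..}" by auto
      show "(fL has_vector_derivative fL' w) (at w within {..- k} \<union> closure {..- k} \<inter> closure {- k<..})"
        by (rule has_vector_derivative_at_within) (simp add: has_real_derivative_iff_has_vector_derivative[symmetric] dL)
      show "(fR has_vector_derivative fR' w) (at w within {- k<..} \<union> closure {..- k} \<inter> closure {- k<..})"
        by (rule has_vector_derivative_at_within) (simp add: has_real_derivative_iff_has_vector_derivative[symmetric] dR)
      assume "w \<in> closure {..- k}" "w \<in> closure {- k<..}"
      then have "w = - k" by simp
      then show "fL w = fR w" "fL' w = fR' w" using glue glue' by simp_all
    qed
    then show ?thesis unfolding f_def[abs_def] f'_def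
      by (simp add: has_real_derivative_iff_has_vector_derivative)
  qed
  moreover have "f' w - w * f w = max 0 (1 - e w) - T" for w
  proof (cases "w \<le> - k")
    case True
    then have "- \<mu> * w - \<mu>\<^sup>2 / 2 \<ge> 0" using assms mult_left_mono[of w "- k" \<mu>] by (simp add: k_def power2_eq_square)
    then have "e w \<ge> 1" by (simp add: e_def)
    then show ?thesis using True odeL[of w] by (simp add: f_def f'_def)
  next
    case False
    then have "- \<mu> * w - \<mu>\<^sup>2 / 2 \<le> 0" using assms mult_left_mono[of "- k" w \<mu>] by (simp add: k_def power2_eq_square)
    then have "e w \<le> 1" by (simp add: e_def)
    then show ?thesis using False odeR[of w] by (simp add: f_def f'_def)
  qed
  moreover obtain B where "B > 0" "\<And>w u. \<bar>f' w - f' u\<bar> \<le> B * \<bar>w - u\<bar>" "\<And>w. \<bar>f' w\<bar> \<le> B"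
  proof -
    obtain C where C: "C \<ge> 1" "\<And>x. x \<ge> - k \<Longrightarrow> \<bar>mills x\<bar> \<le> C \<and> \<bar>M1 x\<bar> \<le> C \<and> \<bar>M2 x\<bar> \<le> C"
      using mills_bounded[of "- k"] unfolding M1_def M2_def by blast
    interpret real_distribution std_normal_distribution by (rule real_dist_normal_dist)
    have k0: "k > 0" using assms by (simp add: k_def)
    have T: "\<bar>T\<bar> \<le> 1" "\<bar>1 - T\<bar> \<le> 2" using cdf_nonneg[of "- k"] cdf_bounded_prob[of "- k"] by (auto simp: T_def)
    define B where "B = 2 * C + (C + 2 * \<mu> * C + \<mu>\<^sup>2 * C)"
    have B: "B > 0" using C assms by (auto simp: B_def intro!: add_pos_nonneg)
    have CB: "C \<le> B" using C assms by (auto simp: B_def)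
    have L: "\<bar>fL' w\<bar> \<le> B" "\<bar>fL'' w\<bar> \<le> B" if "w \<le> - k" for w
    proof -
      have "- w \<ge> - k" using that k0 by simp
      note c = C(2)[OF this]
      have "\<bar>T\<bar> * \<bar>M1 (- w)\<bar> \<le> 1 * C" using c T C(1) by (intro mult_mono) auto
      then show "\<bar>fL' w\<bar> \<le> B" using CB by (simp add: fL'_def abs_mult)
      have "\<bar>T\<bar> * \<bar>M2 (- w)\<bar> \<le> 1 * C" using c T C(1) by (intro mult_mono) auto
      then show "\<bar>fL'' w\<bar> \<le> B" using CB by (simp add: fL''_def abs_mult)
    qed
    have R: "\<bar>fR' w\<bar> \<le> B" "\<bar>fR'' w\<bar> \<le> B" if "w \<ge> - k" for w
    proof -
      note c = C(2)[OF that]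
      have "w + \<mu> \<ge> - k" using that assms by simp
      note c2 = C(2)[OF this]
      have "- \<mu> * w - \<mu>\<^sup>2 / 2 \<le> 0" using that assms mult_left_mono[of "- k" w \<mu>] by (simp add: k_def power2_eq_square)
      then have ew: "0 \<le> e w" "e w \<le> 1" by (auto simp: e_def)
      have 1: "\<bar>(1 - T) * M1 w\<bar> \<le> 2 * C" "\<bar>(1 - T) * M2 w\<bar> \<le> 2 * C"
        unfolding abs_mult using T c by (auto intro!: mult_mono)
      have 3: "\<bar>\<mu> * mills (w + \<mu>)\<bar> \<le> \<mu> * C" "\<bar>2 * \<mu> * M1 (w + \<mu>)\<bar> \<le> 2 * \<mu> * C"
        "\<bar>\<mu>\<^sup>2 * mills (w + \<mu>)\<bar> \<le> \<mu>\<^sup>2 * C"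
        unfolding abs_mult using assms c2 by (auto intro!: mult_mono)
      have nn: "0 \<le> \<mu> * C" "0 \<le> \<mu>\<^sup>2 * C" using assms C(1) by auto
      have "\<bar>M1 (w + \<mu>) - \<mu> * mills (w + \<mu>)\<bar> \<le> C + 2 * \<mu> * C + \<mu>\<^sup>2 * C" using c2 3 nn by linarith
      then have 4: "\<bar>e w * (M1 (w + \<mu>) - \<mu> * mills (w + \<mu>))\<bar> \<le> 1 * (C + 2 * \<mu> * C + \<mu>\<^sup>2 * C)"
        unfolding abs_mult using ew by (intro mult_mono) auto
      have "\<bar>M2 (w + \<mu>) - 2 * \<mu> * M1 (w + \<mu>) + \<mu>\<^sup>2 * mills (w + \<mu>)\<bar> \<le> C + 2 * \<mu> * C + \<mu>\<^sup>2 * C" using c2 3 nn by linarith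
      then have 5: "\<bar>e w * (M2 (w + \<mu>) - 2 * \<mu> * M1 (w + \<mu>) + \<mu>\<^sup>2 * mills (w + \<mu>))\<bar> \<le> 1 * (C + 2 * \<mu> * C + \<mu>\<^sup>2 * C)"
        unfolding abs_mult using ew by (intro mult_mono) auto
      show "\<bar>fR' w\<bar> \<le> B"
        using 1(1) 4 unfolding fR'_def B_def minus_mult_left[symmetric]
        by (intro order_trans[OF abs_triangle_ineq] add_mono) simp_all
      show "\<bar>fR'' w\<bar> \<le> B"
        using 1(2) 5 unfolding fR''_def B_def minus_mult_left[symmetric]
        by (intro order_trans[OF abs_triangle_ineq] add_mono) simp_all
    qed
    have lip: "\<bar>f' w - f' u\<bar> \<le> B * \<bar>w - u\<bar>" for w u
    proof (rule lipschitz_glue[of "- k"])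
      fix x y :: real assume xy: "x \<le> - k" "y \<le> - k"
      have "norm (fL' x - fL' y) \<le> B * norm (x - y)"
        by (rule field_differentiable_bound[of "{..- k}" fL' fL'', OF _ has_field_derivative_at_within[OF dL']])
          (use xy L in simp_all)
      then show "\<bar>f' x - f' y\<bar> \<le> B * \<bar>x - y\<bar>" using xy by (simp add: f'_def)
    next
      fix x y :: real assume xy: "x \<ge> - k" "y \<ge> - k"
      have "norm (fR' x - fR' y) \<le> B * norm (x - y)"
        by (rule field_differentiable_bound[of "{- k..}" fR' fR'', OF _ has_field_derivative_at_within[OF dR']])
          (use xy R in simp_all)
      moreover have "f' x = fR' x" if "x \<ge> - k" for x using that glue' by (cases "x = - k") (auto simp: f'_def)
      ultimately show "\<bar>f' x - f' y\<bar> \<le> B * \<bar>x - y\<bar>" using xy by simp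
    qed
    have bound: "\<bar>f' w\<bar> \<le> B" for w using L(1)[of w] R(1)[of w] by (cases "w \<le> - k") (simp_all add: f'_def)
    show ?thesis by (rule that[OF B lip bound])
  qed
  ultimately have "(\<forall>w. (f has_real_derivative f' w) (at w)) \<and> (\<forall>w. f' w - w * f w = max 0 (1 - e w) - T) \<and>
    (\<forall>w u. \<bar>f' w - f' u\<bar> \<le> B * \<bar>w - u\<bar>) \<and> (\<forall>w. \<bar>f' w\<bar> \<le> B) \<and> B > 0"
    by (intro conjI allI)
  then show ?thesis unfolding e_def T_def k_def
    by - (rule exI[of _ f], rule exI[of _ f'], rule exI[of _ B])
qed

section \<open>Sorted labellings of a word\<close>

text \<open>
  For a word \<open>w\<close> in reversed reading order, \<open>sorted_labellings w j\<close> is the number of labellings of its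
  letters by labels in \<open>{1..j}\<close> that increase weakly in reading order and repeat an odd label only at
  ascents and an even label only at descents. The sum runs over the label \<open>i\<close> of the last letter; the
  previous label is at most \<open>i\<close> if a repetition is permitted and at most \<open>i - 1\<close> otherwise.
\<close>

fun sorted_labellings :: "nat list \<Rightarrow> nat \<Rightarrow> nat" where
  "sorted_labellings [] j = 1"
| "sorted_labellings [x] j = j"
| "sorted_labellings (y # x # r) j =
     (\<Sum>i=1..j. sorted_labellings (x # r) (if (x < y) = odd i then i else i - 1))"

definition even_gf :: "nat list \<Rightarrow> real fps" where
  "even_gf w = Abs_fps (\<lambda>k. real (sorted_labellings w (2 * k)))"

definition odd_gf :: "nat list \<Rightarrow> real fps" where
  "odd_gf w = Abs_fps (\<lambda>k. if k = 0 then 0 else real (sorted_labellings w (2 * k - 1)))"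

lemma sorted_labellings_Suc:
  "sorted_labellings (y # x # r) (Suc j) = sorted_labellings (y # x # r) j +
     sorted_labellings (x # r) (if (x < y) = odd (Suc j) then Suc j else j)"
  by simp

text \<open>
  The labels \<open>2k - 1\<close> and \<open>2k\<close> of the last letter are treated together: at an ascent both leave the bound
  \<open>2k - 1\<close> for the rest of the word, at a descent they leave \<open>2k - 2\<close> and \<open>2k\<close>.
\<close>

lemma gf_step:
  shows "x < y \<Longrightarrow> (1 - fps_X) * even_gf (y # x # r) = 2 * odd_gf (x # r)"
    and "x < y \<Longrightarrow> odd_gf (y # x # r) = fps_X * even_gf (y # x # r) + odd_gf (x # r)"
    and "\<not> x < y \<Longrightarrow> (1 - fps_X) * even_gf (y # x # r) = (1 + fps_X) * even_gf (x # r)"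
    and "\<not> x < y \<Longrightarrow> odd_gf (y # x # r) = fps_X * even_gf (y # x # r) + fps_X * even_gf (x # r)"
proof -
  have 0: "sorted_labellings (x # r) 0 = 0" for x r by (cases r) auto
  have S1: "sorted_labellings (y # x # r) (2 * Suc k - 1) = sorted_labellings (y # x # r) (2 * k) +
     sorted_labellings (x # r) (if x < y then Suc (2 * k) else 2 * k)" for k
    using sorted_labellings_Suc[of y x r "2 * k"] by (auto simp del: sorted_labellings.simps)
  have S2: "sorted_labellings (y # x # r) (2 * Suc k) = sorted_labellings (y # x # r) (2 * Suc k - 1) +
     sorted_labellings (x # r) (if x < y then 2 * k + 1 else 2 * Suc k)" for k
    using sorted_labellings_Suc[of y x r "2 * Suc k - 1"] by (auto simp del: sorted_labellings.simps)
  note simps = fps_eq_iff even_gf_def odd_gf_def algebra_simps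
  show "(1 - fps_X) * even_gf (y # x # r) = 2 * odd_gf (x # r)" if "x < y"
  proof (rule fps_ext)
    fix k show "fps_nth ((1 - fps_X) * even_gf (y # x # r)) k = fps_nth (2 * odd_gf (x # r)) k"
    proof (cases k)
      case (Suc j)
      have "sorted_labellings (y # x # r) (2 * Suc j) = sorted_labellings (y # x # r) (2 * j) + 2 * sorted_labellings (x # r) (2 * Suc j - 1)"
        unfolding S2 S1 using that by simp
      then show ?thesis unfolding Suc numeral_fps_const
        by (simp add: even_gf_def odd_gf_def left_diff_distrib del: sorted_labellings.simps mult_Suc_right)
    qed (simp add: even_gf_def odd_gf_def 0 numeral_fps_const left_diff_distrib)
  qed
  show "odd_gf (y # x # r) = fps_X * even_gf (y # x # r) + odd_gf (x # r)" if "x < y"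
  proof (rule fps_ext)
    fix k show "fps_nth (odd_gf (y # x # r)) k = fps_nth (fps_X * even_gf (y # x # r) + odd_gf (x # r)) k"
    proof (cases k)
      case (Suc j)
      show ?thesis unfolding Suc using S1[of j] that
        by (simp add: even_gf_def odd_gf_def del: sorted_labellings.simps)
    qed (simp add: even_gf_def odd_gf_def)
  qed
  show "(1 - fps_X) * even_gf (y # x # r) = (1 + fps_X) * even_gf (x # r)" if "\<not> x < y"
  proof (rule fps_ext)
    fix k show "fps_nth ((1 - fps_X) * even_gf (y # x # r)) k = fps_nth ((1 + fps_X) * even_gf (x # r)) k"
    proof (cases k)
      case (Suc j)
      have "sorted_labellings (y # x # r) (2 * Suc j) = sorted_labellings (y # x # r) (2 * j) +
         sorted_labellings (x # r) (2 * j) + sorted_labellings (x # r) (2 * Suc j)"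
        unfolding S2 S1 using that by simp
      then show ?thesis unfolding Suc
        by (simp add: even_gf_def odd_gf_def left_diff_distrib distrib_right del: sorted_labellings.simps mult_Suc_right)
    qed (simp add: even_gf_def odd_gf_def 0 left_diff_distrib distrib_right)
  qed
  show "odd_gf (y # x # r) = fps_X * even_gf (y # x # r) + fps_X * even_gf (x # r)" if "\<not> x < y"
  proof (rule fps_ext)
    fix k show "fps_nth (odd_gf (y # x # r)) k = fps_nth (fps_X * even_gf (y # x # r) + fps_X * even_gf (x # r)) k"
    proof (cases k)
      case (Suc j)
      show ?thesis unfolding Suc using S1[of j] that
        by (simp add: even_gf_def odd_gf_def del: sorted_labellings.simps)
    qed (simp add: even_gf_def odd_gf_def)
  qed
qed

lemma gf_singleton:
  "(1 - fps_X)\<^sup>2 * even_gf [x] = 2 * fps_X" "2 * odd_gf [x] = (1 + fps_X) * even_gf [x]"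
proof -
  have a: "(1 - fps_X) * even_gf [x] = Abs_fps (\<lambda>k. if k = 0 then 0 else 2)"
  proof (rule fps_ext)
    fix k show "fps_nth ((1 - fps_X) * even_gf [x]) k = fps_nth (Abs_fps (\<lambda>k. if k = 0 then 0 else 2)) k"
      by (cases k) (simp_all add: even_gf_def left_diff_distrib)
  qed
  have b: "(1 - fps_X) * Abs_fps (\<lambda>k. if k = 0 then 0 else 2 :: real) = 2 * fps_X"
  proof (rule fps_ext)
    fix k show "fps_nth ((1 - fps_X) * Abs_fps (\<lambda>k. if k = 0 then 0 else 2 :: real)) k = fps_nth (2 * fps_X) k"
      unfolding numeral_fps_const by (cases k) (auto simp: left_diff_distrib)
  qed
  show "(1 - fps_X)\<^sup>2 * even_gf [x] = 2 * fps_X"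
    unfolding power2_eq_square mult.assoc a b ..
  show "2 * odd_gf [x] = (1 + fps_X) * even_gf [x]"
  proof (rule fps_ext)
    fix k show "fps_nth (2 * odd_gf [x]) k = fps_nth ((1 + fps_X) * even_gf [x]) k"
      unfolding numeral_fps_const by (cases k) (simp_all add: even_gf_def odd_gf_def distrib_right)
  qed
qed

text \<open>
  Every letter multiplies the generating function of the even bounds by \<open>(1 + t)/(1 - t)\<close>, except that a
  valley contributes \<open>4t/((1 + t)(1 - t))\<close>. To see which case applies one has to know the odd bounds as
  well. They are a rational multiple of the even ones that depends only on whether the last step was a
  descent, which is the second conjunct.
\<close>

theorem even_gf_valleys:
  assumes "distinct w" "w \<noteq> []"
  shows "(1 - fps_X) ^ (length w + 1) * (1 + fps_X) ^ (2 * valleys w + 1) * even_gf w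
      = 2 ^ (2 * valleys w + 1) * fps_X ^ (valleys w + 1) * (1 + fps_X) ^ length w \<and>
    (if \<exists>y x r. w = y # x # r \<and> \<not> x < y then (1 + fps_X) * odd_gf w = 2 * fps_X * even_gf w
     else 2 * odd_gf w = (1 + fps_X) * even_gf w)"
  using assms
proof (induction w rule: induct_list012)
  case (2 x)
  have "(1 - fps_X) ^ 2 * (1 + fps_X) * even_gf [x] = (1 + fps_X) * ((1 - fps_X)\<^sup>2 * even_gf [x])"
    by (simp only: mult_ac)
  also have "\<dots> = 2 * fps_X * (1 + fps_X)" unfolding gf_singleton by (simp only: mult_ac)
  finally show ?case using gf_singleton(2)[of x] by (simp add: numeral_2_eq_2)
next
  case (3 y x r)
  define A :: "real fps" where "A = 1 - fps_X"
  define B :: "real fps" where "B = 1 + fps_X"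
  define X :: "real fps" where "X = fps_X"
  define n where "n = length (x # r)"
  define v where "v = valleys (x # r)"
  define T where "T = even_gf (x # r)"
  define T' where "T' = even_gf (y # x # r)"
  define U where "U = odd_gf (x # r)"
  (* Unprimed series belong to the word without the letter y, primed ones to the full word. *)
  define U' where "U' = odd_gf (y # x # r)"
  have IH: "A ^ (n + 1) * B ^ (2 * v + 1) * T = 2 ^ (2 * v + 1) * X ^ (v + 1) * B ^ n"
    and IH2: "(if \<exists>y x' r'. x # r = y # x' # r' \<and> \<not> x' < y then B * U = 2 * X * T else 2 * U = B * T)"
    using 3(2,3) unfolding A_def B_def X_def n_def v_def T_def U_def by auto
  note step = gf_step[of x y r, folded A_def B_def X_def T_def T'_def U_def U'_def]
  have AB: "A = 1 - X" "B = 1 + X" by (simp_all add: A_def B_def X_def)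
  have "(A ^ (Suc n + 1) * B ^ (2 * valleys (y # x # r) + 1) * T'
      = 2 ^ (2 * valleys (y # x # r) + 1) * X ^ (valleys (y # x # r) + 1) * B ^ Suc n) \<and>
    (if \<not> x < y then B * U' = 2 * X * T' else 2 * U' = B * T')"
  proof (cases "x < y")
    case False
    then have s: "A * T' = B * T" "U' = X * T' + X * T" using step by auto
    have v': "valleys (y # x # r) = v" using False by (cases r) (auto simp: v_def)
    have "A ^ (Suc n + 1) * B ^ (2 * v + 1) * T' = A ^ (n + 1) * B ^ (2 * v + 1) * (A * T')"
      by (simp add: mult_ac)
    also have "\<dots> = (A ^ (n + 1) * B ^ (2 * v + 1) * T) * B" unfolding s by (simp add: mult_ac)
    also have "\<dots> = 2 ^ (2 * v + 1) * X ^ (v + 1) * B ^ Suc n" unfolding IH by (simp add: mult_ac)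
    finally have T': "A ^ (Suc n + 1) * B ^ (2 * v + 1) * T' = 2 ^ (2 * v + 1) * X ^ (v + 1) * B ^ Suc n" .
    have "B * U' = X * (B * T') + X * (B * T)" unfolding s(2) by (simp add: algebra_simps)
    also have "\<dots> = 2 * X * T'" unfolding s(1)[symmetric] unfolding AB by (simp add: algebra_simps)
    finally show ?thesis unfolding v' using False T' by simp
  next
    case True
    then have s: "A * T' = 2 * U" "U' = X * T' + U" using step by auto
    have "2 * U' = 2 * X * T' + A * T'" unfolding s by (simp add: algebra_simps)
    then have U': "2 * U' = B * T'" unfolding AB by (simp add: algebra_simps)
    show ?thesis
    proof (cases "\<exists>y x' r'. x # r = y # x' # r' \<and> \<not> x' < y")
      case D: True
      then obtain z r' where r: "r = z # r'" "\<not> z < x" by auto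
      then have "x < z" using 3(3) by auto
      then have v': "valleys (y # x # r) = Suc v" using True r by (simp add: v_def)
      have BU: "B * U = 2 * X * T" using IH2 D by (simp only: if_True)
      have "A ^ (Suc n + 1) * B ^ (2 * Suc v + 1) * T' = A ^ (n + 1) * B ^ (2 * v + 2) * (B * (A * T'))"
        by (simp add: mult_ac)
      also have "\<dots> = A ^ (n + 1) * B ^ (2 * v + 2) * (2 * (2 * X * T))" unfolding s BU[symmetric] by (simp add: mult_ac)
      also have "\<dots> = (A ^ (n + 1) * B ^ (2 * v + 1) * T) * (4 * X * B)" by (simp add: mult_ac)
      also have "\<dots> = 2 ^ (2 * Suc v + 1) * X ^ (Suc v + 1) * B ^ Suc n" unfolding IH by (simp add: mult_ac)
      finally show ?thesis unfolding v' using U' True by simp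
    next
      case D: False
      have v': "valleys (y # x # r) = v"
      proof (cases r)
        case (Cons z r')
        then show ?thesis using D True by (auto simp: v_def)
      qed (simp add: v_def)
      have BU: "2 * U = B * T" using IH2 D by (simp only: if_False)
      have "A ^ (Suc n + 1) * B ^ (2 * v + 1) * T' = A ^ (n + 1) * B ^ (2 * v + 1) * (A * T')"
        by (simp add: mult_ac)
      also have "\<dots> = (A ^ (n + 1) * B ^ (2 * v + 1) * T) * B" unfolding s BU by (simp add: mult_ac)
      also have "\<dots> = 2 ^ (2 * v + 1) * X ^ (v + 1) * B ^ Suc n" unfolding IH by (simp add: mult_ac)
      finally show ?thesis unfolding v' using U' True by simp
    qed
  qed
  then show ?case unfolding A_def B_def X_def T'_def U'_def n_def by simp
qed simp

text \<open>
  The coefficient of \<open>t\<^sup>m\<close> in \<open>2\<^sup>2\<^sup>v\<^sup>+\<^sup>1 t\<^sup>v\<^sup>+\<^sup>1 (1 + t)\<^sup>N / (1 - t)\<^sup>n\<^sup>+\<^sup>1\<close> with \<open>N = n - 1 - 2v\<close>. The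
  hypothesis \<open>length w \<le> m\<close> keeps the natural number subtraction exact.
\<close>

theorem sorted_labellings_valleys:
  assumes "distinct w" "w \<noteq> []" "length w \<le> m"
  defines "n \<equiv> length w" and "v \<equiv> valleys w"
  shows "real (sorted_labellings w (2 * m)) =
    2 ^ (2 * v + 1) * (\<Sum>j\<le>n - 1 - 2 * v. real (n - 1 - 2 * v choose j) * real (n + (m - (v + 1 + j)) choose n))"
proof -
  define N where "N = n - 1 - 2 * v"
  have n: "n = N + (2 * v + 1)"
  proof -
    have "length w > 0" using assms(2) by simp
    then show ?thesis using valleys_bound[of w] unfolding N_def n_def v_def by linarith
  qed
  have "(1 + fps_X :: real fps) \<noteq> 0" by (rule fps_nonzeroI[of _ 0]) simp
  moreover have "(1 + fps_X) ^ (2 * v + 1) * ((1 - fps_X) ^ (n + 1) * even_gf w)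
      = (1 + fps_X) ^ (2 * v + 1) * (2 ^ (2 * v + 1) * fps_X ^ (v + 1) * (1 + fps_X) ^ N)"
  proof -
    have "(1 + fps_X :: real fps) ^ n = (1 + fps_X) ^ N * (1 + fps_X) ^ (2 * v + 1)"
      unfolding power_add[symmetric] using n by simp
    then show ?thesis using conjunct1[OF even_gf_valleys[OF assms(1,2)]]
      unfolding n_def[symmetric] v_def[symmetric] by (simp only: mult_ac)
  qed
  ultimately have eq: "(1 - fps_X) ^ (n + 1) * even_gf w = 2 ^ (2 * v + 1) * fps_X ^ (v + 1) * (1 + fps_X) ^ N"
    by (metis mult_cancel_left power_not_zero)
  have inv: "inverse ((1 - fps_X) ^ (n + 1)) = Abs_fps (\<lambda>k. real (n + k choose k))"
    using one_minus_const_fps_X_neg_power'[of "n + 1" "1 :: real"] by simp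
  have "inverse ((1 - fps_X :: real fps) ^ (n + 1)) * (1 - fps_X) ^ (n + 1) = 1"
    by (rule inverse_mult_eq_1) (simp add: fps_power_zeroth)
  then have "even_gf w = inverse ((1 - fps_X) ^ (n + 1)) * (2 ^ (2 * v + 1) * fps_X ^ (v + 1) * (1 + fps_X) ^ N)"
    unfolding eq[symmetric] by (simp add: mult.assoc[symmetric])
  also have "(1 + fps_X :: real fps) ^ N = (\<Sum>j\<le>N. of_nat (N choose j) * fps_X ^ j)"
    by (subst add.commute) (simp add: binomial_ring)
  finally have E: "even_gf w = (\<Sum>j\<le>N. fps_const (2 ^ (2 * v + 1) * real (N choose j)) * (fps_X ^ (v + 1 + j) * Abs_fps (\<lambda>k. real (n + k choose k))))"
    unfolding inv by (simp add: sum_distrib_left mult_ac power_add fps_of_nat numeral_fps_const fps_const_power flip: fps_const_mult)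
  have "real (sorted_labellings w (2 * m)) = fps_nth (even_gf w) m" by (simp add: even_gf_def)
  also have "\<dots> = (\<Sum>j\<le>N. 2 ^ (2 * v + 1) * real (N choose j) * real (n + (m - (v + 1 + j)) choose (m - (v + 1 + j))))"
    unfolding E fps_sum_nth fps_mult_left_const_nth fps_X_power_mult_nth
    using n assms(3) unfolding n_def[symmetric] by (intro sum.cong refl) auto
  also have "\<dots> = 2 ^ (2 * v + 1) * (\<Sum>j\<le>N. real (N choose j) * real (n + (m - (v + 1 + j)) choose n))"
    by (simp add: sum_distrib_left mult_ac binomial_symmetric[of n "n + _", simplified])
  finally show ?thesis unfolding N_def .
qed

section \<open>Riffles and multinomial cuts\<close>

definition interleaving :: "'i set \<Rightarrow> ('i \<Rightarrow> 'a list) \<Rightarrow> 'a list \<Rightarrow> bool" where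
  "interleaving J P d \<longleftrightarrow> (\<forall>j\<in>J. filter (\<lambda>x. x \<in> set (P j)) d = P j) \<and> length d = (\<Sum>j\<in>J. length (P j))"

text \<open>
  The subsequences of \<open>d\<close> that belong to the packets have total length \<open>length d\<close>, so nothing else is left
  in \<open>d\<close>.
\<close>

lemma interleaving_set:
  assumes "finite J" "disjoint_family_on (\<lambda>j. set (P j)) J" "interleaving J P d"
  shows "set d = (\<Union>j\<in>J. set (P j))"
proof
  show "(\<Union>j\<in>J. set (P j)) \<subseteq> set d"
  proof (rule UN_least)
    fix j assume "j \<in> J"
    then have "filter (\<lambda>x. x \<in> set (P j)) d = P j" using assms(3) unfolding interleaving_def by blast
    then have "set (filter (\<lambda>x. x \<in> set (P j)) d) = set (P j)" by (rule arg_cong)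
    then show "set (P j) \<subseteq> set d" unfolding set_filter by blast
  qed
  show "set d \<subseteq> (\<Union>j\<in>J. set (P j))"
  proof
    fix x assume x: "x \<in> set d"
    define I where "I j = {i. i < length d \<and> d ! i \<in> set (P j)}" for j
    have "length d = (\<Sum>j\<in>J. length (P j))" using assms(3) unfolding interleaving_def by blast
    also have "\<dots> = (\<Sum>j\<in>J. length (filter (\<lambda>x. x \<in> set (P j)) d))"
    proof (rule sum.cong[OF refl])
      fix j assume "j \<in> J"
      then have "filter (\<lambda>x. x \<in> set (P j)) d = P j" using assms(3) unfolding interleaving_def by blast
      then show "length (P j) = length (filter (\<lambda>x. x \<in> set (P j)) d)" by (rule arg_cong[OF sym])
    qed
    also have "\<dots> = (\<Sum>j\<in>J. card (I j))" unfolding I_def length_filter_conv_card ..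
    also have "\<dots> = card (\<Union>j\<in>J. I j)"
    proof (rule card_UN_disjoint[symmetric, OF assms(1)])
      show "\<forall>j\<in>J. finite (I j)" by (simp add: I_def)
      show "\<forall>i\<in>J. \<forall>j\<in>J. i \<noteq> j \<longrightarrow> I i \<inter> I j = {}"
        using assms(2) unfolding I_def disjoint_family_on_def by fast
    qed
    finally have "card (\<Union>j\<in>J. I j) = card {..<length d}" by simp
    moreover have "(\<Union>j\<in>J. I j) \<subseteq> {..<length d}" unfolding I_def by blast
    ultimately have "(\<Union>j\<in>J. I j) = {..<length d}" by (rule card_subset_eq[OF finite_lessThan, rotated])
    moreover obtain i where "i < length d" "d ! i = x" using x unfolding in_set_conv_nth by blast
    ultimately have "i \<in> (\<Union>j\<in>J. I j)" by simp
    then show "x \<in> (\<Union>j\<in>J. set (P j))" using \<open>d ! i = x\<close> unfolding I_def by blast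
  qed
qed

lemma interleaving_snoc:
  assumes J: "finite J" "disjoint_family_on (\<lambda>j. set (P j)) J" "\<And>j. j \<in> J \<Longrightarrow> distinct (P j)"
    and j: "j \<in> J" "P j \<noteq> []"
  shows "interleaving J P (d @ [last (P j)]) \<longleftrightarrow> interleaving J (P(j := butlast (P j))) d"
proof -
  define x where "x = last (P j)"
  define b where "b = butlast (P j)"
  define P' where "P' = P(j := b)"
  have Pj: "P j = b @ [x]" using j by (simp add: x_def b_def)
  have set_Pj: "set (P j) = insert x (set b)" unfolding Pj by simp
  have P'j: "P' j = b" and P'o: "i \<noteq> j \<Longrightarrow> P' i = P i" for i by (simp_all add: P'_def)
  have xb: "x \<notin> set b" using J(3)[OF j(1)] unfolding Pj by simp
  have xo: "x \<notin> set (P i)" if "i \<in> J" "i \<noteq> j" for i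
  proof -
    have "set (P i) \<inter> set (P j) = {}" using J(2) that j unfolding disjoint_family_on_def by blast
    then show ?thesis using set_Pj by blast
  qed
  have sub: "set (P' i) \<subseteq> set (P i)" for i by (cases "i = j") (auto simp: P'j P'o set_Pj)
  have dis': "disjoint_family_on (\<lambda>j. set (P' j)) J"
    using J(2) sub unfolding disjoint_family_on_def by blast
  have len: "(\<Sum>i\<in>J. length (P i)) = Suc (\<Sum>i\<in>J. length (P' i))"
  proof -
    have "length (P j) = Suc (length (P' j))" unfolding Pj P'j by simp
    moreover have "(\<Sum>i\<in>J-{j}. length (P i)) = (\<Sum>i\<in>J-{j}. length (P' i))"
      by (intro sum.cong) (auto simp: P'o)
    ultimately show ?thesis using sum.remove[OF J(1) j(1), of "\<lambda>i. length (P i)"] sum.remove[OF J(1) j(1), of "\<lambda>i. length (P' i)"]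
      by simp
  qed
  have key: "(filter (\<lambda>y. y \<in> set (P i)) (d @ [x]) = P i) = (filter (\<lambda>y. y \<in> set (P' i)) d = P' i)"
    if "x \<notin> set d" "i \<in> J" for i
  proof (cases "i = j")
    case True
    have "filter (\<lambda>y. y \<in> set (P j)) d = filter (\<lambda>y. y \<in> set b) d"
      by (rule filter_cong[OF refl]) (use that in \<open>auto simp: set_Pj\<close>)
    then have "filter (\<lambda>y. y \<in> set (P j)) (d @ [x]) = filter (\<lambda>y. y \<in> set b) d @ [x]"
      by (simp add: set_Pj)
    then show ?thesis unfolding True P'j by (simp add: Pj)
  next
    case False
    then show ?thesis using xo[OF that(2) False] by (simp add: P'o)
  qed
  show ?thesis unfolding x_def[symmetric] b_def[symmetric] unfolding P'_def[symmetric]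
  proof
    assume I: "interleaving J P (d @ [x])"
    have "filter (\<lambda>y. y \<in> set (P j)) (d @ [x]) = P j"
      using I j unfolding interleaving_def by blast
    then have fj: "filter (\<lambda>y. y \<in> set (P j)) d = b" by (simp add: set_Pj) (simp add: Pj)
    have xd: "x \<notin> set d"
    proof
      assume "x \<in> set d"
      then have "x \<in> set (filter (\<lambda>y. y \<in> set (P j)) d)" by (simp add: set_Pj)
      then show False unfolding fj using xb by simp
    qed
    show "interleaving J P' d" unfolding interleaving_def
    proof (intro conjI ballI)
      fix i assume i: "i \<in> J"
      then have "filter (\<lambda>y. y \<in> set (P i)) (d @ [x]) = P i" using I unfolding interleaving_def by blast
      then show "filter (\<lambda>y. y \<in> set (P' i)) d = P' i" unfolding key[OF xd i] .
    next
      have "length (d @ [x]) = (\<Sum>i\<in>J. length (P i))" using I unfolding interleaving_def by blast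
      then show "length d = (\<Sum>i\<in>J. length (P' i))" unfolding len by simp
    qed
  next
    assume I: "interleaving J P' d"
    have "set d = (\<Union>i\<in>J. set (P' i))" by (rule interleaving_set[OF J(1) dis' I])
    moreover have "x \<notin> set (P' i)" if "i \<in> J" for i
      using xb xo[OF that] by (cases "i = j") (simp_all add: P'j P'o)
    ultimately have xd: "x \<notin> set d" by blast
    show "interleaving J P (d @ [x])" unfolding interleaving_def
    proof (intro conjI ballI)
      fix i assume i: "i \<in> J"
      then have "filter (\<lambda>y. y \<in> set (P' i)) d = P' i" using I unfolding interleaving_def by blast
      then show "filter (\<lambda>y. y \<in> set (P i)) (d @ [x]) = P i" unfolding key[OF xd i] .
    next
      have "length d = (\<Sum>i\<in>J. length (P' i))" using I unfolding interleaving_def by blast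
      then show "length (d @ [x]) = (\<Sum>i\<in>J. length (P i))" unfolding len by simp
    qed
  qed
qed

text \<open>
  All interleavings are equally likely: the packet sizes that appear as numerators while the cards are
  dropped multiply to the product of the factorials, in whatever order the packets are chosen.
\<close>

theorem pmf_gsr_riffle:
  assumes "finite J" "disjoint_family_on (\<lambda>j. set (P j)) J" "\<And>j. j \<in> J \<Longrightarrow> distinct (P j)"
    "(\<Sum>j\<in>J. length (P j)) = k"
  shows "pmf (gsr_riffle k J P) d = (if interleaving J P d then (\<Prod>j\<in>J. fact (length (P j))) / fact k else 0)"
  using assms
proof (induction k arbitrary: P d)
  case 0
  then have e: "\<forall>j\<in>J. P j = []" by simp
  then have "(\<Prod>j\<in>J. fact (length (P j))) = (1 :: real)" by simp
  moreover have "interleaving J P d \<longleftrightarrow> d = []" using e by (auto simp: interleaving_def)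
  ultimately show ?case by (simp add: pmf_return)
next
  case (Suc k)
  note J = Suc.prems(1-3)
  have tot: "(\<Sum>i\<in>J. length (P i)) > 0" "real (\<Sum>i\<in>J. length (P i)) = real (Suc k)" using Suc.prems(4) by simp_all
  note pc = pmf_choose_packet[OF J(1) tot(1)]
  define F where "F j = map_pmf (\<lambda>d. d @ [last (P j)]) (gsr_riffle k J (P(j := butlast (P j))))" for j
  have supp: "j \<in> J" if "pmf (choose_packet J P) j \<noteq> 0" for j
    using that unfolding pc by (metis (full_types))
  have "pmf (gsr_riffle (Suc k) J P) d = (\<Sum>j\<in>J. pmf (F j) d * pmf (choose_packet J P) j)"
    unfolding gsr_riffle.simps pmf_bind F_def by (rule integral_measure_pmf_real[OF J(1)]) (use supp in \<open>auto simp: set_pmf_iff\<close>)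
  also have "\<dots> = (\<Sum>j\<in>J. real (length (P j)) / real (Suc k) * pmf (F j) d)"
    by (intro sum.cong refl) (simp add: pc tot(2) del: of_nat_sum)
  finally have S: "pmf (gsr_riffle (Suc k) J P) d = (\<Sum>j\<in>J. real (length (P j)) / real (Suc k) * pmf (F j) d)" .
  show ?case
  proof (cases "\<exists>d' j. j \<in> J \<and> P j \<noteq> [] \<and> d = d' @ [last (P j)]")
    case True
    then obtain d' j where j: "j \<in> J" "P j \<noteq> []" and d: "d = d' @ [last (P j)]" by auto
    define P' where "P' = P(j := butlast (P j))"
    have other: "real (length (P i)) / real (Suc k) * pmf (F i) d = 0" if "i \<in> J - {j}" for i
    proof (cases "P i = []")
      case False
      have "set (P i) \<inter> set (P j) = {}" using J(2) that j unfolding disjoint_family_on_def by blast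
      moreover have "last (P i) \<in> set (P i)" "last (P j) \<in> set (P j)" using False j by simp_all
      ultimately have "last (P i) \<noteq> last (P j)" by (metis disjoint_iff)
      then have "pmf (F i) d = 0" unfolding F_def d by (auto simp: pmf_eq_0_set_pmf)
      then show ?thesis by simp
    qed simp
    have sub: "set (P' i) \<subseteq> set (P i)" for i by (auto simp: P'_def dest: in_set_butlastD)
    have dis': "disjoint_family_on (\<lambda>j. set (P' j)) J"
      using J(2) sub unfolding disjoint_family_on_def by blast
    have dist': "distinct (P' i)" if "i \<in> J" for i using J(3)[OF that] by (cases "i = j") (simp_all add: P'_def distinct_butlast)
    have rest: "(\<Sum>i\<in>J-{j}. length (P i)) = (\<Sum>i\<in>J-{j}. length (P' i))"
      "(\<Prod>i\<in>J-{j}. fact (length (P i)) :: real) = (\<Prod>i\<in>J-{j}. fact (length (P' i)))"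
      by (auto intro!: sum.cong prod.cong simp: P'_def)
    have l: "length (P j) = Suc (length (P' j))" using j by (simp add: P'_def)
    have k': "(\<Sum>i\<in>J. length (P' i)) = k"
      using Suc.prems(4) rest l sum.remove[OF J(1) j(1), of "\<lambda>i. length (P i)"] sum.remove[OF J(1) j(1), of "\<lambda>i. length (P' i)"]
      by simp
    have pr: "(\<Prod>i\<in>J. fact (length (P i)) :: real) = real (length (P j)) * (\<Prod>i\<in>J. fact (length (P' i)))"
      using rest l prod.remove[OF J(1) j(1), of "\<lambda>i. fact (length (P i)) :: real"]
        prod.remove[OF J(1) j(1), of "\<lambda>i. fact (length (P' i)) :: real"] by simp
    have "pmf (F j) d = pmf (gsr_riffle k J P') d'"
      unfolding F_def d P'_def by (rule pmf_map_inj') (auto simp: inj_def)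
    also have "\<dots> = (if interleaving J P' d' then (\<Prod>j\<in>J. fact (length (P' j))) / fact k else 0)"
      by (rule Suc.IH[OF J(1) dis' dist' k'])
    also have "interleaving J P' d' \<longleftrightarrow> interleaving J P d"
      unfolding d P'_def by (rule interleaving_snoc[OF J j, symmetric])
    finally have Fj: "pmf (F j) d = (if interleaving J P d then (\<Prod>j\<in>J. fact (length (P' j))) / fact k else 0)" .
    have "pmf (gsr_riffle (Suc k) J P) d = real (length (P j)) / real (Suc k) * pmf (F j) d"
    proof -
      have "(\<Sum>i\<in>J - {j}. real (length (P i)) / real (Suc k) * pmf (F i) d) = 0"
        by (rule sum.neutral) (use other in blast)
      then show ?thesis unfolding S sum.remove[OF J(1) j(1)] by simp
    qed
    then show ?thesis unfolding Fj pr by (simp add: mult_ac)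
  next
    case False
    have "real (length (P i)) / real (Suc k) * pmf (F i) d = 0" if "i \<in> J" for i
    proof (cases "P i = []")
      case F: False
      then have "pmf (F i) d = 0" unfolding F_def using False that by (auto simp: pmf_eq_0_set_pmf)
      then show ?thesis by simp
    qed simp
    then have "pmf (gsr_riffle (Suc k) J P) d = 0" unfolding S by (rule sum.neutral[OF ballI])
    moreover have "\<not> interleaving J P d"
    proof
      assume I: "interleaving J P d"
      then have "d \<noteq> []" using Suc.prems(4) unfolding interleaving_def by auto
      then obtain d' x where d: "d = d' @ [x]" by (metis append_butlast_last_id)
      have "x \<in> (\<Union>j\<in>J. set (P j))" using interleaving_set[OF J(1,2) I] d by auto
      then obtain j where j: "j \<in> J" "x \<in> set (P j)" by auto
      have "filter (\<lambda>y. y \<in> set (P j)) d = P j" using I j unfolding interleaving_def by blast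
      then have "filter (\<lambda>y. y \<in> set (P j)) d' @ [x] = P j" using j(2) unfolding d by simp
      then have "last (P j) = x" "P j \<noteq> []" by (metis last_snoc, metis snoc_eq_iff_butlast)
      then show False using False j(1) d by blast
    qed
    ultimately show ?thesis by simp
  qed
qed

definition compositions :: "nat \<Rightarrow> nat \<Rightarrow> (nat \<Rightarrow> nat) set" where
  "compositions n k = {N. (\<forall>j. j \<notin> {1..k} \<longrightarrow> N j = 0) \<and> (\<Sum>j=1..k. N j) = n}"

lemma finite_compositions: "finite (compositions n k)"
proof (rule finite_subset)
  show "compositions n k \<subseteq> {N. \<forall>j. (j \<in> {1..k} \<longrightarrow> N j \<in> {..n}) \<and> (j \<notin> {1..k} \<longrightarrow> N j = 0)}"
  proof (intro subsetI CollectI allI conjI impI)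
    fix N j assume N: "N \<in> compositions n k" "j \<in> {1..k}"
    then have "N j \<le> (\<Sum>j=1..k. N j)" by (intro member_le_sum) auto
    then show "N j \<in> {..n}" using N by (simp add: compositions_def)
  qed (simp add: compositions_def)
  show "finite {N. \<forall>j. (j \<in> {1..k} \<longrightarrow> N j \<in> {..n}) \<and> (j \<notin> {1..k} \<longrightarrow> N j = (0::nat))}"
    by (rule finite_set_of_finite_funs) auto
qed

text \<open>
  The assignments of packets to positions with prescribed counts correspond to the arrangements of a
  multiset.
\<close>

theorem pmf_multinomial:
  assumes "k > 0"
  shows "pmf (multinomial_pmf n k) N =
    (if N \<in> compositions n k then fact n / (\<Prod>j=1..k. fact (N j)) / real k ^ n else 0)"
proof -
  define S where "S = PiE_dflt {1..n} (0::nat) (\<lambda>_. {1..k})"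
  define cnt where "cnt f j = card {i \<in> {1..n}. f i = j}" for f :: "nat \<Rightarrow> nat" and j :: nat
  have S: "finite S" "S \<noteq> {}" "card S = k ^ n"
    unfolding S_def using assms by (auto simp: card_PiE_dflt PiE_dflt_empty_iff)
  have M: "multinomial_pmf n k = map_pmf cnt (pmf_of_set S)"
    unfolding multinomial_pmf_def S_def cnt_def using assms by (subst Pi_pmf_of_set) auto
  have p: "pmf (multinomial_pmf n k) N = real (card (S \<inter> cnt -` {N})) / real k ^ n"
    unfolding M pmf_map measure_pmf_of_set[OF S(2,1)] using S by simp
  have cm: "count (mset (map f xs)) j = length (filter (\<lambda>i. j = f i) xs)" for f :: "nat \<Rightarrow> nat" and xs j
    by (induction xs) auto
  have count: "count (mset (map f [1..<Suc n])) j = cnt f j" for f j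
  proof -
    have "count (mset (map f [1..<Suc n])) j = length (filter (\<lambda>i. j = f i) [1..<Suc n])"
      by (rule cm)
    also have "\<dots> = card (set (filter (\<lambda>i. j = f i) [1..<Suc n]))"
      by (rule distinct_card[symmetric]) simp
    also have "set (filter (\<lambda>i. j = f i) [1..<Suc n]) = {i \<in> {1..n}. f i = j}" by auto
    finally show ?thesis by (simp add: cnt_def)
  qed
  show ?thesis
  proof (cases "N \<in> compositions n k")
    case True
    define A where "A = (\<Sum>j=1..k. replicate_mset (N j) j)"
    have cA: "count A j = N j" for j
      using True by (auto simp: A_def count_sum compositions_def)
    have sA: "size A = n" using True by (simp add: A_def compositions_def size_multiset_sum)
    have setA: "set_mset A \<subseteq> {1..k}" using True cA by (auto simp: compositions_def simp flip: count_greater_zero_iff)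
    have "bij_betw (\<lambda>f. map f [1..<Suc n]) (S \<inter> cnt -` {N}) (permutations_of_multiset A)"
    proof (rule bij_betwI')
      fix f g assume "f \<in> S \<inter> cnt -` {N}" "g \<in> S \<inter> cnt -` {N}"
      then have o: "f i = g i" if "i \<notin> {1..n}" for i using that by (auto simp: S_def PiE_dflt_def)
      show "(map f [1..<Suc n] = map g [1..<Suc n]) = (f = g)"
      proof
        assume e: "map f [1..<Suc n] = map g [1..<Suc n]"
        have "f i = g i" if "i \<in> {1..n}" for i using e that by (auto simp del: upt_Suc)
        then show "f = g" using o by blast
      qed simp
    next
      fix f assume "f \<in> S \<inter> cnt -` {N}"
      then have "cnt f = N" by simp
      then have "mset (map f [1..<Suc n]) = A" by (intro multiset_eqI) (simp only: count cA)
      then show "map f [1..<Suc n] \<in> permutations_of_multiset A" by (rule permutations_of_multisetI)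
    next
      fix xs assume "xs \<in> permutations_of_multiset A"
      then have xs: "mset xs = A" by (rule permutations_of_multisetD)
      then have len: "length xs = n" using sA by (metis size_mset)
      define f where "f i = (if i \<in> {1..n} then xs ! (i - 1) else 0)" for i
      have "map f [1..<Suc n] = xs"
        by (rule nth_equalityI) (auto simp: len f_def simp del: upt_Suc)
      moreover from this have "cnt f j = N j" for j unfolding count[symmetric] using xs cA by simp
      moreover have "f i \<in> {1..k}" if "i \<in> {1..n}" for i
      proof -
        have "xs ! (i - 1) \<in> set xs" using that len by (intro nth_mem) auto
        then have "xs ! (i - 1) \<in># A" using xs by (metis set_mset_mset)
        then show ?thesis using that setA by (auto simp: f_def)
      qed
      ultimately show "\<exists>f\<in>S \<inter> cnt -` {N}. xs = map f [1..<Suc n]"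
        by (intro bexI[of _ f]) (auto simp: S_def PiE_dflt_def f_def)
    qed
    then have "card (S \<inter> cnt -` {N}) = card (permutations_of_multiset A)" by (rule bij_betw_same_card)
    also have "\<dots> = fact n div (\<Prod>x\<in>set_mset A. fact (count A x))"
      unfolding card_permutations_of_multiset(1) sA ..
    finally have "real (card (S \<inter> cnt -` {N})) = fact n / real (\<Prod>x\<in>set_mset A. fact (count A x))"
      using card_permutations_of_multiset(2)[of A] unfolding sA by (simp add: real_of_nat_div)
    also have "(\<Prod>x\<in>set_mset A. fact (count A x) :: nat) = (\<Prod>j=1..k. fact (N j))"
      unfolding cA by (rule prod.mono_neutral_left) (use setA cA in \<open>auto simp flip: count_eq_zero_iff\<close>)
    finally show ?thesis unfolding p using True by simp
  next
    case False
    have "S \<inter> cnt -` {N} = {}"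
    proof (rule ccontr)
      assume "S \<inter> cnt -` {N} \<noteq> {}"
      then obtain f where f: "f \<in> S" "cnt f = N" by auto
      have "f i \<in> {1..k}" if "i \<in> {1..n}" for i using f(1) that by (auto simp: S_def PiE_dflt_def)
      then have "{i \<in> {1..n}. f i = j} = {}" if "j \<notin> {1..k}" for j using that by blast
      then have "N j = 0" if "j \<notin> {1..k}" for j using that unfolding f(2)[symmetric] cnt_def by simp
      moreover have "(\<Sum>j=1..k. N j) = card (\<Union>j\<in>{1..k}. {i \<in> {1..n}. f i = j})"
        unfolding f(2)[symmetric] cnt_def by (rule card_UN_disjoint[symmetric]) auto
      moreover have "(\<Union>j\<in>{1..k}. {i \<in> {1..n}. f i = j}) = {1..n}" using \<open>\<And>i. i \<in> {1..n} \<Longrightarrow> f i \<in> {1..k}\<close> by auto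
      ultimately show False using False unfolding compositions_def by simp
    qed
    then show ?thesis unfolding p using False by simp
  qed
qed

section \<open>The law of the shelf shuffle\<close>

text \<open>
  When the cards \<open>1, 2, \<dots>\<close> are cut into packets of sizes \<open>N\<close>, the positions \<open>\<pi>\<close> of consecutive cards
  within a packet increase if the packet is odd and decrease if it is even.
\<close>

definition packets_monotone :: "(nat \<Rightarrow> nat) \<Rightarrow> (nat \<Rightarrow> nat) \<Rightarrow> bool" where
  "packets_monotone \<pi> N \<longleftrightarrow> (\<forall>j\<ge>1. \<forall>a. (\<Sum>i=1..<j. N i) < a \<and> a < (\<Sum>i=1..j. N i) \<longrightarrow> (\<pi> a < \<pi> (Suc a) \<longleftrightarrow> odd j))"

lemma compositions_beyond:
  assumes "N \<in> compositions n k" "k < j"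
  shows "(\<Sum>i=1..<j. N i) = n" "(\<Sum>i=1..j. N i) = n"
proof -
  have N: "N i = 0" if "i \<notin> {1..k}" for i using assms(1) that by (auto simp: compositions_def)
  have n: "(\<Sum>i=1..k. N i) = n" using assms(1) by (auto simp: compositions_def)
  have "(\<Sum>i=1..k. N i) = (\<Sum>i=1..<j. N i)" "(\<Sum>i=1..k. N i) = (\<Sum>i=1..j. N i)"
    by (rule sum.mono_neutral_left; use assms(2) N in auto)+
  then show "(\<Sum>i=1..<j. N i) = n" "(\<Sum>i=1..j. N i) = n" using n by simp_all
qed

lemma compositions_Suc_zero: "N \<in> compositions n (Suc k) \<and> N (Suc k) = 0 \<longleftrightarrow> N \<in> compositions n k"
proof -
  have "(\<forall>j. j \<notin> {1..Suc k} \<longrightarrow> N j = 0) \<and> N (Suc k) = 0 \<longleftrightarrow> (\<forall>j. j \<notin> {1..k} \<longrightarrow> N j = 0)"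
    by (metis atLeastAtMost_iff le_Suc_eq Suc_n_not_le_n)
  moreover have "(\<Sum>j=1..Suc k. N j) = (\<Sum>j=1..k. N j) + N (Suc k)" by simp
  ultimately show ?thesis unfolding compositions_def mem_Collect_eq
    by (metis add.right_neutral)
qed

text \<open>
  Adding the card \<open>n + 1\<close> to the last packet creates one new condition, on the cards \<open>n\<close> and
  \<open>n + 1\<close>, and does so only if that packet was not empty before.
\<close>

lemma packets_monotone_add_card:
  assumes N': "N' \<in> compositions n (Suc k)"
  defines "N \<equiv> N'(Suc k := Suc (N' (Suc k)))"
  shows "N \<in> compositions (Suc n) (Suc k)"
    and "packets_monotone \<pi> N \<longleftrightarrow> packets_monotone \<pi> N' \<and> (N' (Suc k) > 0 \<longrightarrow> (\<pi> n < \<pi> (Suc n) \<longleftrightarrow> odd (Suc k)))"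
proof -
  have low: "(\<Sum>i=1..<j. N i) = (\<Sum>i=1..<j. N' i)" if "j \<le> Suc k" for j
    by (rule sum.cong) (use that in \<open>auto simp: N_def\<close>)
  have low': "(\<Sum>i=1..j. N i) = (\<Sum>i=1..j. N' i)" if "j \<le> k" for j
    by (rule sum.cong) (use that in \<open>auto simp: N_def\<close>)
  have tot': "(\<Sum>i=1..Suc k. N' i) = n" using N' by (simp add: compositions_def)
  have "(\<Sum>i=1..Suc k. N i) = (\<Sum>i=1..k. N i) + N (Suc k)" "(\<Sum>i=1..Suc k. N' i) = (\<Sum>i=1..k. N' i) + N' (Suc k)" by simp_all
  then have tot: "(\<Sum>i=1..Suc k. N i) = Suc n" unfolding low'[OF order_refl] tot' by (simp add: N_def)
  show C: "N \<in> compositions (Suc n) (Suc k)"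
    using N' tot unfolding compositions_def mem_Collect_eq by (auto simp: N_def)
  have s: "(\<Sum>i=1..<Suc k. N' i) + N' (Suc k) = n"
    using tot' by (simp add: atLeastLessThanSuc_atLeastAtMost)
  define Q where "Q M j \<longleftrightarrow> (\<forall>a. (\<Sum>i=1..<j. M i) < a \<and> a < (\<Sum>i=1..j. M i) \<longrightarrow> (\<pi> a < \<pi> (Suc a) \<longleftrightarrow> odd j))" for M :: "nat \<Rightarrow> nat" and j
  have ag: "packets_monotone \<pi> M \<longleftrightarrow> (\<forall>j\<ge>1. Q M j)" for M unfolding packets_monotone_def Q_def ..
  have e1: "Q N j = Q N' j" if "j \<le> k" for j unfolding Q_def using low[of j] low'[of j] that by simp
  have e2: "Q N j" "Q N' j" if "Suc k < j" for j
    unfolding Q_def compositions_beyond[OF C that] compositions_beyond[OF N' that] by auto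
  have e3: "Q N (Suc k) \<longleftrightarrow> Q N' (Suc k) \<and> (N' (Suc k) > 0 \<longrightarrow> (\<pi> n < \<pi> (Suc n) \<longleftrightarrow> odd (Suc k)))"
  proof -
    have "Q N (Suc k) \<longleftrightarrow> (\<forall>a. (\<Sum>i=1..<Suc k. N' i) < a \<and> a < Suc n \<longrightarrow> (\<pi> a < \<pi> (Suc a) \<longleftrightarrow> odd (Suc k)))"
      unfolding Q_def low[OF order_refl] tot ..
    also have "\<dots> \<longleftrightarrow> (\<forall>a. (\<Sum>i=1..<Suc k. N' i) < a \<and> a < n \<longrightarrow> (\<pi> a < \<pi> (Suc a) \<longleftrightarrow> odd (Suc k))) \<and>
       ((\<Sum>i=1..<Suc k. N' i) < n \<longrightarrow> (\<pi> n < \<pi> (Suc n) \<longleftrightarrow> odd (Suc k)))"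
      by (auto simp: less_Suc_eq)
    also have "(\<Sum>i=1..<Suc k. N' i) < n \<longleftrightarrow> N' (Suc k) > 0" using s by linarith
    finally show ?thesis unfolding Q_def tot' .
  qed
  have split_at: "(\<forall>j\<ge>1. Q N j) \<longleftrightarrow> (\<forall>j\<ge>1. Q N' j) \<and> C"
    if "\<And>j. j \<le> k \<Longrightarrow> Q N j = Q N' j" "\<And>j. Suc k < j \<Longrightarrow> Q N j" "\<And>j. Suc k < j \<Longrightarrow> Q N' j"
      "Q N (Suc k) \<longleftrightarrow> Q N' (Suc k) \<and> C" for C
  proof -
    have eq: "Q N j \<longleftrightarrow> Q N' j \<and> (j = Suc k \<longrightarrow> C)" for j
      using that(1,2,3)[of j] that(4) by (cases j "Suc k" rule: linorder_cases) auto
    show ?thesis unfolding eq by auto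
  qed
  show "packets_monotone \<pi> N \<longleftrightarrow> packets_monotone \<pi> N' \<and> (N' (Suc k) > 0 \<longrightarrow> (\<pi> n < \<pi> (Suc n) \<longleftrightarrow> odd (Suc k)))"
    unfolding ag by (rule split_at[OF e1 e2 e3])
qed

text \<open>
  Compositions are labellings by packet numbers in disguise. The induction removes the last card from
  its packet and follows the recursion of \<open>sorted_labellings\<close>.
\<close>

theorem card_packets_monotone:
  "card {N \<in> compositions n k. packets_monotone \<pi> N} = sorted_labellings (map \<pi> (rev [1..<Suc n])) k"
proof (induction n arbitrary: k)
  case 0
  have "N = (\<lambda>_. 0)" if "N \<in> compositions 0 k" for N
  proof
    fix j show "N j = 0" using that by (cases "j \<in> {1..k}") (simp_all add: compositions_def)
  qed
  moreover have "(\<lambda>_. 0) \<in> compositions 0 k" by (simp add: compositions_def)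
  ultimately have "compositions 0 k = {\<lambda>_. 0}" by blast
  moreover have "packets_monotone \<pi> (\<lambda>_. 0)" by (simp add: packets_monotone_def)
  ultimately have "{N \<in> compositions 0 k. packets_monotone \<pi> N} = {\<lambda>_. 0}" by auto
  then show ?case by simp
next
  case (Suc n)
  define A where "A n k = {N \<in> compositions n k. packets_monotone \<pi> N}" for n k
  have fin: "finite (A n k)" for n k unfolding A_def by (rule finite_subset[OF _ finite_compositions]) auto
  define B where "B k = {N \<in> A n (Suc k). N (Suc k) > 0 \<longrightarrow> (\<pi> n < \<pi> (Suc n) \<longleftrightarrow> odd (Suc k))}" for k
  have A0: "A n k = {N \<in> A n (Suc k). N (Suc k) = 0}" for n k
    unfolding A_def using compositions_Suc_zero by blast
  have step: "card (A (Suc n) (Suc k)) = card (A (Suc n) k) + card (B k)" for k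
  proof -
    have "bij_betw (\<lambda>N. N(Suc k := Suc (N (Suc k)))) (B k) {N \<in> A (Suc n) (Suc k). N (Suc k) > 0}"
    proof (rule bij_betwI[where g = "\<lambda>N. N(Suc k := N (Suc k) - 1)"])
      show "(\<lambda>N. N(Suc k := Suc (N (Suc k)))) \<in> B k \<rightarrow> {N \<in> A (Suc n) (Suc k). 0 < N (Suc k)}"
      proof
        fix N' assume "N' \<in> B k"
        then have "(N' \<in> compositions n (Suc k) \<and> packets_monotone \<pi> N') \<and> (N' (Suc k) > 0 \<longrightarrow> (\<pi> n < \<pi> (Suc n) \<longleftrightarrow> odd (Suc k)))"
          unfolding B_def A_def mem_Collect_eq .
        then have N': "N' \<in> compositions n (Suc k)" "packets_monotone \<pi> N' \<and> (N' (Suc k) > 0 \<longrightarrow> (\<pi> n < \<pi> (Suc n) \<longleftrightarrow> odd (Suc k)))"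
          unfolding conj_assoc by (rule conjunct1, rule conjunct2)
        have "N'(Suc k := Suc (N' (Suc k))) \<in> A (Suc n) (Suc k)"
          unfolding A_def packets_monotone_add_card(2)[OF N'(1)] mem_Collect_eq
          by (rule conjI[OF packets_monotone_add_card(1)[OF N'(1)] N'(2)])
        then show "N'(Suc k := Suc (N' (Suc k))) \<in> {N \<in> A (Suc n) (Suc k). 0 < N (Suc k)}" by simp
      qed
      show "(\<lambda>N. N(Suc k := N (Suc k) - 1)) \<in> {N \<in> A (Suc n) (Suc k). 0 < N (Suc k)} \<rightarrow> B k"
      proof
        fix N assume "N \<in> {N \<in> A (Suc n) (Suc k). 0 < N (Suc k)}"
        then have N: "N \<in> compositions (Suc n) (Suc k)" "packets_monotone \<pi> N" "N (Suc k) > 0" by (auto simp: A_def)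
        define N' where "N' = N(Suc k := N (Suc k) - 1)"
        have NN: "N = N'(Suc k := Suc (N' (Suc k)))" using N(3) by (auto simp: N'_def)
        have "(\<Sum>i=1..k. N' i) = (\<Sum>i=1..k. N i)" by (rule sum.cong) (auto simp: N'_def)
        moreover have "(\<Sum>i=1..Suc k. N i) = (\<Sum>i=1..k. N i) + N (Suc k)" "(\<Sum>i=1..Suc k. N' i) = (\<Sum>i=1..k. N' i) + N' (Suc k)" by simp_all
        moreover have "(\<Sum>i=1..Suc k. N i) = Suc n" using N(1) by (simp add: compositions_def)
        moreover have "N' (Suc k) = N (Suc k) - 1" by (simp add: N'_def)
        ultimately have "(\<Sum>i=1..Suc k. N' i) = n" using N(3) by linarith
        then have C: "N' \<in> compositions n (Suc k)" using N(1) unfolding compositions_def mem_Collect_eq by (auto simp: N'_def)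
        have "packets_monotone \<pi> N' \<and> (N' (Suc k) > 0 \<longrightarrow> (\<pi> n < \<pi> (Suc n) \<longleftrightarrow> odd (Suc k)))"
          using packets_monotone_add_card(2)[OF C, of \<pi>] N(2) unfolding NN[symmetric] by blast
        then show "N(Suc k := N (Suc k) - 1) \<in> B k" using C unfolding B_def A_def N'_def[symmetric] by blast
      qed
    qed auto
    then have "card {N \<in> A (Suc n) (Suc k). N (Suc k) > 0} = card (B k)" by (rule bij_betw_same_card[symmetric])
    moreover have "A (Suc n) (Suc k) = A (Suc n) k \<union> {N \<in> A (Suc n) (Suc k). N (Suc k) > 0}"
      unfolding A0[of "Suc n" k] by auto
    moreover have "A (Suc n) k \<inter> {N \<in> A (Suc n) (Suc k). N (Suc k) > 0} = {}"
      unfolding A0[of "Suc n" k] by auto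
    moreover have "finite {N \<in> A (Suc n) (Suc k). N (Suc k) > 0}" using fin[of "Suc n" "Suc k"] by simp
    ultimately show ?thesis using card_Un_disjoint[OF fin[of "Suc n" k]] by metis
  qed
  have IH: "card (A n k) = sorted_labellings (map \<pi> (rev [1..<Suc n])) k" for k
    unfolding A_def by (rule Suc.IH)
  have B: "card (B k) = sorted_labellings (map \<pi> (rev [1..<Suc n])) (if (\<pi> n < \<pi> (Suc n)) = odd (Suc k) then Suc k else k)" for k
  proof (cases "(\<pi> n < \<pi> (Suc n)) = odd (Suc k)")
    case True
    then have "B k = A n (Suc k)" unfolding B_def by blast
    then show ?thesis using True IH by simp
  next
    case False
    then have "B k = {N \<in> A n (Suc k). \<not> 0 < N (Suc k)}" unfolding B_def by blast
    then have "B k = A n k" unfolding A0[of n k] not_gr_zero .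
    then show ?thesis using False IH by simp
  qed
  have "card (A (Suc n) k) = sorted_labellings (map \<pi> (rev [1..<Suc (Suc n)])) k"
  proof (induction k)
    case 0
    have "A (Suc n) 0 = {}" by (auto simp: A_def compositions_def)
    moreover have "sorted_labellings (x # r) 0 = 0" for x r by (cases r) auto
    ultimately show ?case by simp
  next
    case (Suc k)
    show ?case
    proof (cases n)
      case 0
      then show ?thesis unfolding step Suc B by simp
    next
      case (Suc n')
      have w: "map \<pi> (rev [1..<Suc (Suc n)]) = \<pi> (Suc n) # \<pi> n # map \<pi> (rev [1..<Suc n'])"
        "map \<pi> (rev [1..<Suc n]) = \<pi> n # map \<pi> (rev [1..<Suc n'])"
        unfolding Suc by simp_all
      show ?thesis unfolding step \<open>card (A (Suc n) k) = _\<close> B unfolding w sorted_labellings_Suc ..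
    qed
  qed
  then show ?case unfolding A_def .
qed

text \<open>
  A list that is strictly sorted with respect to an injective key is determined by its set.
\<close>

lemma filter_eq_sorted:
  fixes \<pi> :: "nat \<Rightarrow> nat"
  assumes d: "sorted_wrt (\<lambda>x y. \<pi> x < \<pi> y) d" "inj \<pi>" and P: "set P \<subseteq> set d"
  shows "filter (\<lambda>x. x \<in> set P) d = P \<longleftrightarrow> sorted_wrt (\<lambda>x y. \<pi> x < \<pi> y) P"
proof
  assume e: "filter (\<lambda>x. x \<in> set P) d = P"
  have "sorted_wrt (\<lambda>x y. \<pi> x < \<pi> y) (filter (\<lambda>x. x \<in> set P) d)" by (rule sorted_wrt_filter[OF d(1)])
  then show "sorted_wrt (\<lambda>x y. \<pi> x < \<pi> y) P" unfolding e .
next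
  assume s: "sorted_wrt (\<lambda>x y. \<pi> x < \<pi> y) P"
  let ?F = "filter (\<lambda>x. x \<in> set P) d"
  have "sorted_wrt (<) (map \<pi> ?F)" "sorted_wrt (<) (map \<pi> P)"
    using s sorted_wrt_filter[OF d(1)] by (simp_all add: sorted_wrt_map)
  moreover have "set (map \<pi> ?F) = set (map \<pi> P)" using P by auto
  ultimately have "map \<pi> ?F = map \<pi> P" by (simp add: strict_sorted_equal)
  then show "?F = P" using d(2) by (simp add: inj_map_eq_map)
qed

lemma sorted_wrt_upt:
  fixes \<pi> :: "nat \<Rightarrow> nat"
  shows "sorted_wrt (\<lambda>x y. \<pi> x < \<pi> y) [a..<b] \<longleftrightarrow> (\<forall>i. a \<le> i \<and> Suc i < b \<longrightarrow> \<pi> i < \<pi> (Suc i))"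
    and "sorted_wrt (\<lambda>x y. \<pi> y < \<pi> x) [a..<b] \<longleftrightarrow> (\<forall>i. a \<le> i \<and> Suc i < b \<longrightarrow> \<pi> (Suc i) < \<pi> i)"
proof -
  have *: "(\<forall>i. Suc i < b - a \<longrightarrow> R (a + i) (a + Suc i)) \<longleftrightarrow> (\<forall>i. a \<le> i \<and> Suc i < b \<longrightarrow> R i (Suc i))" for R
  proof safe
    fix i assume "\<forall>i. Suc i < b - a \<longrightarrow> R (a + i) (a + Suc i)" "a \<le> i" "Suc i < b"
    then obtain t where "i = a + t" by (metis le_Suc_ex)
    then show "R i (Suc i)" using \<open>\<forall>i. Suc i < b - a \<longrightarrow> R (a + i) (a + Suc i)\<close> \<open>Suc i < b\<close> by simp
  next
    fix i assume "\<forall>i. a \<le> i \<and> Suc i < b \<longrightarrow> R i (Suc i)" "Suc i < b - a"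
    then show "R (a + i) (a + Suc i)" by simp
  qed
  have "sorted_wrt (\<lambda>x y. \<pi> x < \<pi> y) [a..<b] \<longleftrightarrow> (\<forall>i. Suc i < b - a \<longrightarrow> \<pi> (a + i) < \<pi> (a + Suc i))"
    by (subst sorted_wrt_iff_nth_Suc_transp) (auto simp: transp_def)
  then show "sorted_wrt (\<lambda>x y. \<pi> x < \<pi> y) [a..<b] \<longleftrightarrow> (\<forall>i. a \<le> i \<and> Suc i < b \<longrightarrow> \<pi> i < \<pi> (Suc i))"
    unfolding *[of "\<lambda>x y. \<pi> x < \<pi> y"] .
  have "sorted_wrt (\<lambda>x y. \<pi> y < \<pi> x) [a..<b] \<longleftrightarrow> (\<forall>i. Suc i < b - a \<longrightarrow> \<pi> (a + Suc i) < \<pi> (a + i))"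
    by (subst sorted_wrt_iff_nth_Suc_transp) (auto simp: transp_def)
  then show "sorted_wrt (\<lambda>x y. \<pi> y < \<pi> x) [a..<b] \<longleftrightarrow> (\<forall>i. a \<le> i \<and> Suc i < b \<longrightarrow> \<pi> (Suc i) < \<pi> i)"
    unfolding *[of "\<lambda>x y. \<pi> y < \<pi> x"] .
qed

lemma set_shelf_packet: "set (shelf_packet N j) = {(\<Sum>i=1..<j. N i) + 1..(\<Sum>i=1..j. N i)}"
  by (auto simp: shelf_packet_def packet_def)

lemma distinct_shelf_packet: "distinct (shelf_packet N j)"
  by (simp add: shelf_packet_def packet_def)

lemma length_shelf_packet: "j \<ge> 1 \<Longrightarrow> length (shelf_packet N j) = N j"
proof -
  assume "j \<ge> 1"
  then have "{1..j} = insert j {1..<j}" by auto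
  then have "(\<Sum>i=1..j. N i) = N j + (\<Sum>i=1..<j. N i)" by simp
  then show ?thesis by (simp add: shelf_packet_def packet_def)
qed

lemma disjoint_shelf_packets: "disjoint_family_on (\<lambda>j. set (shelf_packet N j)) {1..k}"
proof -
  have *: "set (shelf_packet N i) \<inter> set (shelf_packet N j) = {}" if "i < j" for i j
  proof -
    have "(\<Sum>i=1..i. N i) \<le> (\<Sum>i=1..<j. N i)" by (rule sum_mono2) (use that in auto)
    then show ?thesis by (auto simp: set_shelf_packet)
  qed
  show ?thesis unfolding disjoint_family_on_def
  proof (intro ballI impI)
    fix i j :: nat assume "i \<noteq> j"
    then show "set (shelf_packet N i) \<inter> set (shelf_packet N j) = {}"
      using *[of i j] *[of j i] by (cases "i < j") auto
  qed
qed

lemma shelf_packets_cover: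
  assumes "N \<in> compositions n k"
  shows "(\<Union>j\<in>{1..k}. set (shelf_packet N j)) = {1..n}"
proof (rule card_subset_eq)
  have tot: "(\<Sum>j=1..k. N j) = n" using assms by (simp add: compositions_def)
  show "(\<Union>j\<in>{1..k}. set (shelf_packet N j)) \<subseteq> {1..n}"
  proof (rule UN_least)
    fix j assume "j \<in> {1..k}"
    then have "(\<Sum>i=1..j. N i) \<le> (\<Sum>i=1..k. N i)" by (intro sum_mono2) auto
    then show "set (shelf_packet N j) \<subseteq> {1..n}" unfolding tot set_shelf_packet by auto
  qed
  have "card (\<Union>j\<in>{1..k}. set (shelf_packet N j)) = (\<Sum>j\<in>{1..k}. card (set (shelf_packet N j)))"
    by (rule card_UN_disjoint) (use disjoint_shelf_packets[of N k] in \<open>auto simp: disjoint_family_on_def\<close>)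
  also have "\<dots> = (\<Sum>j\<in>{1..k}. N j)"
    by (rule sum.cong) (auto simp: distinct_card distinct_shelf_packet length_shelf_packet)
  finally show "card (\<Union>j\<in>{1..k}. set (shelf_packet N j)) = card {1..n}" using tot by simp
qed simp

text \<open>
  In the deck given by \<open>\<sigma>\<close> the card \<open>x\<close> is in position \<open>inv \<sigma> x\<close>. Hence a packet keeps its order in that
  deck if and only if the positions of its cards increase along it.
\<close>

lemma interleaving_packets_monotone:
  assumes \<sigma>: "\<sigma> permutes {1..n}" and N: "N \<in> compositions n k"
  shows "interleaving {1..k} (shelf_packet N) (map \<sigma> [1..<Suc n]) \<longleftrightarrow> packets_monotone (inv \<sigma>) N"
proof -
  define \<pi> where "\<pi> = inv \<sigma>"
  let ?d = "map \<sigma> [1..<Suc n]"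
  have inj: "inj \<pi>" unfolding \<pi>_def by (rule permutes_inj[OF permutes_inv[OF \<sigma>]])
  have sorted: "sorted_wrt (\<lambda>x y. \<pi> x < \<pi> y) ?d"
    unfolding sorted_wrt_map \<pi>_def permutes_inverses(2)[OF \<sigma>] by (simp del: upt_Suc)
  have "set ?d = \<sigma> ` {1..n}" by auto
  then have setd: "set ?d = {1..n}" using permutes_image[OF \<sigma>] by simp
  have len: "(\<Sum>j=1..k. length (shelf_packet N j)) = n"
    using N by (simp add: length_shelf_packet compositions_def)
  have pk: "filter (\<lambda>x. x \<in> set (shelf_packet N j)) ?d = shelf_packet N j \<longleftrightarrow>
      (\<forall>a. (\<Sum>i=1..<j. N i) < a \<and> a < (\<Sum>i=1..j. N i) \<longrightarrow> (\<pi> a < \<pi> (Suc a) \<longleftrightarrow> odd j))" if j: "j \<in> {1..k}" for j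
  proof -
    have sub: "set (shelf_packet N j) \<subseteq> set ?d" unfolding setd shelf_packets_cover[OF N, symmetric] using j by blast
    have "sorted_wrt (\<lambda>x y. \<pi> x < \<pi> y) (shelf_packet N j) \<longleftrightarrow>
      (\<forall>a. (\<Sum>i=1..<j. N i) + 1 \<le> a \<and> Suc a < (\<Sum>i=1..j. N i) + 1 \<longrightarrow> (\<pi> a < \<pi> (Suc a) \<longleftrightarrow> odd j))"
    proof (cases "even j")
      case True
      have "\<pi> (Suc a) < \<pi> a \<longleftrightarrow> \<not> \<pi> a < \<pi> (Suc a)" for a
      proof -
        have "\<pi> a \<noteq> \<pi> (Suc a)" using injD[OF inj, of a "Suc a"] by auto
        then show ?thesis by linarith
      qed
      then show ?thesis using True unfolding shelf_packet_def packet_def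
        by (simp add: sorted_wrt_rev sorted_wrt_upt del: upt_Suc)
    next
      case False
      then show ?thesis unfolding shelf_packet_def packet_def by (simp add: sorted_wrt_upt del: upt_Suc)
    qed
    then show ?thesis unfolding filter_eq_sorted[OF sorted inj sub] by (simp add: Suc_le_eq)
  qed
  have "interleaving {1..k} (shelf_packet N) ?d \<longleftrightarrow>
    (\<forall>j\<in>{1..k}. \<forall>a. (\<Sum>i=1..<j. N i) < a \<and> a < (\<Sum>i=1..j. N i) \<longrightarrow> (\<pi> a < \<pi> (Suc a) \<longleftrightarrow> odd j))"
    unfolding interleaving_def len using pk by simp
  also have "\<dots> \<longleftrightarrow> packets_monotone \<pi> N"
  proof -
    have "\<not> ((\<Sum>i=1..<j. N i) < a \<and> a < (\<Sum>i=1..j. N i))" if "k < j" for j a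
      using compositions_beyond[OF N that] by simp
    then have "(\<forall>a. (\<Sum>i=1..<j. N i) < a \<and> a < (\<Sum>i=1..j. N i) \<longrightarrow> (\<pi> a < \<pi> (Suc a) \<longleftrightarrow> odd j))" if "k < j" for j
      using that by blast
    then show ?thesis unfolding packets_monotone_def by (meson atLeastAtMost_iff linorder_not_less)
  qed
  finally show ?thesis unfolding \<pi>_def .
qed

lemma pmf_map_unique_preimage:
  assumes "\<And>x. x \<in> set_pmf p \<Longrightarrow> f x = y \<longleftrightarrow> x = x0"
  shows "pmf (map_pmf f p) y = pmf p x0"
proof -
  have "pmf (map_pmf f p) y = measure p (f -` {y} \<inter> set_pmf p)"
    by (simp add: pmf_map measure_Int_set_pmf)
  also have "f -` {y} \<inter> set_pmf p = {x0} \<inter> set_pmf p" using assms by auto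
  also have "measure p ({x0} \<inter> set_pmf p) = pmf p x0"
    by (simp add: measure_Int_set_pmf measure_pmf_single)
  finally show ?thesis .
qed

text \<open>
  The multinomial probability of a cut and the probability of one of its interleavings multiply to
  \<open>1/(2m)\<^sup>n\<close>, so the law counts the cuts that can produce \<open>\<sigma>\<close>.
\<close>

theorem pmf_inv_shelf_shuffle:
  assumes "m > 0"
  shows "set_pmf (inv_shelf_shuffle n m) \<subseteq> {\<sigma>. \<sigma> permutes {1..n}}"
    and "\<sigma> permutes {1..n} \<Longrightarrow> pmf (inv_shelf_shuffle n m) \<sigma> =
      real (sorted_labellings (map (inv \<sigma>) (rev [1..<Suc n])) (2 * m)) / real (2 * m) ^ n"
proof -
  define k where "k = 2 * m"
  have k: "k > 0" using assms by (simp add: k_def)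
  define G where "G N = gsr_riffle n {1..k} (shelf_packet N)" for N
  have mult: "pmf (multinomial_pmf n k) N =
    (if N \<in> compositions n k then fact n / (\<Prod>j=1..k. fact (N j)) / real k ^ n else 0)" for N
    by (rule pmf_multinomial[OF k])
  have supp: "N \<in> compositions n k" if "N \<in> set_pmf (multinomial_pmf n k)" for N
    using that unfolding set_pmf_iff mult by (rule contrapos_np) simp
  have G: "pmf (G N) d = (if interleaving {1..k} (shelf_packet N) d then (\<Prod>j=1..k. fact (N j)) / fact n else 0)"
    if N: "N \<in> compositions n k" for N d
  proof -
    have "(\<Sum>j\<in>{1..k}. length (shelf_packet N j)) = n" using N by (simp add: length_shelf_packet compositions_def)
    from pmf_gsr_riffle[OF _ disjoint_shelf_packets distinct_shelf_packet this]
    show ?thesis unfolding G_def by (simp add: length_shelf_packet)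
  qed
  have deck: "length d = n" "set d = {1..n}" if N: "N \<in> compositions n k" and d: "d \<in> set_pmf (G N)" for N d
  proof -
    have "interleaving {1..k} (shelf_packet N) d" using d unfolding set_pmf_iff G[OF N] by (rule contrapos_np) simp
    then show "set d = {1..n}"
      unfolding shelf_packets_cover[OF N, symmetric]
      by (rule interleaving_set[OF finite_atLeastAtMost disjoint_shelf_packets])
    have "(\<Sum>j\<in>{1..k}. length (shelf_packet N j)) = n" using N by (simp add: length_shelf_packet compositions_def)
    then show "length d = n" using \<open>interleaving {1..k} (shelf_packet N) d\<close> unfolding interleaving_def by blast
  qed
  have I: "inv_shelf_shuffle n m = bind_pmf (multinomial_pmf n k) (\<lambda>N. map_pmf (perm_of_deck n) (G N))"
    unfolding inv_shelf_shuffle_def k_def G_def ..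
  show "set_pmf (inv_shelf_shuffle n m) \<subseteq> {\<sigma>. \<sigma> permutes {1..n}}"
  proof
    fix \<sigma> assume "\<sigma> \<in> set_pmf (inv_shelf_shuffle n m)"
    then obtain N d where Nd: "N \<in> set_pmf (multinomial_pmf n k)" "d \<in> set_pmf (G N)" "\<sigma> = perm_of_deck n d"
      unfolding I by auto
    note dk = deck[OF supp[OF Nd(1)] Nd(2)]
    have "distinct d" by (rule card_distinct) (simp add: dk)
    have "bij_betw (\<lambda>i. i - 1) {1..n} {..<n}"
      by (rule bij_betwI[where g = Suc]) auto
    moreover have "bij_betw ((!) d) {..<n} {1..n}"
      by (rule bij_betw_nth) (use \<open>distinct d\<close> dk in auto)
    ultimately have "bij_betw ((!) d \<circ> (\<lambda>i. i - 1)) {1..n} {1..n}" by (rule bij_betw_trans)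
    then have "bij_betw \<sigma> {1..n} {1..n}"
      by (rule bij_betw_cong[THEN iffD1, rotated]) (simp add: Nd(3) perm_of_deck_def)
    moreover have "\<sigma> i = i" if "i \<notin> {1..n}" for i
      unfolding Nd(3) perm_of_deck_def by (rule if_not_P[OF that])
    ultimately have "\<sigma> permutes {1..n}" by (rule bij_imp_permutes)
    then show "\<sigma> \<in> {\<sigma>. \<sigma> permutes {1..n}}" by simp
  qed
  assume \<sigma>: "\<sigma> permutes {1..n}"
  have pre: "perm_of_deck n d = \<sigma> \<longleftrightarrow> d = map \<sigma> [1..<Suc n]" if "length d = n" for d
  proof
    assume e: "perm_of_deck n d = \<sigma>"
    show "d = map \<sigma> [1..<Suc n]"
    proof (rule nth_equalityI)
      fix i assume "i < length d"
      then show "d ! i = map \<sigma> [1..<Suc n] ! i" using that unfolding e[symmetric]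
        by (simp add: perm_of_deck_def del: upt_Suc)
    qed (use that in simp)
  next
    assume "d = map \<sigma> [1..<Suc n]"
    then have "perm_of_deck n d i = \<sigma> i" for i
    proof (cases "i \<in> {1..n}")
      case True
      then have "map \<sigma> [1..<Suc n] ! (i - 1) = \<sigma> i" by (subst nth_map) (auto simp del: upt_Suc)
      then show ?thesis using True \<open>d = _\<close> by (simp add: perm_of_deck_def del: upt_Suc)
    next
      case False
      show ?thesis using permutes_not_in[OF \<sigma> False] unfolding perm_of_deck_def if_not_P[OF False] by (rule sym)
    qed
    then show "perm_of_deck n d = \<sigma>" by (rule ext)
  qed
  have single: "pmf (map_pmf (perm_of_deck n) (G N)) \<sigma> * pmf (multinomial_pmf n k) N =
     (if packets_monotone (inv \<sigma>) N then 1 / real k ^ n else 0)" if N: "N \<in> compositions n k" for N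
  proof -
    have "pmf (map_pmf (perm_of_deck n) (G N)) \<sigma> = pmf (G N) (map \<sigma> [1..<Suc n])"
      by (rule pmf_map_unique_preimage) (rule pre, rule deck(1)[OF N])
    also have "\<dots> = (if packets_monotone (inv \<sigma>) N then (\<Prod>j=1..k. fact (N j)) / fact n else 0)"
      unfolding G[OF N] interleaving_packets_monotone[OF \<sigma> N] ..
    finally show ?thesis unfolding mult using N by (simp add: prod_zero_iff)
  qed
  have "pmf (inv_shelf_shuffle n m) \<sigma> = (\<Sum>N\<in>compositions n k. pmf (map_pmf (perm_of_deck n) (G N)) \<sigma> * pmf (multinomial_pmf n k) N)"
    unfolding I pmf_bind by (rule integral_measure_pmf_real[OF finite_compositions]) (rule supp)
  also have "\<dots> = (\<Sum>N\<in>compositions n k. if packets_monotone (inv \<sigma>) N then 1 / real k ^ n else 0)"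
    by (rule sum.cong[OF refl single])
  also have "\<dots> = real (card {N \<in> compositions n k. packets_monotone (inv \<sigma>) N}) / real k ^ n"
    by (simp add: sum.inter_filter[symmetric] finite_compositions)
  finally show "pmf (inv_shelf_shuffle n m) \<sigma> =
      real (sorted_labellings (map (inv \<sigma>) (rev [1..<Suc n])) (2 * m)) / real (2 * m) ^ n"
    unfolding card_packets_monotone k_def .
qed

theorem pmf_shelf_shuffle:
  assumes "m > 0"
  shows "set_pmf (shelf_shuffle n m) \<subseteq> {\<pi>. \<pi> permutes {1..n}}"
    and "\<pi> permutes {1..n} \<Longrightarrow> pmf (shelf_shuffle n m) \<pi> =
      real (sorted_labellings (map \<pi> (rev [1..<Suc n])) (2 * m)) / real (2 * m) ^ n"
proof -
  note supp = pmf_inv_shelf_shuffle(1)[OF assms, of n]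
  show "set_pmf (shelf_shuffle n m) \<subseteq> {\<pi>. \<pi> permutes {1..n}}"
    using supp unfolding shelf_shuffle_def by (auto intro: permutes_inv)
  assume \<pi>: "\<pi> permutes {1..n}"
  have "pmf (shelf_shuffle n m) \<pi> = pmf (inv_shelf_shuffle n m) (inv \<pi>)"
    unfolding shelf_shuffle_def
  proof (rule pmf_map_unique_preimage)
    fix \<sigma> assume "\<sigma> \<in> set_pmf (inv_shelf_shuffle n m)"
    then have "\<sigma> permutes {1..n}" using supp by auto
    then show "inv \<sigma> = \<pi> \<longleftrightarrow> \<sigma> = inv \<pi>" using permutes_inv_inv[OF \<pi>] permutes_inv_inv[of \<sigma>] by auto
  qed
  also have "\<dots> = real (sorted_labellings (map (inv (inv \<pi>)) (rev [1..<Suc n])) (2 * m)) / real (2 * m) ^ n"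
    by (rule pmf_inv_shelf_shuffle(2)[OF assms permutes_inv[OF \<pi>]])
  finally show "pmf (shelf_shuffle n m) \<pi> =
      real (sorted_labellings (map \<pi> (rev [1..<Suc n])) (2 * m)) / real (2 * m) ^ n"
    unfolding permutes_inv_inv[OF \<pi>] .
qed

section \<open>Averages over coin flips\<close>

text \<open>
  The expectation of \<open>\<phi>\<close> at a sum of \<open>N\<close> independent random signs, each times \<open>1/2\<close>.
\<close>

primrec coin_avg :: "nat \<Rightarrow> (real \<Rightarrow> real) \<Rightarrow> real" where
  "coin_avg 0 \<phi> = \<phi> 0"
| "coin_avg (Suc N) \<phi> = coin_avg N (\<lambda>d. (\<phi> (d + 1 / 2) + \<phi> (d - 1 / 2)) / 2)"

lemma coin_avg_sum: "coin_avg N \<phi> = (\<Sum>j\<le>N. real (N choose j) * \<phi> (real j - real N / 2)) / 2 ^ N"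
proof (induction N arbitrary: \<phi>)
  case (Suc N)
  let ?f = "\<lambda>j. \<phi> (real j - real (Suc N) / 2)"
  have "(\<Sum>j\<le>Suc N. real (Suc N choose j) * ?f j) = ?f 0 + (\<Sum>j\<le>N. real (Suc N choose Suc j) * ?f (Suc j))"
    by (subst sum.atMost_Suc_shift) simp
  also have "(\<Sum>j\<le>N. real (Suc N choose Suc j) * ?f (Suc j)) =
    (\<Sum>j\<le>N. real (N choose j) * ?f (Suc j)) + (\<Sum>j\<le>N. real (N choose Suc j) * ?f (Suc j))"
    by (simp add: sum.distrib[symmetric] algebra_simps)
  also have "?f 0 + (\<dots>) = (\<Sum>j\<le>N. real (N choose j) * ?f (Suc j)) + (?f 0 + (\<Sum>j\<le>N. real (N choose Suc j) * ?f (Suc j)))"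
    by simp
  also have "?f 0 + (\<Sum>j\<le>N. real (N choose Suc j) * ?f (Suc j)) = (\<Sum>j\<le>Suc N. real (N choose j) * ?f j)"
    by (subst sum.atMost_Suc_shift) simp
  also have "\<dots> = (\<Sum>j\<le>N. real (N choose j) * ?f j)" by simp
  finally have "(\<Sum>j\<le>Suc N. real (Suc N choose j) * ?f j) =
     (\<Sum>j\<le>N. real (N choose j) * (?f (Suc j) + ?f j))" by (simp add: sum.distrib[symmetric] algebra_simps)
  also have "\<dots> = (\<Sum>j\<le>N. 2 * (real (N choose j) * ((\<phi> (real j - real N / 2 + 1 / 2) + \<phi> (real j - real N / 2 - 1 / 2)) / 2)))"
  proof (intro sum.cong refl)
    fix j
    have "real (Suc j) - real (Suc N) / 2 = real j - real N / 2 + 1 / 2"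
      "real j - real (Suc N) / 2 = real j - real N / 2 - 1 / 2" by (simp_all add: field_simps)
    then show "real (N choose j) * (?f (Suc j) + ?f j) = 2 * (real (N choose j) * ((\<phi> (real j - real N / 2 + 1 / 2) + \<phi> (real j - real N / 2 - 1 / 2)) / 2))"
      by (metis field_sum_of_halves mult.left_commute mult_2)
  qed
  finally show ?case using Suc.IH[of "\<lambda>d. (\<phi> (d + 1 / 2) + \<phi> (d - 1 / 2)) / 2"]
    unfolding sum_distrib_left[symmetric] by simp
qed simp

lemma coin_avg_linear:
  "coin_avg N (\<lambda>d. a * \<phi> d + b * \<psi> d) = a * coin_avg N \<phi> + b * coin_avg N \<psi>"
  unfolding coin_avg_sum by (simp add: algebra_simps sum.distrib sum_distrib_left add_divide_distrib)

lemma coin_avg_add: "coin_avg N (\<lambda>d. \<phi> d + \<psi> d) = coin_avg N \<phi> + coin_avg N \<psi>"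
  using coin_avg_linear[of N 1 \<phi> 1 \<psi>] by simp
lemma coin_avg_diff: "coin_avg N (\<lambda>d. \<phi> d - \<psi> d) = coin_avg N \<phi> - coin_avg N \<psi>"
  using coin_avg_linear[of N 1 \<phi> "-1" \<psi>] by simp
lemma coin_avg_cmult: "coin_avg N (\<lambda>d. a * \<phi> d) = a * coin_avg N \<phi>"
  using coin_avg_linear[of N a \<phi> 0 \<phi>] by simp

lemma centred_le: "j \<le> N \<Longrightarrow> \<bar>real j - real N / 2\<bar> \<le> real N / 2"
  unfolding abs_le_iff by (simp add: field_simps)

lemma coin_avg_mono:
  assumes "\<And>d. \<bar>d\<bar> \<le> real N / 2 \<Longrightarrow> \<phi> d \<le> \<psi> d"
  shows "coin_avg N \<phi> \<le> coin_avg N \<psi>"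
  unfolding coin_avg_sum
  by (intro divide_right_mono sum_mono mult_left_mono assms centred_le) auto

lemma coin_avg_abs_le:
  assumes "\<And>d. \<bar>d\<bar> \<le> real N / 2 \<Longrightarrow> \<bar>\<phi> d\<bar> \<le> \<psi> d"
  shows "\<bar>coin_avg N \<phi>\<bar> \<le> coin_avg N \<psi>"
proof -
  have "coin_avg N \<phi> \<le> coin_avg N \<psi>" by (rule coin_avg_mono) (use assms in \<open>force simp: abs_le_iff\<close>)
  moreover have "coin_avg N (\<lambda>d. - 1 * \<phi> d) \<le> coin_avg N \<psi>"
    by (rule coin_avg_mono) (use assms in \<open>force simp: abs_le_iff\<close>)
  ultimately show ?thesis unfolding coin_avg_cmult by linarith
qed

lemma coin_avg_pos:
  assumes "\<And>d. \<bar>d\<bar> \<le> real N / 2 \<Longrightarrow> \<phi> d > 0"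
  shows "coin_avg N \<phi> > 0"
  unfolding coin_avg_sum
  by (intro divide_pos_pos sum_pos mult_pos_pos assms centred_le) auto

text \<open>
  Integration by parts for the symmetric binomial distribution.
\<close>

lemma coin_avg_stein:
  "coin_avg N (\<lambda>d. d * \<phi> d) = real N / 4 * coin_avg (N - 1) (\<lambda>d. \<phi> (d + 1 / 2) - \<phi> (d - 1 / 2))"
proof (induction N arbitrary: \<phi>)
  case (Suc N)
  let ?\<psi> = "\<lambda>d. (\<phi> (d + 1 / 2) + \<phi> (d - 1 / 2)) / 2"
  let ?D = "\<lambda>d. \<phi> (d + 1 / 2) - \<phi> (d - 1 / 2)"
  have "coin_avg (Suc N) (\<lambda>d. d * \<phi> d) = coin_avg N (\<lambda>d. d * ?\<psi> d + 1 / 4 * ?D d)"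
    unfolding coin_avg.simps by (intro arg_cong[of _ _ "coin_avg N"] ext) (simp add: field_simps)
  also have "\<dots> = coin_avg N (\<lambda>d. d * ?\<psi> d) + 1 / 4 * coin_avg N ?D"
    unfolding coin_avg_add coin_avg_cmult ..
  also have "coin_avg N (\<lambda>d. d * ?\<psi> d) = real N / 4 * coin_avg N ?D"
  proof (cases N)
    case (Suc M)
    have "(\<lambda>d. ?\<psi> (d + 1 / 2) - ?\<psi> (d - 1 / 2)) = (\<lambda>d. (?D (d + 1 / 2) + ?D (d - 1 / 2)) / 2)"
      by (intro ext) (simp add: field_simps)
    then show ?thesis using Suc.IH[of ?\<psi>] unfolding Suc by simp
  qed simp
  finally show ?case by (simp add: algebra_simps)
qed simp

text \<open>
  The product of \<open>(m - d + x)/m\<close> over the \<open>n\<close> numbers \<open>x = -(n - 1)/2, \<dots>, (n - 1)/2\<close>.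
\<close>

definition rising :: "nat \<Rightarrow> real \<Rightarrow> real \<Rightarrow> real" where
  "rising n m d = pochhammer (m - d - (real n - 1) / 2) n / m ^ n"

lemma rising_pos: "m > 0 \<Longrightarrow> \<bar>d\<bar> \<le> real n / 2 \<Longrightarrow> real n \<le> m \<Longrightarrow> rising n m d > 0"
  unfolding rising_def by (intro divide_pos_pos pochhammer_pos) (auto simp: abs_le_iff field_simps)

lemma rising_step: "rising n m (d + 1) * (m - d + (real n - 1) / 2) = rising n m d * (m - d - (real n + 1) / 2)"
proof -
  define y where "y = m - d - (real n + 1) / 2"
  have "m - (d + 1) - (real n - 1) / 2 = y" "m - d - (real n - 1) / 2 = y + 1" "m - d + (real n - 1) / 2 = y + real n" "m - d - (real n + 1) / 2 = y"
    by (simp_all add: y_def field_simps)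
  then have "rising n m (d + 1) * (m - d + (real n - 1) / 2) = (pochhammer y n * (y + real n)) / m ^ n"
    "rising n m d * (m - d - (real n + 1) / 2) = (y * pochhammer (y + 1) n) / m ^ n"
    unfolding rising_def by (simp_all only: times_divide_eq_left times_divide_eq_right mult.commute)
  then show ?thesis using pochhammer_rec[of y n] pochhammer_rec'[of y n] by (simp add: mult_ac)
qed

lemma rising_second_difference:
  assumes "\<bar>d\<bar> \<le> real n / 2" "m > real n" "n > 0"
  shows "rising n m (d + 1) + rising n m (d - 1) - 2 * rising n m d =
    rising n m d * (real n * (real n - 1) / ((m - d)\<^sup>2 - ((real n - 1) / 2)\<^sup>2))"
proof -
  define u where "u = m - d"
  define z where "z = (real n - 1) / 2"
  have u: "u > real n / 2" "u + z > 0" "u - z > 0" "z \<ge> 0" using assms by (auto simp: u_def z_def abs_le_iff field_simps)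
  have n: "real n = 2 * z + 1" by (simp add: z_def field_simps)
  have "rising n m (d + 1) * (u + z) = rising n m d * (u - z - 1)"
    using rising_step[of n m d] by (simp add: u_def z_def field_simps)
  then have a: "rising n m (d + 1) = rising n m d * ((u - z - 1) / (u + z))" using u by (simp add: field_simps)
  have "rising n m d * (u + 1 + z) = rising n m (d - 1) * (u - z)"
    using rising_step[of n m "d - 1"] by (simp add: u_def z_def field_simps)
  then have b: "rising n m (d - 1) = rising n m d * ((u + z + 1) / (u - z))" using u by (simp add: field_simps)
  have q: "u\<^sup>2 - z\<^sup>2 = (u + z) * (u - z)" by (simp add: algebra_simps power2_eq_square)
  have "A / P + B / Q - 2 = (A * Q + B * P - 2 * (P * Q)) / (P * Q)" if "P > 0" "Q > 0" for A B P Q :: real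
    using that by (simp add: field_simps)
  from this[OF u(2,3)]
  have "(u - z - 1) / (u + z) + (u + z + 1) / (u - z) - 2 = ((u - z - 1) * (u - z) + (u + z + 1) * (u + z) - 2 * ((u + z) * (u - z))) / ((u + z) * (u - z))" .
  also have "(u - z - 1) * (u - z) + (u + z + 1) * (u + z) - 2 * ((u + z) * (u - z)) = (2 * z + 1) * (2 * z)"
    by (simp add: algebra_simps)
  finally have "(u - z - 1) / (u + z) + (u + z + 1) / (u - z) - 2 = real n * (real n - 1) / (u\<^sup>2 - z\<^sup>2)"
    unfolding q n by simp
  moreover have "R * A + R * B - 2 * R = R * (A + B - 2)" for R A B :: real by (simp add: algebra_simps)
  ultimately show ?thesis unfolding a b by (simp only: u_def z_def)
qed

lemma inverse_square_expansion:
  fixes y z x :: real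
  assumes "\<bar>y\<bar> \<le> x / 2" "\<bar>z\<bar> \<le> x / 2" "0 \<le> x" "x \<le> 1 / 4"
  shows "\<bar>1 / ((1 - y)\<^sup>2 - z\<^sup>2) - (1 + 2 * y)\<bar> \<le> 2 * x\<^sup>2"
proof -
  define q where "q = (1 - y)\<^sup>2 - z\<^sup>2"
  have yy: "y\<^sup>2 \<le> x\<^sup>2 / 4" "z\<^sup>2 \<le> x\<^sup>2 / 4"
    using power_mono[OF assms(1), of 2] power_mono[OF assms(2), of 2] by (simp_all add: power2_eq_square)
  have xx: "x\<^sup>2 \<le> 1 / 16" using power_mono[OF assms(4,3), of 2] by (simp add: power2_eq_square)
  have q: "q = 1 - 2 * y + (y\<^sup>2 - z\<^sup>2)" by (simp add: q_def power2_eq_square algebra_simps)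
  have nn: "0 \<le> y\<^sup>2" "0 \<le> z\<^sup>2" by auto
  have "q \<ge> 7 / 10" unfolding q using yy nn xx assms by linarith
  have "1 / q - (1 + 2 * y) = (4 * y\<^sup>2 - (1 + 2 * y) * (y\<^sup>2 - z\<^sup>2)) / q"
    using \<open>q \<ge> 7 / 10\<close> by (simp add: field_simps) (simp add: q algebra_simps power2_eq_square)
  then have "\<bar>1 / q - (1 + 2 * y)\<bar> = \<bar>4 * y\<^sup>2 - (1 + 2 * y) * (y\<^sup>2 - z\<^sup>2)\<bar> / q"
    using \<open>q \<ge> 7 / 10\<close> by (simp add: abs_divide)
  also have "\<bar>(1 + 2 * y) * (y\<^sup>2 - z\<^sup>2)\<bar> \<le> 5 / 4 * (x\<^sup>2 / 4)"
  proof -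
    have "\<bar>1 + 2 * y\<bar> \<le> 5 / 4" "\<bar>y\<^sup>2 - z\<^sup>2\<bar> \<le> x\<^sup>2 / 4" using assms yy nn by linarith+
    then show ?thesis unfolding abs_mult by (intro mult_mono) auto
  qed
  then have "\<bar>4 * y\<^sup>2 - (1 + 2 * y) * (y\<^sup>2 - z\<^sup>2)\<bar> / q \<le> (x\<^sup>2 * (21 / 16)) / (7 / 10)"
  proof (intro frac_le)
    assume "\<bar>(1 + 2 * y) * (y\<^sup>2 - z\<^sup>2)\<bar> \<le> 5 / 4 * (x\<^sup>2 / 4)"
    moreover have "\<bar>4 * y\<^sup>2 - e\<bar> \<le> x\<^sup>2 * (21 / 16)" if "\<bar>e\<bar> \<le> 5 / 4 * (x\<^sup>2 / 4)" for e
      using that yy nn by linarith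
    ultimately show "\<bar>4 * y\<^sup>2 - (1 + 2 * y) * (y\<^sup>2 - z\<^sup>2)\<bar> \<le> x\<^sup>2 * (21 / 16)" by blast
  qed (use \<open>q \<ge> 7 / 10\<close> in auto)
  also have "\<dots> \<le> 2 * x\<^sup>2" by simp
  finally show ?thesis by (simp add: q_def)
qed

text \<open>
  Two additional coin flips add a quarter of the average of the second difference, which is
  \<open>n (n - 1) / ((m - d)\<^sup>2 - ((n - 1)/2)\<^sup>2)\<close> times \<open>rising n m d\<close>. To first order in \<open>d/m\<close> this factor is
  \<open>4a (1 + 2d/m)\<close>. The term with \<open>d/m\<close> may be as large as \<open>n/m\<close>, but its weighted average is only of
  order \<open>(n/m)\<^sup>2\<close>, because integration by parts turns the average of \<open>d * rising n m d\<close> into one of a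
  first difference. So the relative error is of order \<open>a + 1/n\<close>.
\<close>

theorem coin_avg_rising_ratio:
  fixes m :: real
  assumes m: "4 * real n \<le> m" and N: "N + 2 < n"
  defines "L \<equiv> \<lambda>N. coin_avg N (rising n m)" and "a \<equiv> real n ^ 2 / (4 * m ^ 2)"
  shows "L N > 0" and "\<bar>ln (L (N + 2)) - ln (L N) - a\<bar> \<le> 16 * a\<^sup>2 + a / real n"
proof -
  let ?G = "rising n m"
  define x where "x = real n / m"
  have n0: "real n > 0" "real n \<ge> 1" "m > 0" "real n < m" using N m by auto
  have x: "0 < x" "x \<le> 1 / 4" using n0 m by (auto simp: x_def field_simps)
  have ax: "a = x\<^sup>2 / 4" by (simp add: a_def x_def power_divide)
  have Gpos: "?G d > 0" if "\<bar>d\<bar> \<le> real n / 2" for d using rising_pos[OF _ that] n0 by simp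
  have Nn: "real N \<le> real n" "real N + 2 < real n" using N by linarith+
  have small: "\<bar>d\<bar> \<le> real n / 2" if "\<bar>d\<bar> \<le> real N / 2" for d using that Nn by linarith
  show L0: "L N > 0" unfolding L_def by (intro coin_avg_pos Gpos small)
  define D where "D d = ?G d * (real n * (real n - 1) / ((m - d)\<^sup>2 - ((real n - 1) / 2)\<^sup>2))" for d
  define K where "K = real n * (real n - 1) / m\<^sup>2"
  have K: "0 \<le> K" "K \<le> x\<^sup>2" "x\<^sup>2 - K = x\<^sup>2 / real n"
    using n0 by (auto simp: K_def x_def power_divide field_simps power2_eq_square)
  have "L (N + 2) = coin_avg N (\<lambda>d. ?G d + 1 / 4 * (?G (d + 1) + ?G (d - 1) - 2 * ?G d))"
    unfolding L_def numeral_2_eq_2 add_Suc_right add_0_right coin_avg.simps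
  proof (intro arg_cong[of _ _ "coin_avg N"] ext)
    fix d :: real
    have e: "d + 1 / 2 + 1 / 2 = d + 1" "d + 1 / 2 - 1 / 2 = d" "d - 1 / 2 + 1 / 2 = d" "d - 1 / 2 - 1 / 2 = d - 1" by simp_all
    show "((?G (d + 1 / 2 + 1 / 2) + ?G (d + 1 / 2 - 1 / 2)) / 2 + (?G (d - 1 / 2 + 1 / 2) + ?G (d - 1 / 2 - 1 / 2)) / 2) / 2
      = ?G d + 1 / 4 * (?G (d + 1) + ?G (d - 1) - 2 * ?G d)" unfolding e by (simp add: field_simps)
  qed
  also have "\<dots> = L N + 1 / 4 * coin_avg N (\<lambda>d. ?G (d + 1) + ?G (d - 1) - 2 * ?G d)"
    unfolding L_def coin_avg_add coin_avg_cmult ..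
  also have "coin_avg N (\<lambda>d. ?G (d + 1) + ?G (d - 1) - 2 * ?G d) = coin_avg N D"
  proof (rule antisym)
    have "?G (d + 1) + ?G (d - 1) - 2 * ?G d = D d" if "\<bar>d\<bar> \<le> real N / 2" for d
      unfolding D_def by (rule rising_second_difference) (use small[OF that] n0 in auto)
    then show "coin_avg N (\<lambda>d. ?G (d + 1) + ?G (d - 1) - 2 * ?G d) \<le> coin_avg N D"
      "coin_avg N D \<le> coin_avg N (\<lambda>d. ?G (d + 1) + ?G (d - 1) - 2 * ?G d)"
      by (auto intro: coin_avg_mono)
  qed
  finally have LL: "L (N + 2) = L N + coin_avg N D / 4" by simp
  have D_approx: "\<bar>D d - K * (?G d + 2 / m * (d * ?G d))\<bar> \<le> 2 * x ^ 4 * ?G d" if "\<bar>d\<bar> \<le> real N / 2" for d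
  proof -
    have d: "\<bar>d\<bar> \<le> real n / 2" by (rule small[OF that])
    have y: "\<bar>d / m\<bar> \<le> x / 2" using d n0 by (simp add: x_def abs_divide field_simps)
    have z: "\<bar>(real n - 1) / 2 / m\<bar> \<le> x / 2" using n0 by (simp add: x_def abs_divide field_simps)
    have q: "(m - d)\<^sup>2 - ((real n - 1) / 2)\<^sup>2 = m\<^sup>2 * ((1 - d / m)\<^sup>2 - ((real n - 1) / 2 / m)\<^sup>2)"
      using n0 by (simp add: field_simps power2_eq_square)
    define r where "r = 1 / ((1 - d / m)\<^sup>2 - ((real n - 1) / 2 / m)\<^sup>2)"
    have r: "\<bar>r - (1 + 2 * (d / m))\<bar> \<le> 2 * x\<^sup>2"
      unfolding r_def by (rule inverse_square_expansion) (use x y z in auto)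
    have "D d = ?G d * (K * r)" unfolding D_def q K_def r_def by simp
    then have "D d - K * (?G d + 2 / m * (d * ?G d)) = ?G d * (K * (r - (1 + 2 * (d / m))))"
      by (simp add: algebra_simps)
    then have "\<bar>D d - K * (?G d + 2 / m * (d * ?G d))\<bar> = ?G d * (K * \<bar>r - (1 + 2 * (d / m))\<bar>)"
      using K(1) Gpos[OF d] by (simp add: abs_mult)
    also have "\<dots> \<le> ?G d * (x\<^sup>2 * (2 * x\<^sup>2))"
      using K r Gpos[OF d] by (intro mult_left_mono mult_mono) auto
    finally show ?thesis by (simp add: power2_eq_square power4_eq_xxxx mult_ac)
  qed
  have "\<bar>coin_avg N (\<lambda>d. D d - K * (?G d + 2 / m * (d * ?G d)))\<bar> \<le> coin_avg N (\<lambda>d. 2 * x ^ 4 * ?G d)"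
    by (rule coin_avg_abs_le[OF D_approx])
  then have A1: "\<bar>coin_avg N D - K * (L N + 2 / m * coin_avg N (\<lambda>d. d * ?G d))\<bar> \<le> 2 * x ^ 4 * L N"
    unfolding coin_avg_diff coin_avg_cmult coin_avg_add L_def .
  have A2: "\<bar>coin_avg N (\<lambda>d. d * ?G d)\<bar> \<le> real n * x / 2 * L N"
  proof (cases N)
    case 0
    then show ?thesis using L0 n0 x by simp
  next
    case (Suc M)
    have "\<bar>coin_avg M (\<lambda>d. ?G (d + 1 / 2) - ?G (d - 1 / 2))\<bar> \<le> coin_avg M (\<lambda>d. 2 * x * ((?G (d + 1 / 2) + ?G (d - 1 / 2)) / 2))"
    proof (rule coin_avg_abs_le)
      fix d :: real assume d: "\<bar>d\<bar> \<le> real M / 2"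
      have M: "real M + 1 \<le> real n" using Nn Suc by simp
      have pos: "?G (d + 1 / 2) > 0" "?G (d - 1 / 2) > 0" by (rule Gpos; use d M in linarith)+
      (* One step changes the rising factorial by the relative amount real n / w, at most x. *)
      define w where "w = m - (d - 1 / 2) + (real n - 1) / 2"
      have w: "w \<ge> m" using d M unfolding w_def by (simp add: abs_le_iff field_simps)
      have "?G (d + 1 / 2) * w = ?G (d - 1 / 2) * (w - real n)"
        using rising_step[of n m "d - 1 / 2"] by (simp add: w_def field_simps)
      then have "?G (d - 1 / 2) - ?G (d + 1 / 2) = ?G (d - 1 / 2) * (real n / w)"
        using w n0 by (simp add: field_simps)
      moreover have "real n / w \<le> x" unfolding x_def using w n0 by (intro frac_le) auto
      moreover have "0 \<le> real n / w" using w n0 by simp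
      ultimately have "0 \<le> ?G (d - 1 / 2) - ?G (d + 1 / 2)" "?G (d - 1 / 2) - ?G (d + 1 / 2) \<le> ?G (d - 1 / 2) * x"
        using pos by (simp_all only: mult_left_mono mult_nonneg_nonneg less_imp_le)
      moreover have "0 \<le> ?G (d + 1 / 2) * x" using pos x by simp
      ultimately show "\<bar>?G (d + 1 / 2) - ?G (d - 1 / 2)\<bar> \<le> 2 * x * ((?G (d + 1 / 2) + ?G (d - 1 / 2)) / 2)"
        by (simp add: algebra_simps abs_le_iff)
    qed
    also have "\<dots> = 2 * x * L N" unfolding coin_avg_cmult L_def Suc by simp
    finally have "\<bar>coin_avg N (\<lambda>d. d * ?G d)\<bar> \<le> real N / 4 * (2 * x * L N)"
      unfolding Suc coin_avg_stein[of "Suc M" ?G] diff_Suc_1 abs_mult by (intro mult_mono) auto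
    also have "\<dots> \<le> real n / 4 * (2 * x * L N)" using Nn L0 x by (intro mult_right_mono divide_right_mono) auto
    finally show ?thesis by (simp add: mult_ac)
  qed
  have "\<bar>K * (2 / m * coin_avg N (\<lambda>d. d * ?G d))\<bar> = K * (2 / m * \<bar>coin_avg N (\<lambda>d. d * ?G d)\<bar>)"
    using K n0 by (simp add: abs_mult)
  also have "\<dots> \<le> x\<^sup>2 * (2 / m * (real n * x / 2 * L N))"
    using K A2 n0 L0 x by (intro mult_mono) auto
  also have "\<dots> = x ^ 4 * L N" using n0 by (simp add: x_def field_simps power4_eq_xxxx power2_eq_square)
  finally have A3: "\<bar>K * (2 / m * coin_avg N (\<lambda>d. d * ?G d))\<bar> \<le> x ^ 4 * L N" .
  have "\<bar>coin_avg N D - x\<^sup>2 * L N\<bar> \<le> (3 * x ^ 4 + x\<^sup>2 / real n) * L N"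
  proof -
    have "coin_avg N D - x\<^sup>2 * L N = (coin_avg N D - K * (L N + 2 / m * coin_avg N (\<lambda>d. d * ?G d)))
      + K * (2 / m * coin_avg N (\<lambda>d. d * ?G d)) - (x\<^sup>2 - K) * L N" by (simp add: algebra_simps)
    moreover have abs3: "\<bar>e\<bar> \<le> t + u + s" if "e = p + q - r" "\<bar>r\<bar> = s" "\<bar>p\<bar> \<le> t" "\<bar>q\<bar> \<le> u" for e p q r s t u :: real
      using that by linarith
    moreover have "\<bar>(x\<^sup>2 - K) * L N\<bar> = x\<^sup>2 / real n * L N" unfolding K(3) using L0 n0 by (simp add: abs_mult)
    ultimately have "\<bar>coin_avg N D - x\<^sup>2 * L N\<bar> \<le> 2 * x ^ 4 * L N + x ^ 4 * L N + x\<^sup>2 / real n * L N"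
      by (intro abs3[OF _ _ A1 A3])
    then show ?thesis by (simp add: algebra_simps)
  qed
  (* So L (N + 2) = L N * (1 + t), and ln (1 + t) differs from t by at most t ^ 2. *)
  define t where "t = coin_avg N D / (4 * L N)"
  have "t - a = (coin_avg N D - x\<^sup>2 * L N) / (4 * L N)" unfolding t_def ax using L0 by (simp add: field_simps)
  then have "\<bar>t - a\<bar> = \<bar>coin_avg N D - x\<^sup>2 * L N\<bar> / (4 * L N)" using L0 by (simp add: abs_divide)
  also have "\<dots> \<le> ((3 * x ^ 4 + x\<^sup>2 / real n) * L N) / (4 * L N)"
    using \<open>\<bar>coin_avg N D - x\<^sup>2 * L N\<bar> \<le> _\<close> L0 by (intro divide_right_mono) auto
  also have "\<dots> = 12 * a\<^sup>2 + a / real n" unfolding ax using L0 by (simp add: field_simps power4_eq_xxxx power2_eq_square)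
  finally have ta: "\<bar>t - a\<bar> \<le> 12 * a\<^sup>2 + a / real n" .
  have D0: "D d \<ge> 0" if "\<bar>d\<bar> \<le> real N / 2" for d
  proof -
    have d: "\<bar>d\<bar> \<le> real n / 2" by (rule small[OF that])
    have "((real n - 1) / 2)\<^sup>2 \<le> (m - d)\<^sup>2" by (rule power_mono) (use d n0 in \<open>auto simp: abs_le_iff\<close>)
    then show ?thesis unfolding D_def using Gpos[OF d] n0 by (intro mult_nonneg_nonneg divide_nonneg_nonneg) auto
  qed
  have t0: "t \<ge> 0"
    unfolding t_def using coin_avg_mono[of N "\<lambda>_. 0" D] D0 L0 coin_avg_cmult[of N 0 "\<lambda>_. 0"] by simp
  have a0: "0 < a" "a \<le> 1 / 64" unfolding ax using x power_mono[OF x(2), of 2] by (auto simp: power2_eq_square)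
  have "t \<le> 2 * a"
  proof -
    have "t \<le> a + (12 * a\<^sup>2 + a / real n)" using ta by linarith
    moreover have "12 * a\<^sup>2 \<le> 12 / 64 * a" using a0 mult_left_mono[of a "1/64" a] by (simp add: power2_eq_square)
    moreover have "a / real n \<le> a / 3" using a0 Nn by (intro divide_left_mono) auto
    ultimately show ?thesis using a0 by linarith
  qed
  have "L (N + 2) = L N * (1 + t)" unfolding LL t_def using L0 by (simp add: field_simps)
  then have "ln (L (N + 2)) - ln (L N) = ln (1 + t)" using L0 t0 by (simp add: ln_mult)
  moreover have "ln (1 + t) \<le> t" using t0 by (simp add: ln_add_one_self_le_self)
  moreover have "t - t\<^sup>2 \<le> ln (1 + t)" using t0 \<open>t \<le> 2 * a\<close> a0 by (intro ln_one_plus_pos_lower_bound) auto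
  moreover have "t\<^sup>2 \<le> 4 * a\<^sup>2" using power_mono[OF \<open>t \<le> 2 * a\<close> t0, of 2] by (simp add: power2_eq_square)
  ultimately show "\<bar>ln (L (N + 2)) - ln (L N) - a\<bar> \<le> 16 * a\<^sup>2 + a / real n"
    using ta unfolding abs_le_iff by linarith
qed

lemma pochhammer_binomial: "pochhammer (real K + 1) n = fact n * real (n + K choose n)"
  using gbinomial_pochhammer'[of "real (n + K)" n] by (simp add: binomial_gbinomial)

section \<open>The likelihood ratio\<close>

text \<open>
  The likelihood ratio of the shelf shuffle against the uniform measure at a permutation whose reversed
  word has \<open>v\<close> valleys.
\<close>

definition likelihood :: "nat \<Rightarrow> nat \<Rightarrow> nat \<Rightarrow> real" where
  "likelihood n m v = coin_avg (n - 1 - 2 * v) (rising n (real m))"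

lemma likelihood_sorted_labellings:
  assumes "distinct w" "w \<noteq> []" "length w \<le> m"
  shows "real (sorted_labellings w (2 * m)) * fact (length w) / real (2 * m) ^ length w =
    likelihood (length w) m (valleys w)"
proof -
  define n where "n = length w"
  define v where "v = valleys w"
  define N where "N = n - 1 - 2 * v"
  have n0: "n > 0" "n \<le> m" using assms by (simp_all add: n_def)
  have n: "n = N + 2 * v + 1" using valleys_bound[of w] n0 unfolding N_def n_def v_def by linarith
  have tm: "fact n * real (n + (m - (v + 1 + j)) choose n) = rising n (real m) (real j - real N / 2) * real m ^ n"
    if "j \<le> N" for j
  proof -
    have "v + 1 + j \<le> m" using that n n0 by linarith
    then have "real m - (real j - real N / 2) - (real n - 1) / 2 = real (m - (v + 1 + j)) + 1"
      unfolding n by (simp add: of_nat_diff field_simps)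
    then show ?thesis unfolding rising_def using n0 by (simp add: pochhammer_binomial)
  qed
  have "real (sorted_labellings w (2 * m)) * fact n =
    2 ^ (2 * v + 1) * (\<Sum>j\<le>N. real (N choose j) * (fact n * real (n + (m - (v + 1 + j)) choose n)))"
    unfolding sorted_labellings_valleys[OF assms, folded n_def v_def, folded N_def]
    by (simp add: sum_distrib_left sum_distrib_right mult_ac)
  also have "(\<Sum>j\<le>N. real (N choose j) * (fact n * real (n + (m - (v + 1 + j)) choose n))) =
     (\<Sum>j\<le>N. real (N choose j) * rising n (real m) (real j - real N / 2)) * real m ^ n"
    unfolding sum_distrib_right by (rule sum.cong[OF refl]) (simp only: atMost_iff tm mult.assoc)
  also have "(\<Sum>j\<le>N. real (N choose j) * rising n (real m) (real j - real N / 2)) = 2 ^ N * coin_avg N (rising n (real m))"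
    unfolding coin_avg_sum by simp
  finally have "real (sorted_labellings w (2 * m)) * fact n = (2 ^ (2 * v + 1) * 2 ^ N * real m ^ n) * coin_avg N (rising n (real m))"
    by (simp only: mult_ac)
  also have "2 ^ (2 * v + 1) * 2 ^ N * real m ^ n = real (2 * m) ^ n"
  proof -
    have "(2::real) ^ (2 * v + 1) * 2 ^ N = 2 ^ n" unfolding power_add[symmetric] by (rule arg_cong[of _ _ "\<lambda>i. 2 ^ i"]) (use n in linarith)
    then show ?thesis by (simp only: of_nat_mult power_mult_distrib of_nat_numeral)
  qed
  finally show ?thesis using n0 unfolding likelihood_def n_def[symmetric] v_def[symmetric] N_def[symmetric] by simp
qed

lemma sum_valleys_permutes:
  fixes g :: "nat \<Rightarrow> real"
  shows "(\<Sum>\<pi> | \<pi> permutes {1..Suc k}. g (valleys (map \<pi> (rev [1..<Suc (Suc k)])))) = weighted (valley_poly k) g"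
proof -
  let ?n = "Suc k" and ?S = "{\<pi>. \<pi> permutes {1..Suc k}}"
  let ?w = "\<lambda>\<pi>. map \<pi> (rev [1..<Suc ?n])"
  have s: "set (rev [1..<Suc ?n]) = {1..?n}" by auto
  have inj: "inj_on ?w ?S"
  proof (rule inj_onI)
    fix p q assume pq: "p \<in> ?S" "q \<in> ?S" "?w p = ?w q"
    have "p i = q i" for i
    proof (cases "i \<in> {1..?n}")
      case True
      then show ?thesis using pq(3) unfolding map_eq_conv s by blast
    next
      case False
      then show ?thesis using pq(1,2) permutes_not_in[of p "{1..?n}" i] permutes_not_in[of q "{1..?n}" i] by simp
    qed
    then show "p = q" by (rule ext)
  qed
  have sub: "?w ` ?S \<subseteq> permutations_of_set {1..?n}"
  proof (rule image_subsetI)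
    fix p assume "p \<in> ?S"
    then have p: "p permutes {1..?n}" by simp
    have "set (?w p) = {1..?n}" unfolding set_map s by (rule permutes_image[OF p])
    moreover have "distinct (?w p)" unfolding distinct_map
      using permutes_inj_on[OF p] by (simp del: upt_Suc)
    ultimately show "?w p \<in> permutations_of_set {1..?n}" by (rule permutations_of_setI)
  qed
  have "card (?w ` ?S) = fact ?n" unfolding card_image[OF inj] by (rule card_permutations) simp_all
  also have "\<dots> = card (permutations_of_set {1..?n})" by simp
  finally have "?w ` ?S = permutations_of_set {1..?n}" by (rule card_subset_eq[OF finite_permutations_of_set sub])
  then have "(\<Sum>xs\<in>permutations_of_set {1..?n}. g (valleys xs)) = (\<Sum>\<pi>\<in>?S. g (valleys (?w \<pi>)))"
    using sum.reindex[OF inj, of "\<lambda>xs. g (valleys xs)"] by (simp only: o_def)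
  then show ?thesis using sum_valleys_permutations[of "{1..?n}" k g] by simp
qed

text \<open>
  Both measures are functions of the number of valleys. The absolute value becomes a positive part
  because the likelihood ratio has expectation \<open>1\<close>.
\<close>

theorem tv_dist_expectation:
  assumes "Suc k \<le> m" and P: "valley_poly k = smult (fact (Suc k)) (bernoulli_poly P)"
  defines "L \<equiv> likelihood (Suc k) m"
  shows "weighted (bernoulli_poly P) L = 1"
    and "tv_dist (Suc k) (shelf_shuffle (Suc k) m) (uniform_perm (Suc k)) = weighted (bernoulli_poly P) (\<lambda>v. max 0 (1 - L v))"
proof -
  let ?n = "Suc k" and ?S = "{\<pi>. \<pi> permutes {1..Suc k}}"
  let ?v = "\<lambda>\<pi>. valleys (map \<pi> (rev [1..<Suc (Suc k)]))"
  have m: "m > 0" using assms(1) by simp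
  have fin: "finite ?S" by (rule finite_permutations) simp
  have f: "(fact ?n :: real) \<noteq> 0" by (rule fact_nonzero)
  have pmf: "pmf (shelf_shuffle ?n m) \<pi> = L (?v \<pi>) / fact ?n" if \<pi>: "\<pi> \<in> ?S" for \<pi>
  proof -
    let ?w = "map \<pi> (rev [1..<Suc ?n])"
    have "inj \<pi>" using \<pi> permutes_inj by blast
    then have "distinct ?w" by (simp add: distinct_map inj_on_subset[OF _ subset_UNIV] del: upt_Suc)
    moreover have "length ?w = ?n" by simp
    ultimately have "real (sorted_labellings ?w (2 * m)) * fact ?n / real (2 * m) ^ ?n = L (?v \<pi>)"
      using likelihood_sorted_labellings[of ?w m] assms(1) unfolding L_def by (metis length_0_conv nat.distinct(1))
    moreover have "pmf (shelf_shuffle ?n m) \<pi> = real (sorted_labellings ?w (2 * m)) / real (2 * m) ^ ?n"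
      using pmf_shelf_shuffle(2)[OF m, of \<pi> ?n] \<pi> by blast
    ultimately show ?thesis using f by (simp add: field_simps del: fact_Suc upt_Suc)
  qed
  have E: "(\<Sum>\<pi>\<in>?S. g (?v \<pi>)) / fact ?n = weighted (bernoulli_poly P) g" for g
    unfolding sum_valleys_permutes P weighted_smult using f by simp
  have "(\<Sum>\<pi>\<in>?S. pmf (shelf_shuffle ?n m) \<pi>) = 1"
    by (rule sum_pmf_eq_1[OF fin pmf_shelf_shuffle(1)[OF m]])
  then have "(\<Sum>\<pi>\<in>?S. L (?v \<pi>)) / fact ?n = 1" unfolding sum_divide_distrib using pmf by simp
  then show E1: "weighted (bernoulli_poly P) L = 1" unfolding E .
  have unif: "pmf (uniform_perm ?n) \<pi> = 1 / fact ?n" if "\<pi> \<in> ?S" for \<pi>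
  proof -
    have "?S \<noteq> {}" "card ?S = fact ?n" using that card_permutations[of "{1..?n}" ?n] by auto
    then show ?thesis unfolding uniform_perm_def using that fin by (simp add: pmf_of_set del: fact_Suc)
  qed
  have "tv_dist ?n (shelf_shuffle ?n m) (uniform_perm ?n) = (\<Sum>\<pi>\<in>?S. \<bar>1 - L (?v \<pi>)\<bar> / fact ?n) / 2"
    unfolding tv_dist_def
    by (intro arg_cong[of _ _ "\<lambda>x. x / 2"] sum.cong refl) (simp add: pmf unif diff_divide_distrib[symmetric] abs_divide del: fact_Suc)
  also have "\<dots> = weighted (bernoulli_poly P) (\<lambda>v. \<bar>1 - L v\<bar>) / 2"
    unfolding sum_divide_distrib[symmetric] E[of "\<lambda>v. \<bar>1 - L v\<bar>", symmetric] ..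
  also have "(\<lambda>v. \<bar>1 - L v\<bar>) = (\<lambda>v. (2 * max 0 (1 - L v) - 1) + L v)"
  proof
    fix v show "\<bar>1 - L v\<bar> = (2 * max 0 (1 - L v) - 1) + L v" by (cases "L v \<le> 1") auto
  qed
  also have "weighted (bernoulli_poly P) \<dots> = 2 * weighted (bernoulli_poly P) (\<lambda>v. max 0 (1 - L v))"
    unfolding weighted_add_fun weighted_diff_fun weighted_mult_fun E1 by simp
  finally show "tv_dist ?n (shelf_shuffle ?n m) (uniform_perm ?n) = weighted (bernoulli_poly P) (\<lambda>v. max 0 (1 - L v))"
    by simp
qed

lemma telescope_log_linear:
  fixes l :: "nat \<Rightarrow> real"
  assumes step: "\<And>v. v < V \<Longrightarrow> \<bar>l v - l (Suc v) - a\<bar> \<le> \<eta>" and "u \<le> V" "v \<le> V"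
  shows "\<bar>l v - l u + a * (real v - real u)\<bar> \<le> \<eta> * \<bar>real v - real u\<bar>"
proof -
  have *: "\<bar>l v - l u + a * (real v - real u)\<bar> \<le> \<eta> * (real v - real u)" if "u \<le> v" "v \<le> V" for u v
    using that
  proof (induction v rule: dec_induct)
    case (step i)
    have "\<bar>l i - l (Suc i) - a\<bar> \<le> \<eta>" using assms(1)[of i] step by simp
    moreover have "\<bar>l i - l u + a * (real i - real u)\<bar> \<le> \<eta> * (real i - real u)" using step by simp
    moreover have "l (Suc i) - l u + a * (real (Suc i) - real u) = (l i - l u + a * (real i - real u)) - (l i - l (Suc i) - a)"
      by (simp add: algebra_simps)
    moreover have "\<eta> * (real (Suc i) - real u) = \<eta> * (real i - real u) + \<eta>" by (simp add: algebra_simps)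
    ultimately show ?case by linarith
  qed simp
  show ?thesis
  proof (cases "u \<le> v")
    case True
    then show ?thesis using *[of u v] assms by simp
  next
    case False
    then have "\<bar>l u - l v + a * (real u - real v)\<bar> \<le> \<eta> * (real u - real v)" using *[of v u] assms by simp
    moreover have "l v - l u + a * (real v - real u) = - (l u - l v + a * (real u - real v))" by (simp add: algebra_simps)
    moreover have "\<bar>real v - real u\<bar> = real u - real v" using False by simp
    ultimately show ?thesis by (simp only: abs_minus_cancel)
  qed
qed

text \<open>
  Summation of the increments of \<open>ln L\<close>, started at the integer part of the mean number \<open>(n - 2)/3\<close> of
  valleys, so that the error grows with the distance from the mean.
\<close>

theorem likelihood_log_linear:
  fixes n m :: nat
  assumes "n \<ge> 2" "4 * n \<le> m"
  defines "a \<equiv> real n ^ 2 / (4 * real m ^ 2)" and "c \<equiv> (real n - 2) / 3"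
  shows "\<exists>K>0. \<forall>v. 2 * v \<le> n - 1 \<longrightarrow> (\<exists>\<epsilon>. likelihood n m v = K * exp (- a * (real v - c)) * exp \<epsilon> \<and>
    \<bar>\<epsilon>\<bar> \<le> (16 * a\<^sup>2 + a / real n) * (\<bar>real v - c\<bar> + 1))"
proof -
  define l where "l v = ln (likelihood n m v)" for v
  define V where "V = (n - 1) div 2"
  define \<eta> where "\<eta> = 16 * a\<^sup>2 + a / real n"
  have \<eta>0: "\<eta> \<ge> 0" unfolding \<eta>_def a_def by simp
  have m: "4 * real n \<le> real m" using assms(2) by linarith
  have step: "\<bar>l v - l (Suc v) - a\<bar> \<le> \<eta>" if "v < V" for v
  proof -
    define N where "N = n - 1 - 2 * Suc v"
    have N: "N + 2 < n" "n - 1 - 2 * v = N + 2" using that assms(1) unfolding N_def V_def by auto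
    show ?thesis unfolding l_def likelihood_def N(2) N_def[symmetric] \<eta>_def a_def
      by (rule coin_avg_rising_ratio(2)[OF m N(1)])
  qed
  have pos: "likelihood n m v > 0" if "2 * v \<le> n - 1" for v
    unfolding likelihood_def
  proof (rule coin_avg_pos)
    fix d assume "\<bar>d\<bar> \<le> real (n - 1 - 2 * v) / 2"
    then have "\<bar>d\<bar> \<le> real n / 2" by (simp add: of_nat_diff)
    then show "rising n (real m) d > 0" using rising_pos[of "real m" d n] m assms(1) by simp
  qed
  define u where "u = (n - 2) div 3"
  have u: "2 * u \<le> n - 1" "u \<le> V" using assms(1) unfolding u_def V_def by linarith+
  have ul: "\<bar>real u - c\<bar> \<le> 1"
  proof -
    have "3 * u \<le> n - 2" "n - 2 < 3 * u + 3" unfolding u_def by linarith+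
    then have "3 * real u \<le> real n - 2" "real n - 2 < 3 * real u + 3" using assms(1) by linarith+
    then have "real u - (real n - 2) / 3 \<le> 1" "- (real u - (real n - 2) / 3) \<le> 1" by (simp_all add: field_simps)
    then show ?thesis unfolding c_def by (rule abs_leI)
  qed
  define K where "K = likelihood n m u * exp (a * (real u - c))"
  have "\<exists>\<epsilon>. likelihood n m v = K * exp (- a * (real v - c)) * exp \<epsilon> \<and> \<bar>\<epsilon>\<bar> \<le> \<eta> * (\<bar>real v - c\<bar> + 1)" if v: "2 * v \<le> n - 1" for v
  proof (intro exI conjI)
    let ?e = "l v - l u + a * (real v - real u)"
    have "v \<le> V" using v unfolding V_def by linarith
    then have "\<bar>?e\<bar> \<le> \<eta> * \<bar>real v - real u\<bar>" by (intro telescope_log_linear[where V = V] step u(2))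
    also have "\<dots> \<le> \<eta> * (\<bar>real v - c\<bar> + 1)" using \<eta>0 ul by (intro mult_left_mono) linarith+
    finally show "\<bar>?e\<bar> \<le> \<eta> * (\<bar>real v - c\<bar> + 1)" .
    have "likelihood n m v = exp (l v)" "likelihood n m u = exp (l u)" using pos v u by (simp_all add: l_def)
    then show "likelihood n m v = K * exp (- a * (real v - c)) * exp ?e"
      unfolding K_def by (simp add: exp_add[symmetric] algebra_simps)
  qed
  then show ?thesis using pos[OF u(1)] unfolding \<eta>_def by (intro exI[of _ K]) (simp add: K_def)
qed

text \<open>
  The Stein identity replaces \<open>W f(W)\<close> by increments of \<open>f\<close> over steps of length \<open>\<tau>\<close>. Each of them is
  \<open>\<tau> f'(W)\<close> up to \<open>B \<tau>\<^sup>2\<close>, and restoring the omitted Bernoulli variable costs another \<open>B \<tau>\<^sup>2\<close>.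
\<close>

theorem bernoulli_stein_bound:
  fixes f f' :: "real \<Rightarrow> real"
  assumes P: "finite P" "P \<subseteq> {0..1}" and \<tau>: "\<tau> \<ge> 0"
    and df: "\<And>w. (f has_real_derivative f' w) (at w)"
    and lip: "\<And>w u. \<bar>f' w - f' u\<bar> \<le> B * \<bar>w - u\<bar>" and bound: "\<And>w. \<bar>f' w\<bar> \<le> B"
  defines "W \<equiv> \<lambda>v. \<tau> * (real v - \<Sum>P)" and "s \<equiv> \<tau>\<^sup>2 * (\<Sum>p\<in>P. p * (1 - p))"
  shows "\<bar>weighted (bernoulli_poly P) (\<lambda>v. f' (W v) - W v * f (W v))\<bar> \<le> B * \<bar>1 - s\<bar> + 2 * B * \<tau> * s"
proof -
  let ?E = "weighted (bernoulli_poly P)"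
  have B0: "B \<ge> 0" using bound[of 0] by linarith
  have WS: "W (Suc v) = W v + \<tau>" for v by (simp add: W_def algebra_simps)
  have diff: "\<bar>f (W (Suc v)) - f (W v) - \<tau> * f' (W v)\<bar> \<le> B * \<tau>\<^sup>2" for v
  proof (cases "\<tau> = 0")
    case False
    then have "W v < W (Suc v)" using \<tau> WS by simp
    then obtain z where z: "W v < z" "z < W (Suc v)" "f (W (Suc v)) - f (W v) = (W (Suc v) - W v) * f' z"
      using MVT2[of "W v" "W (Suc v)" f f'] df by blast
    then have "f (W (Suc v)) - f (W v) - \<tau> * f' (W v) = \<tau> * (f' z - f' (W v))" unfolding WS by (simp add: algebra_simps)
    then have "\<bar>f (W (Suc v)) - f (W v) - \<tau> * f' (W v)\<bar> = \<tau> * \<bar>f' z - f' (W v)\<bar>" using \<tau> by (simp add: abs_mult)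
    also have "\<dots> \<le> \<tau> * (B * \<bar>z - W v\<bar>)" using \<tau> lip by (intro mult_left_mono) auto
    also have "\<dots> \<le> \<tau> * (B * \<tau>)" using \<tau> z B0 unfolding WS by (intro mult_left_mono) auto
    finally show ?thesis by (simp add: power2_eq_square mult_ac)
  qed (simp add: WS)
  have tm: "\<bar>weighted (bernoulli_poly (P - {p})) (\<lambda>v. f (W (Suc v)) - f (W v)) - \<tau> * ?E (\<lambda>v. f' (W v))\<bar> \<le> 2 * B * \<tau>\<^sup>2"
    if p: "p \<in> P" for p
  proof -
    let ?F = "weighted (bernoulli_poly (P - {p}))"
    have P': "finite (P - {p})" "P - {p} \<subseteq> {0..1}" using P by auto
    have p01: "0 \<le> p" "p \<le> 1" using p P by auto
    have "\<bar>?F (\<lambda>v. f (W (Suc v)) - f (W v) - \<tau> * f' (W v))\<bar> \<le> ?F (\<lambda>_. B * \<tau>\<^sup>2)"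
      by (rule weighted_bernoulli_abs_le[OF P' diff])
    then have 1: "\<bar>?F (\<lambda>v. f (W (Suc v)) - f (W v)) - \<tau> * ?F (\<lambda>v. f' (W v))\<bar> \<le> B * \<tau>\<^sup>2"
      unfolding weighted_diff_fun weighted_mult_fun by simp
    have "\<bar>?F (\<lambda>v. f' (W (Suc v)) - f' (W v))\<bar> \<le> ?F (\<lambda>_. B * \<tau>)"
    proof (rule weighted_bernoulli_abs_le[OF P'])
      show "\<bar>f' (W (Suc v)) - f' (W v)\<bar> \<le> B * \<tau>" for v using lip[of "W (Suc v)" "W v"] \<tau> unfolding WS by simp
    qed
    then have 2: "\<bar>?F (\<lambda>v. f' (W (Suc v))) - ?F (\<lambda>v. f' (W v))\<bar> \<le> B * \<tau>"
      unfolding weighted_diff_fun by simp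
    have "?E (\<lambda>v. f' (W v)) - ?F (\<lambda>v. f' (W v)) = p * (?F (\<lambda>v. f' (W (Suc v))) - ?F (\<lambda>v. f' (W v)))"
      unfolding weighted_bernoulli_remove[OF P(1) p] by (simp add: algebra_simps)
    then have "\<bar>?E (\<lambda>v. f' (W v)) - ?F (\<lambda>v. f' (W v))\<bar> = p * \<bar>?F (\<lambda>v. f' (W (Suc v))) - ?F (\<lambda>v. f' (W v))\<bar>"
      using p01 by (simp add: abs_mult)
    also have "\<dots> \<le> 1 * (B * \<tau>)" using p01 2 by (intro mult_mono) auto
    finally have "\<tau> * \<bar>?E (\<lambda>v. f' (W v)) - ?F (\<lambda>v. f' (W v))\<bar> \<le> \<tau> * (1 * (B * \<tau>))" using \<tau> by (rule mult_left_mono)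
    then have 3: "\<bar>\<tau> * ?E (\<lambda>v. f' (W v)) - \<tau> * ?F (\<lambda>v. f' (W v))\<bar> \<le> B * \<tau>\<^sup>2"
      using \<tau> by (simp add: abs_mult right_diff_distrib[symmetric] power2_eq_square mult_ac)
    show ?thesis using 1 3 by linarith
  qed
  define e1 where "e1 = ?E (\<lambda>v. f' (W v))"
  define V where "V = (\<Sum>p\<in>P. p * (1 - p))"
  have V0: "p * (1 - p) \<ge> 0" if "p \<in> P" for p using that P by auto
  have e1: "\<bar>e1\<bar> \<le> B" using weighted_bernoulli_abs_le[OF P, of "\<lambda>v. f' (W v)" "\<lambda>_. B"] bound unfolding e1_def by simp
  have W: "?E (\<lambda>v. W v * f (W v)) = \<tau> * (\<Sum>p\<in>P. p * (1 - p) * weighted (bernoulli_poly (P - {p})) (\<lambda>v. f (W (Suc v)) - f (W v)))"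
  proof -
    have "?E (\<lambda>v. W v * f (W v)) = ?E (\<lambda>v. \<tau> * ((real v - \<Sum>P) * f (W v)))" by (simp add: W_def mult_ac)
    then show ?thesis unfolding weighted_mult_fun bernoulli_stein_identity[OF P(1)] .
  qed
  have "\<bar>(\<Sum>p\<in>P. p * (1 - p) * weighted (bernoulli_poly (P - {p})) (\<lambda>v. f (W (Suc v)) - f (W v))) - V * (\<tau> * e1)\<bar>
    = \<bar>\<Sum>p\<in>P. p * (1 - p) * (weighted (bernoulli_poly (P - {p})) (\<lambda>v. f (W (Suc v)) - f (W v)) - \<tau> * e1)\<bar>"
    unfolding V_def by (simp add: sum_distrib_right sum_subtractf[symmetric] right_diff_distrib)
  also have "\<dots> \<le> (\<Sum>p\<in>P. p * (1 - p) * (2 * B * \<tau>\<^sup>2))"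
  proof (rule order_trans[OF sum_abs], rule sum_mono)
    fix p assume p: "p \<in> P"
    show "\<bar>p * (1 - p) * (weighted (bernoulli_poly (P - {p})) (\<lambda>v. f (W (Suc v)) - f (W v)) - \<tau> * e1)\<bar> \<le> p * (1 - p) * (2 * B * \<tau>\<^sup>2)"
      unfolding abs_mult[of "p * (1 - p)"] abs_of_nonneg[OF V0[OF p]] e1_def
      by (rule mult_left_mono[OF tm[OF p] V0[OF p]])
  qed
  also have "\<dots> = V * (2 * B * \<tau>\<^sup>2)" unfolding V_def by (simp add: sum_distrib_right)
  finally have S: "\<bar>(\<Sum>p\<in>P. p * (1 - p) * weighted (bernoulli_poly (P - {p})) (\<lambda>v. f (W (Suc v)) - f (W v))) - V * (\<tau> * e1)\<bar> \<le> V * (2 * B * \<tau>\<^sup>2)" .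
  have s: "s = \<tau>\<^sup>2 * V" by (simp add: s_def V_def)
  have "\<bar>?E (\<lambda>v. W v * f (W v)) - s * e1\<bar> = \<tau> * \<bar>(\<Sum>p\<in>P. p * (1 - p) * weighted (bernoulli_poly (P - {p})) (\<lambda>v. f (W (Suc v)) - f (W v))) - V * (\<tau> * e1)\<bar>"
  proof -
    have "\<bar>\<tau> * S - \<tau>\<^sup>2 * V * e1\<bar> = \<tau> * \<bar>S - V * (\<tau> * e1)\<bar>" for S
    proof -
      have "\<tau> * S - \<tau>\<^sup>2 * V * e1 = \<tau> * (S - V * (\<tau> * e1))" by (simp add: algebra_simps power2_eq_square)
      then show ?thesis using \<tau> by (simp add: abs_mult)
    qed
    then show ?thesis unfolding W s .
  qed
  also have "\<dots> \<le> \<tau> * (V * (2 * B * \<tau>\<^sup>2))" using S \<tau> by (rule mult_left_mono)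
  finally have A: "\<bar>?E (\<lambda>v. W v * f (W v)) - s * e1\<bar> \<le> 2 * B * \<tau> * s" unfolding s by (simp add: mult_ac)
  have "\<bar>e1 - s * e1\<bar> = \<bar>e1\<bar> * \<bar>1 - s\<bar>" by (simp add: abs_mult[symmetric] algebra_simps)
  also have "\<dots> \<le> B * \<bar>1 - s\<bar>" using e1 by (rule mult_right_mono) simp
  finally show ?thesis using A unfolding weighted_diff_fun e1_def[symmetric] by linarith
qed

section \<open>The total variation distance\<close>

lemma exp_minus_one_abs_le:
  fixes x :: real
  shows "\<bar>exp x - 1\<bar> \<le> \<bar>x\<bar> * exp \<bar>x\<bar>"
proof -
  obtain t where t: "\<bar>t\<bar> \<le> \<bar>x\<bar>" "exp x = (\<Sum>m<1. x ^ m / fact m) + exp t / fact 1 * x ^ 1"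
    using Maclaurin_exp_le[of x 1] by auto
  have "exp x - 1 = exp t * x" using t(2) by simp
  then have "\<bar>exp x - 1\<bar> = exp t * \<bar>x\<bar>" by (simp add: abs_mult)
  also have "\<dots> \<le> exp \<bar>x\<bar> * \<bar>x\<bar>" using t(1) by (intro mult_right_mono) auto
  finally show ?thesis by (simp add: mult.commute)
qed

lemma max_0_lipschitz: "\<bar>max 0 (1 - x) - max 0 (1 - y)\<bar> \<le> \<bar>x - y\<bar>" for x y :: real
  by (auto simp: max_def)

text \<open>
  The whole error analysis at fixed \<open>n\<close>, with \<open>s = 1/sqrt n\<close> as the small parameter. The hypotheses
  express that \<open>a\<close> is \<open>\<kappa> s\<close> up to lower order, where \<open>2 \<kappa>\<^sup>2 / 45 = \<mu>\<^sup>2\<close> is the limit of \<open>a\<^sup>2\<close> times the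
  variance of the number of valleys. In the result, \<open>4 D + C1\<close> bounds the cost of replacing the
  likelihood ratio by the log-linear function, and the terms with \<open>B\<close> that of Stein's method.
\<close>

theorem tv_dist_gaussian_bound:
  fixes f f' :: "real \<Rightarrow> real" and A A2 B \<kappa> \<mu> :: real and k m :: nat
  defines "n \<equiv> Suc k"
  defines "a \<equiv> real n ^ 2 / (4 * real m ^ 2)" and "s \<equiv> 1 / sqrt (real n)"
  defines "E0 \<equiv> 16 * A\<^sup>2 + A"
  defines "D \<equiv> E0 * exp E0 * (4 + exp (2 * A\<^sup>2) * exp (16 * A ^ 3)) / 2"
    and "C1 \<equiv> exp (A\<^sup>2 / 2) * (2 * A ^ 3 * exp (2 * A ^ 3)) + (A2 + A\<^sup>2) * exp (A2 + A\<^sup>2)"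
    and "V1 \<equiv> (A2 + A\<^sup>2) / \<mu>\<^sup>2"
  assumes k: "k \<ge> 3" and m: "4 * n \<le> m"
    and aA: "a \<le> A * s" and aA2: "\<bar>a\<^sup>2 * real n - \<kappa>\<^sup>2\<bar> \<le> A2 * s"
    and small: "A * s \<le> 1 / 4" "D * s \<le> 1 / 2"
    and \<mu>: "\<mu> > 0" "\<mu>\<^sup>2 = 2 * \<kappa>\<^sup>2 / 45"
    and df: "\<And>w. (f has_real_derivative f' w) (at w)"
    and ode: "\<And>w. f' w - w * f w = max 0 (1 - exp (- \<mu> * w - \<mu>\<^sup>2 / 2)) - T"
    and lip: "\<And>w u. \<bar>f' w - f' u\<bar> \<le> B * \<bar>w - u\<bar>" and bound: "\<And>w. \<bar>f' w\<bar> \<le> B"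
  shows "\<bar>tv_dist n (shelf_shuffle n m) (uniform_perm n) - T\<bar> \<le> (4 * D + C1 + B * V1 + 2 * B * (A / \<mu>) * (1 + V1)) * s"
proof -
  obtain P where P: "finite P" "P \<subseteq> {0<..<1}" "card P \<le> k"
    and VP: "valley_poly k = smult (fact (Suc k)) (bernoulli_poly P)"
    and mean: "\<Sum>P = (real k - 1) / 3" and var: "(\<Sum>p\<in>P. p * (1 - p)) = 2 * (real k + 2) / 45"
    using valley_poly_bernoulli[OF k] by blast
  have P01: "P \<subseteq> {0..1}" using P(2) by auto
  let ?E = "weighted (bernoulli_poly P)"
  define \<sigma>2 where "\<sigma>2 = (\<Sum>p\<in>P. p * (1 - p))"
  define h where "h v = real v - \<Sum>P" for v
  define L where "L = likelihood n m"
  define x where "x v = exp (- a * h v)" for v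
  have n: "real n = real k + 1" "real n \<ge> 4" using k by (simp_all add: n_def)
  have s: "s > 0" "s \<le> 1" "s\<^sup>2 * real n = 1" using n by (simp_all add: s_def power_divide)
  have a0: "a \<ge> 0" by (simp add: a_def)
  have A0: "A \<ge> 0" using a0 aA s by (meson mult_neg_pos not_le order_trans)
  have A20: "A2 \<ge> 0" using aA2 s by (meson abs_ge_zero mult_neg_pos not_le order_trans)
  have a14: "a \<le> 1 / 4" using aA small by linarith
  have \<sigma>2: "\<sigma>2 = 2 * (real n + 1) / 45" "0 \<le> \<sigma>2" "\<sigma>2 \<le> real n" using var n by (simp_all add: \<sigma>2_def)
  have As: "A * s \<le> A" using A0 s by (simp add: mult_left_le)
  have a2n: "a\<^sup>2 * real n \<le> A\<^sup>2"
  proof -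
    have "a\<^sup>2 \<le> (A * s)\<^sup>2" by (rule power_mono[OF aA a0])
    then have "a\<^sup>2 * real n \<le> (A * s)\<^sup>2 * real n" using n by (intro mult_right_mono) auto
    also have "\<dots> = A\<^sup>2 * (s\<^sup>2 * real n)" by (simp only: power_mult_distrib mult.assoc)
    finally show ?thesis unfolding s by simp
  qed
  have na3: "real n * a ^ 3 \<le> A ^ 3 * s" "real n * a ^ 3 \<le> A ^ 3"
  proof -
    have "real n * a ^ 3 = (a\<^sup>2 * real n) * a" by (simp add: power2_eq_square power3_eq_cube)
    also have "\<dots> \<le> A\<^sup>2 * (A * s)" using a2n aA a0 n by (intro mult_mono) auto
    finally show 1: "real n * a ^ 3 \<le> A ^ 3 * s" by (simp add: power2_eq_square power3_eq_cube)
    also have "\<dots> \<le> A ^ 3" using A0 s by (simp add: mult_left_le)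
    finally show "real n * a ^ 3 \<le> A ^ 3" .
  qed
  have ca3: "real (card P) * a ^ 3 \<le> real n * a ^ 3" using P(3) a0 n by (intro mult_right_mono) auto
  define \<eta> where "\<eta> = 16 * a\<^sup>2 + a / real n"
  have \<eta>: "0 \<le> \<eta>" "\<eta> * real n \<le> E0" "\<eta> \<le> E0 * s\<^sup>2"
  proof -
    show "0 \<le> \<eta>" using a0 by (simp add: \<eta>_def)
    have "\<eta> * real n = 16 * (a\<^sup>2 * real n) + a" using n by (simp add: \<eta>_def field_simps)
    then show *: "\<eta> * real n \<le> E0" using a2n aA As unfolding E0_def by linarith
    have "\<eta> = \<eta> * real n * s\<^sup>2" using s(3) by (metis mult.assoc mult.commute mult.right_neutral)
    also have "\<dots> \<le> E0 * s\<^sup>2" by (rule mult_right_mono[OF *]) simp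
    finally show "\<eta> \<le> E0 * s\<^sup>2" .
  qed
  have E00: "E0 \<ge> 0" using \<eta> n by (meson mult_nonneg_nonneg of_nat_0_le_iff order_trans)
  have deg: "2 * v \<le> n - 1" if "v \<le> degree (bernoulli_poly P)" for v
  proof -
    have "degree (bernoulli_poly P) = degree (valley_poly k)" unfolding VP by simp
    then show ?thesis using that degree_valley_poly[of k] unfolding n_def by linarith
  qed
  have h: "\<bar>h v\<bar> + 1 \<le> real n" if "2 * v \<le> n - 1" for v
  proof -
    have "2 * real v \<le> real k" "0 \<le> real v" using that unfolding n_def by linarith+
    then show ?thesis unfolding h_def mean n(1) using k by (simp add: abs_if field_simps)
  qed
  have EL: "?E L = 1" and tv: "tv_dist n (shelf_shuffle n m) (uniform_perm n) = ?E (\<lambda>v. max 0 (1 - L v))"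
    using tv_dist_expectation[OF _ VP, of m] m unfolding L_def n_def by simp_all
  obtain K where K: "K > 0" and LK: "\<And>v. 2 * v \<le> n - 1 \<Longrightarrow> \<exists>\<epsilon>. L v = K * x v * exp \<epsilon> \<and> \<bar>\<epsilon>\<bar> \<le> \<eta> * (\<bar>h v\<bar> + 1)"
  proof -
    have "(real n - 2) / 3 = \<Sum>P" unfolding mean n by simp
    then show ?thesis using likelihood_log_linear[of n m] m k that
      unfolding L_def x_def h_def \<eta>_def a_def n_def by auto
  qed
  (* The Laplace transforms of the centred number of valleys at a and at 2 * a; the second one
     controls second moments of x. *)
  define M1 where "M1 = ?E x"
  define M2 where "M2 = ?E (\<lambda>v. exp (- (2 * a) * h v))"
  have M1: "M1 \<ge> 1"
  proof -
    have "?E (\<lambda>v. 1 - a * (real v - \<Sum>P)) \<le> ?E x"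
    proof (rule weighted_bernoulli_mono[OF P(1) P01])
      show "1 - a * (real v - \<Sum>P) \<le> x v" for v
        using exp_ge_add_one_self[of "- (a * (real v - \<Sum>P))"] by (simp add: x_def h_def)
    qed
    then show ?thesis unfolding M1_def weighted_diff_fun weighted_mult_fun bernoulli_mean[OF P(1)] by simp
  qed
  have M2: "M2 \<le> exp (2 * A\<^sup>2) * exp (16 * A ^ 3)"
  proof -
    have "\<bar>M2 - exp ((2 * a)\<^sup>2 * \<sigma>2 / 2)\<bar> \<le> exp ((2 * a)\<^sup>2 * \<sigma>2 / 2) * (exp (2 * real (card P) * (2 * a) ^ 3) - 1)"
      unfolding M2_def h_def \<sigma>2_def by (rule bernoulli_laplace[OF P(1) P01]) (use a0 a14 in auto)
    then have "M2 \<le> exp ((2 * a)\<^sup>2 * \<sigma>2 / 2) * exp (2 * real (card P) * (2 * a) ^ 3)"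
      by (simp add: algebra_simps abs_le_iff)
    also have "\<dots> \<le> exp (2 * A\<^sup>2) * exp (16 * A ^ 3)"
    proof (intro mult_mono)
      have "a\<^sup>2 * \<sigma>2 \<le> a\<^sup>2 * real n" using \<sigma>2 by (intro mult_left_mono) auto
      moreover have "(2 * a)\<^sup>2 * \<sigma>2 / 2 = 2 * (a\<^sup>2 * \<sigma>2)" by (simp add: power2_eq_square)
      ultimately show "exp ((2 * a)\<^sup>2 * \<sigma>2 / 2) \<le> exp (2 * A\<^sup>2)" unfolding exp_le_cancel_iff using a2n by linarith
      show "exp (2 * real (card P) * (2 * a) ^ 3) \<le> exp (16 * A ^ 3)" using ca3 na3(2) by (simp add: power3_eq_cube)
    qed auto
    finally show ?thesis .
  qed
  (* Q is the limit of M1. As the likelihood ratio has expectation 1, K is close to 1 / Q. *)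
  define Q where "Q = exp (\<mu>\<^sup>2 / 2)"
  have Q1: "Q \<ge> 1" by (simp add: Q_def)
  have s1: "s\<^sup>2 \<le> s" using s by (simp add: power2_eq_square mult_left_le)
  have var_diff: "\<bar>a\<^sup>2 * \<sigma>2 - \<mu>\<^sup>2\<bar> \<le> (A2 + A\<^sup>2) * s"
  proof -
    have "a\<^sup>2 \<le> (A * s)\<^sup>2" by (rule power_mono[OF aA a0])
    also have "\<dots> \<le> A\<^sup>2 * s" unfolding power_mult_distrib using s1 by (rule mult_left_mono) simp
    finally have "a\<^sup>2 \<le> A\<^sup>2 * s" .
    have "a\<^sup>2 * \<sigma>2 - \<mu>\<^sup>2 = 2 / 45 * ((a\<^sup>2 * real n - \<kappa>\<^sup>2) + a\<^sup>2)" unfolding \<sigma>2(1) \<mu>(2)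
      by (simp add: algebra_simps add_divide_distrib diff_divide_distrib)
    also have "\<bar>\<dots>\<bar> \<le> \<bar>a\<^sup>2 * real n - \<kappa>\<^sup>2\<bar> + a\<^sup>2"
    proof -
      have "\<bar>2 / 45 * (e + b)\<bar> \<le> \<bar>e\<bar> + b" if "b \<ge> 0" for e b :: real
      proof -
        have "\<bar>2 / 45 * (e + b)\<bar> = 2 / 45 * \<bar>e + b\<bar>" unfolding abs_mult by simp
        also have "\<dots> \<le> 1 * \<bar>e + b\<bar>" by (rule mult_right_mono) simp_all
        also have "\<dots> \<le> \<bar>e\<bar> + b" using abs_triangle_ineq[of e b] that by simp
        finally show ?thesis .
      qed
      from this[OF zero_le_power2] show ?thesis .
    qed
    also have "\<dots> \<le> A2 * s + A\<^sup>2 * s" using aA2 \<open>a\<^sup>2 \<le> A\<^sup>2 * s\<close> by linarith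
    finally show ?thesis by (simp add: algebra_simps)
  qed
  have M1Q: "\<bar>M1 / Q - 1\<bar> \<le> C1 * s"
  proof -
    define q where "q = exp (a\<^sup>2 * \<sigma>2 / 2)"
    have q: "q \<le> exp (A\<^sup>2 / 2)"
    proof -
      have "a\<^sup>2 * \<sigma>2 \<le> a\<^sup>2 * real n" using \<sigma>2 by (intro mult_left_mono) auto
      then show ?thesis using a2n unfolding q_def by simp
    qed
    define y where "y = 2 * real (card P) * a ^ 3"
    have y: "0 \<le> y" "y \<le> 2 * A ^ 3 * s" "y \<le> 2 * A ^ 3" using ca3 na3 a0 by (simp_all add: y_def)
    have "\<bar>M1 - q\<bar> \<le> q * (exp y - 1)"
      unfolding M1_def x_def[abs_def] h_def \<sigma>2_def q_def y_def by (rule bernoulli_laplace[OF P(1) P01]) (use a0 a14 in auto)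
    also have "\<dots> \<le> exp (A\<^sup>2 / 2) * (y * exp y)"
      using q y exp_minus_one_abs_le[of y] by (intro mult_mono) auto
    also have "\<dots> \<le> exp (A\<^sup>2 / 2) * ((2 * A ^ 3 * s) * exp (2 * A ^ 3))"
      using y A0 s by (intro mult_left_mono mult_mono) auto
    finally have 1: "\<bar>M1 - q\<bar> \<le> exp (A\<^sup>2 / 2) * (2 * A ^ 3 * exp (2 * A ^ 3)) * s" by (simp add: mult_ac)
    have "\<bar>M1 / Q - q / Q\<bar> = \<bar>M1 - q\<bar> / Q" using Q1 by (simp add: diff_divide_distrib[symmetric] abs_divide)
    also have "\<dots> \<le> \<bar>M1 - q\<bar> / 1" using Q1 by (intro divide_left_mono) auto
    finally have 2: "\<bar>M1 / Q - q / Q\<bar> \<le> \<bar>M1 - q\<bar>" by simp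
    define z where "z = (a\<^sup>2 * \<sigma>2 - \<mu>\<^sup>2) / 2"
    have z: "\<bar>z\<bar> \<le> (A2 + A\<^sup>2) * s" "(A2 + A\<^sup>2) * s \<le> A2 + A\<^sup>2"
      using var_diff A20 s by (simp_all add: z_def mult_left_le)
    have "q / Q = exp z" unfolding q_def Q_def z_def by (simp add: exp_diff[symmetric] diff_divide_distrib)
    then have "\<bar>q / Q - 1\<bar> \<le> \<bar>z\<bar> * exp \<bar>z\<bar>" using exp_minus_one_abs_le by simp
    also have "\<dots> \<le> ((A2 + A\<^sup>2) * s) * exp (A2 + A\<^sup>2)" using z A20 s by (intro mult_mono) auto
    finally have 3: "\<bar>q / Q - 1\<bar> \<le> (A2 + A\<^sup>2) * exp (A2 + A\<^sup>2) * s" by (simp add: mult_ac)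
    have "C1 * s = exp (A\<^sup>2 / 2) * (2 * A ^ 3 * exp (2 * A ^ 3)) * s + (A2 + A\<^sup>2) * exp (A2 + A\<^sup>2) * s"
      unfolding C1_def by (rule distrib_right)
    then show ?thesis using 1 2 3 by linarith
  qed
  have \<Delta>: "?E (\<lambda>v. \<bar>L v - K * x v\<bar>) \<le> K * (D * s)"
  proof -
    (* The factor 1 / s comes from 2 * (p * s) * x <= (p * s) ^ 2 + x ^ 2 with p = |h v| + 1,
       which separates the moments of h from those of x. *)
    define c where "c = K * \<eta> * exp E0 / (2 * s)"
    have c0: "c \<ge> 0" using K \<eta> s by (simp add: c_def)
    have "?E (\<lambda>v. \<bar>L v - K * x v\<bar>) \<le> ?E (\<lambda>v. c * (s\<^sup>2 * 2 * (real v - \<Sum>P)\<^sup>2 + s\<^sup>2 * 2 + exp (- (2 * a) * h v)))"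
    proof (rule weighted_bernoulli_mono[OF P(1) P01])
      fix v assume "v \<le> degree (bernoulli_poly P)"
      then have v: "2 * v \<le> n - 1" by (rule deg)
      obtain \<epsilon> where \<epsilon>: "L v = K * x v * exp \<epsilon>" "\<bar>\<epsilon>\<bar> \<le> \<eta> * (\<bar>h v\<bar> + 1)" using LK[OF v] by blast
      have x0: "x v > 0" by (simp add: x_def)
      have "\<eta> * (\<bar>h v\<bar> + 1) \<le> \<eta> * real n" using h[OF v] \<eta> by (intro mult_left_mono) auto
      then have \<epsilon>E: "\<bar>\<epsilon>\<bar> \<le> E0" using \<epsilon>(2) \<eta>(2) by linarith
      have "L v - K * x v = K * x v * (exp \<epsilon> - 1)" unfolding \<epsilon>(1) by (simp add: algebra_simps)
      then have "\<bar>L v - K * x v\<bar> = K * x v * \<bar>exp \<epsilon> - 1\<bar>" using K x0 by (simp add: abs_mult)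
      also have "\<dots> \<le> K * x v * (\<bar>\<epsilon>\<bar> * exp \<bar>\<epsilon>\<bar>)" using K x0 exp_minus_one_abs_le by (intro mult_left_mono) auto
      also have "\<dots> \<le> K * x v * ((\<eta> * (\<bar>h v\<bar> + 1)) * exp E0)" using K x0 \<epsilon>(2) \<epsilon>E \<eta> by (intro mult_left_mono mult_mono) auto
      also have "\<dots> = c * (2 * ((\<bar>h v\<bar> + 1) * s) * x v)" using s by (simp add: c_def)
      also have "\<dots> \<le> c * (s\<^sup>2 * 2 * (real v - \<Sum>P)\<^sup>2 + s\<^sup>2 * 2 + exp (- (2 * a) * h v))"
      proof (rule mult_left_mono[OF _ c0])
        have "2 * ((\<bar>h v\<bar> + 1) * s) * x v \<le> ((\<bar>h v\<bar> + 1) * s)\<^sup>2 + (x v)\<^sup>2" by (rule sum_squares_bound)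
        also have "\<dots> \<le> s\<^sup>2 * 2 * (real v - \<Sum>P)\<^sup>2 + s\<^sup>2 * 2 + exp (- (2 * a) * h v)"
        proof (rule add_mono)
          have "(\<bar>h v\<bar> + 1)\<^sup>2 \<le> 2 * (h v)\<^sup>2 + 2"
            using sum_squares_bound[of "\<bar>h v\<bar>" 1] by (simp add: power2_eq_square algebra_simps)
          then have le: "s\<^sup>2 * (\<bar>h v\<bar> + 1)\<^sup>2 \<le> s\<^sup>2 * (2 * (h v)\<^sup>2 + 2)" by (rule mult_left_mono) simp
          have "((\<bar>h v\<bar> + 1) * s)\<^sup>2 = s\<^sup>2 * (\<bar>h v\<bar> + 1)\<^sup>2" unfolding power_mult_distrib by (rule mult.commute)
          also note le
          also have "s\<^sup>2 * (2 * (h v)\<^sup>2 + 2) = s\<^sup>2 * 2 * (real v - \<Sum>P)\<^sup>2 + s\<^sup>2 * 2" unfolding h_def by (simp only: distrib_left mult.assoc)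
          finally show "((\<bar>h v\<bar> + 1) * s)\<^sup>2 \<le> s\<^sup>2 * 2 * (real v - \<Sum>P)\<^sup>2 + s\<^sup>2 * 2" .
          show "(x v)\<^sup>2 \<le> exp (- (2 * a) * h v)" unfolding x_def by (simp add: power2_eq_square exp_add[symmetric])
        qed
        finally show "2 * ((\<bar>h v\<bar> + 1) * s) * x v \<le> s\<^sup>2 * 2 * (real v - \<Sum>P)\<^sup>2 + s\<^sup>2 * 2 + exp (- (2 * a) * h v)" .
      qed
      finally show "\<bar>L v - K * x v\<bar> \<le> c * (s\<^sup>2 * 2 * (real v - \<Sum>P)\<^sup>2 + s\<^sup>2 * 2 + exp (- (2 * a) * h v))" .
    qed
    also have "\<dots> = c * (s\<^sup>2 * 2 * \<sigma>2 + s\<^sup>2 * 2 + M2)"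
      unfolding weighted_mult_fun weighted_add_fun bernoulli_variance[OF P(1)] \<sigma>2_def M2_def by simp
    also have "\<dots> \<le> c * (4 + exp (2 * A\<^sup>2) * exp (16 * A ^ 3))"
    proof (rule mult_left_mono[OF _ c0])
      have "s\<^sup>2 * \<sigma>2 \<le> s\<^sup>2 * real n" using \<sigma>2 by (intro mult_left_mono) auto
      moreover have "s\<^sup>2 \<le> 1" using s1 s by linarith
      ultimately show "s\<^sup>2 * 2 * \<sigma>2 + s\<^sup>2 * 2 + M2 \<le> 4 + exp (2 * A\<^sup>2) * exp (16 * A ^ 3)"
        using M2 s(3) by linarith
    qed
    also have "\<dots> \<le> (K * (E0 * s\<^sup>2) * exp E0 / (2 * s)) * (4 + exp (2 * A\<^sup>2) * exp (16 * A ^ 3))"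
      unfolding c_def using K \<eta> s by (intro mult_right_mono divide_right_mono mult_left_mono) (auto intro: add_nonneg_nonneg)
    also have "\<dots> = K * (D * s)" unfolding D_def using s by (simp add: power2_eq_square field_simps)
    finally show ?thesis .
  qed
  have KM: "\<bar>1 - K * M1\<bar> \<le> K * (D * s)"
  proof -
    have "1 - K * M1 = ?E (\<lambda>v. L v - K * x v)" unfolding weighted_diff_fun weighted_mult_fun EL M1_def ..
    also have "\<bar>\<dots>\<bar> \<le> ?E (\<lambda>v. \<bar>L v - K * x v\<bar>)" by (rule weighted_bernoulli_abs_le[OF P(1) P01]) simp
    finally show ?thesis using \<Delta> by linarith
  qed
  have D0: "D \<ge> 0" unfolding D_def using E00 by (auto intro!: add_nonneg_nonneg mult_nonneg_nonneg)
  (* M1 >= 1 by convexity of the exponential function. *)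
  have K2: "K \<le> 2"
  proof -
    have "K * (D * s) \<le> K * (1 / 2)" using K small by (intro mult_left_mono) auto
    moreover have "K * 1 \<le> K * M1" using K M1 by (intro mult_left_mono) auto
    ultimately show ?thesis using KM by linarith
  qed
  have KD: "K * (D * s) \<le> 2 * D * s" using K2 D0 s mult_right_mono[of K 2 "D * s"] by simp
  have LQ: "?E (\<lambda>v. \<bar>L v - x v / Q\<bar>) \<le> 4 * D * s + C1 * s"
  proof -
    have "?E (\<lambda>v. \<bar>L v - x v / Q\<bar>) \<le> ?E (\<lambda>v. \<bar>L v - K * x v\<bar> + \<bar>K - 1 / Q\<bar> * x v)"
    proof (rule weighted_bernoulli_mono[OF P(1) P01])
      fix v
      have "L v - x v / Q = (L v - K * x v) + (K - 1 / Q) * x v" by (simp add: algebra_simps)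
      also have "\<bar>\<dots>\<bar> \<le> \<bar>L v - K * x v\<bar> + \<bar>(K - 1 / Q) * x v\<bar>" by (rule abs_triangle_ineq)
      also have "\<bar>(K - 1 / Q) * x v\<bar> = \<bar>K - 1 / Q\<bar> * x v" by (simp add: abs_mult x_def)
      finally show "\<bar>L v - x v / Q\<bar> \<le> \<bar>L v - K * x v\<bar> + \<bar>K - 1 / Q\<bar> * x v" .
    qed
    also have "\<dots> = ?E (\<lambda>v. \<bar>L v - K * x v\<bar>) + \<bar>K - 1 / Q\<bar> * M1" unfolding weighted_add_fun weighted_mult_fun M1_def ..
    also have "\<bar>K - 1 / Q\<bar> * M1 = \<bar>(K * M1 - 1) + (1 - M1 / Q)\<bar>"
    proof -
      have "(K * M1 - 1) + (1 - M1 / Q) = (K - 1 / Q) * M1" by (simp add: algebra_simps)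
      then show ?thesis using M1 by (simp add: abs_mult)
    qed
    also have "\<dots> \<le> \<bar>1 - K * M1\<bar> + \<bar>M1 / Q - 1\<bar>" by linarith
    finally show ?thesis using \<Delta> KM KD M1Q by linarith
  qed
  define \<tau> where "\<tau> = a / \<mu>"
  define W where "W v = \<tau> * (real v - \<Sum>P)" for v
  have \<tau>: "\<tau> \<ge> 0" "\<tau> \<le> A / \<mu> * s" using a0 aA \<mu> by (simp_all add: \<tau>_def field_simps)
  have xW: "x v / Q = exp (- \<mu> * W v - \<mu>\<^sup>2 / 2)" for v
    unfolding x_def Q_def W_def \<tau>_def h_def using \<mu> by (simp add: exp_diff)
  define sv where "sv = \<tau>\<^sup>2 * \<sigma>2"
  have "1 - sv = (\<mu>\<^sup>2 - a\<^sup>2 * \<sigma>2) / \<mu>\<^sup>2" unfolding sv_def \<tau>_def using \<mu>(1) by (simp add: field_simps power_divide)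
  then have "\<bar>1 - sv\<bar> = \<bar>a\<^sup>2 * \<sigma>2 - \<mu>\<^sup>2\<bar> / \<mu>\<^sup>2" by (simp add: abs_divide abs_minus_commute)
  also have "\<dots> \<le> (A2 + A\<^sup>2) * s / \<mu>\<^sup>2" using var_diff by (rule divide_right_mono) simp
  finally have sv: "\<bar>1 - sv\<bar> \<le> V1 * s" by (simp add: V1_def)
  have V10: "V1 \<ge> 0" using A20 by (simp add: V1_def)
  have "V1 * s \<le> V1" using V10 s by (simp add: mult_left_le)
  then have sv1: "sv \<le> 1 + V1" "sv \<ge> 0" using sv \<sigma>2 by (linarith, simp add: sv_def)
  have B0: "B \<ge> 0" using bound[of 0] by linarith
  have "?E (\<lambda>v. max 0 (1 - x v / Q)) - T = ?E (\<lambda>v. f' (W v) - W v * f (W v))"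
    unfolding ode xW weighted_diff_fun by simp
  also have "\<bar>\<dots>\<bar> \<le> B * \<bar>1 - sv\<bar> + 2 * B * \<tau> * sv"
    unfolding W_def sv_def \<sigma>2_def by (rule bernoulli_stein_bound[OF P(1) P01 \<tau>(1) df lip bound])
  also have "\<dots> \<le> B * (V1 * s) + 2 * B * (A / \<mu> * s) * (1 + V1)"
    using B0 sv \<tau> sv1 A0 s(1) \<mu>(1) V10 by (intro add_mono mult_left_mono mult_mono) auto
  finally have stein: "\<bar>?E (\<lambda>v. max 0 (1 - x v / Q)) - T\<bar> \<le> B * (V1 * s) + 2 * B * (A / \<mu> * s) * (1 + V1)" .
  have "?E (\<lambda>v. max 0 (1 - L v)) - ?E (\<lambda>v. max 0 (1 - x v / Q)) = ?E (\<lambda>v. max 0 (1 - L v) - max 0 (1 - x v / Q))"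
    unfolding weighted_diff_fun ..
  also have "\<bar>\<dots>\<bar> \<le> ?E (\<lambda>v. \<bar>L v - x v / Q\<bar>)"
    by (rule weighted_bernoulli_abs_le[OF P(1) P01 max_0_lipschitz])
  finally have "\<bar>?E (\<lambda>v. max 0 (1 - L v)) - ?E (\<lambda>v. max 0 (1 - x v / Q))\<bar> \<le> 4 * D * s + C1 * s"
    using LQ by linarith
  then have "\<bar>tv_dist n (shelf_shuffle n m) (uniform_perm n) - T\<bar> \<le> (4 * D * s + C1 * s) + (B * (V1 * s) + 2 * B * (A / \<mu> * s) * (1 + V1))"
    unfolding tv using stein by linarith
  also have "\<dots> = (4 * D + C1 + B * V1 + 2 * B * (A / \<mu>) * (1 + V1)) * s" by (simp add: algebra_simps)
  finally show ?thesis .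
qed

theorem theorem1p1:
  fixes c :: real
  assumes "c > 0"
  shows "\<exists>C::real. \<exists>N::nat. C > 0 \<and> N > 0 \<and> (\<forall>n\<ge>N.
    \<bar>tv_dist n (shelf_shuffle n (nat \<lfloor>c * real n powr (5 / 4)\<rfloor>)) (uniform_perm n)
      - (1 - 2 * Phi (- (1 / (12 * c\<^sup>2 * sqrt 10))))\<bar> \<le> C / sqrt (real n))"
proof -
  define \<kappa> where "\<kappa> = 1 / (4 * c\<^sup>2)"
  define \<mu> where "\<mu> = 1 / (6 * c\<^sup>2 * sqrt 10)"
  define T where "T = 1 - 2 * Phi (- (\<mu> / 2))"
  have \<mu>: "\<mu> > 0" "\<mu>\<^sup>2 = 2 * \<kappa>\<^sup>2 / 45" using assms by (simp_all add: \<mu>_def \<kappa>_def power_divide power_mult_distrib)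
  have \<mu>2: "\<mu> / 2 = 1 / (12 * c\<^sup>2 * sqrt 10)" by (simp add: \<mu>_def)
  obtain f f' B where st: "\<forall>w. (f has_real_derivative f' w) (at w)"
    "\<forall>w. f' w - w * f w = max 0 (1 - exp (- \<mu> * w - \<mu>\<^sup>2 / 2)) - T"
    "\<forall>w u. \<bar>f' w - f' u\<bar> \<le> B * \<bar>w - u\<bar>" "\<forall>w. \<bar>f' w\<bar> \<le> B" "B > 0"
    using stein_solution[OF \<mu>(1)] unfolding T_def by blast
  (* ub bounds a from above after the floor is removed. *)
  define ub where "ub n = real n ^ 2 / (4 * (c * real n powr (5 / 4) - 1) ^ 2)" for n
  have "(\<lambda>n. real n ^ 2 / (4 * (c * real n powr (5 / 4) - 1) ^ 2)) \<in> O(\<lambda>n. 1 / sqrt (real n))"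
    using assms by real_asymp
  then have O1: "ub \<in> O(\<lambda>n. 1 / sqrt (real n))" unfolding ub_def .
  obtain A where A: "eventually (\<lambda>n. norm (ub n) \<le> A * norm (1 / sqrt (real n))) at_top"
    by (rule landau_o.bigE[OF O1])
  have t4: "(c * real n powr (5 / 4)) ^ 4 = c ^ 4 * real n ^ 5" if "n > 0" for n
    using that by (simp add: power_mult_distrib powr_power)
  (* With the limit factored out, the bracket is an expansion around 1 in powers of n powr (-5/4). *)
  have ub2: "(ub n)\<^sup>2 * real n - (1 / (4 * c\<^sup>2))\<^sup>2 = (1 / (4 * c\<^sup>2))\<^sup>2 * (1 / (1 - 1 / (c * real n powr (5 / 4))) ^ 4 - 1)"
    if "n > 0" for n
  proof -
    define t where "t = c * real n powr (5 / 4)"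
    have t: "t > 0" "t ^ 4 = c ^ 4 * real n ^ 5" using that assms t4[OF that] by (simp_all add: t_def)
    have "t - 1 = t * (1 - 1 / t)" using t by (simp add: field_simps)
    then have "(t - 1) ^ 4 = c ^ 4 * real n ^ 5 * (1 - 1 / t) ^ 4" by (simp only: power_mult_distrib t(2))
    moreover have "(ub n)\<^sup>2 * real n = real n ^ 5 / (16 * (t - 1) ^ 4)"
      unfolding ub_def t_def[symmetric] by (simp add: power_divide power_mult_distrib eval_nat_numeral)
    ultimately have "(ub n)\<^sup>2 * real n = (1 / (4 * c\<^sup>2))\<^sup>2 * (1 / (1 - 1 / t) ^ 4)"
      using that assms by (simp add: power_divide power_mult_distrib)
    then show ?thesis unfolding t_def by (simp add: algebra_simps)
  qed
  have ev: "eventually (\<lambda>n. (ub n)\<^sup>2 * real n - (1 / (4 * c\<^sup>2))\<^sup>2 = (1 / (4 * c\<^sup>2))\<^sup>2 * (1 / (1 - 1 / (c * real n powr (5 / 4))) ^ 4 - 1)) at_top"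
    using eventually_gt_at_top[of "0 :: nat"] by eventually_elim (rule ub2)
  have "(\<lambda>n. (1 / (4 * c\<^sup>2))\<^sup>2 * (1 / (1 - 1 / (c * real n powr (5 / 4))) ^ 4 - 1)) \<in> O(\<lambda>n. 1 / sqrt (real n))"
    using assms by real_asymp
  then have O2: "(\<lambda>n. (ub n)\<^sup>2 * real n - (1 / (4 * c\<^sup>2))\<^sup>2) \<in> O(\<lambda>n. 1 / sqrt (real n))"
    by (rule landau_o.big.in_cong[OF ev, THEN iffD2])
  obtain A2 where A2: "eventually (\<lambda>n. norm ((ub n)\<^sup>2 * real n - (1 / (4 * c\<^sup>2))\<^sup>2) \<le> A2 * norm (1 / sqrt (real n))) at_top"
    by (rule landau_o.bigE[OF O2])
  define E0 where "E0 = 16 * A\<^sup>2 + A"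
  define D where "D = E0 * exp E0 * (4 + exp (2 * A\<^sup>2) * exp (16 * A ^ 3)) / 2"
  define C1 where "C1 = exp (A\<^sup>2 / 2) * (2 * A ^ 3 * exp (2 * A ^ 3)) + (A2 + A\<^sup>2) * exp (A2 + A\<^sup>2)"
  define V1 where "V1 = (A2 + A\<^sup>2) / \<mu>\<^sup>2"
  define C where "C = 4 * D + C1 + B * V1 + 2 * B * (A / \<mu>) * (1 + V1)"
  have lim: "(\<lambda>n. X * (1 / sqrt (real n))) \<longlonglongrightarrow> 0" for X by real_asymp
  have small1: "eventually (\<lambda>n. A * (1 / sqrt (real n)) < 1 / 4) at_top" using order_tendstoD(2)[OF lim] by simp
  have small2: "eventually (\<lambda>n. D * (1 / sqrt (real n)) < 1 / 2) at_top" using order_tendstoD(2)[OF lim] by simp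
  have big: "eventually (\<lambda>n. 4 * real n + 1 \<le> c * real n powr (5 / 4) - 1) at_top" using assms by real_asymp
  have "eventually (\<lambda>n. \<bar>tv_dist n (shelf_shuffle n (nat \<lfloor>c * real n powr (5 / 4)\<rfloor>)) (uniform_perm n) - T\<bar> \<le> C * (1 / sqrt (real n))) at_top"
    using A A2 small1 small2 big eventually_ge_at_top[of 4]
  proof eventually_elim
    case (elim n)
    define m where "m = nat \<lfloor>c * real n powr (5 / 4)\<rfloor>"
    define a where "a = real n ^ 2 / (4 * real m ^ 2)"
    obtain k where k: "n = Suc k" "k \<ge> 3" using elim(6) by (cases n) auto
    have pos: "c * real n powr (5 / 4) \<ge> 0" using assms by simp
    have m: "c * real n powr (5 / 4) - 1 \<le> real m" "real m \<le> c * real n powr (5 / 4)"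
      using pos unfolding m_def by linarith+
    have m4: "4 * n \<le> m" using m(1) elim(5) by linarith
    have m0: "real m > 0" using m4 elim(6) by simp
    have a_ub: "a \<le> ub n" unfolding a_def ub_def
      by (intro divide_left_mono mult_left_mono power_mono mult_pos_pos m zero_less_power) (use m0 elim(5) in auto)
    have a0: "a \<ge> 0" by (simp add: a_def)
    have "a \<le> A * (1 / sqrt (real n))" using a_ub elim(1) by simp
    moreover have "\<bar>a\<^sup>2 * real n - \<kappa>\<^sup>2\<bar> \<le> A2 * (1 / sqrt (real n))"
    proof -
      have "a\<^sup>2 * real n \<le> (ub n)\<^sup>2 * real n" using a_ub a0 by (intro mult_right_mono power_mono) auto
      moreover have "(ub n)\<^sup>2 * real n - \<kappa>\<^sup>2 \<le> A2 * (1 / sqrt (real n))" using elim(2) unfolding \<kappa>_def by simp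
      moreover have "\<kappa>\<^sup>2 \<le> a\<^sup>2 * real n"
      proof -
        have n0: "real n > 0" using elim(6) by simp
        have "(c * real n powr (5 / 4)) ^ 4 = c ^ 4 * real n ^ 5" using n0 by (intro t4) simp
        then have "real m ^ 4 \<le> c ^ 4 * real n ^ 5" using power_mono[OF m(2), of 4] m0 by simp
        then have "real n ^ 5 / (16 * (c ^ 4 * real n ^ 5)) \<le> real n ^ 5 / (16 * real m ^ 4)"
          using m0 n0 assms by (intro divide_left_mono) auto
        moreover have "real n ^ 5 / (16 * (c ^ 4 * real n ^ 5)) = \<kappa>\<^sup>2"
          using n0 assms by (simp add: \<kappa>_def power_divide power_mult_distrib)
        moreover have "real n ^ 5 / (16 * real m ^ 4) = a\<^sup>2 * real n"
          unfolding a_def by (simp add: power_divide power_mult_distrib eval_nat_numeral)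
        ultimately show ?thesis by simp
      qed
      ultimately show ?thesis by linarith
    qed
    ultimately have "\<bar>tv_dist (Suc k) (shelf_shuffle (Suc k) m) (uniform_perm (Suc k)) - T\<bar> \<le> C * (1 / sqrt (real (Suc k)))"
      unfolding C_def D_def C1_def V1_def E0_def
      by (intro tv_dist_gaussian_bound[where \<kappa> = \<kappa> and f = f and f' = f'])
        (use k m4 elim(3,4) \<mu> st in \<open>auto simp: a_def D_def E0_def\<close>)
    then show ?case unfolding m_def k(1) .
  qed
  then obtain N0 where N0: "\<And>n. n \<ge> N0 \<Longrightarrow> \<bar>tv_dist n (shelf_shuffle n (nat \<lfloor>c * real n powr (5 / 4)\<rfloor>)) (uniform_perm n) - T\<bar> \<le> C * (1 / sqrt (real n))"
    unfolding eventually_at_top_linorder by blast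
  have "\<bar>tv_dist n (shelf_shuffle n (nat \<lfloor>c * real n powr (5 / 4)\<rfloor>)) (uniform_perm n) - (1 - 2 * Phi (- (1 / (12 * c\<^sup>2 * sqrt 10))))\<bar> \<le> max C 1 / sqrt (real n)"
    if "n \<ge> max N0 1" for n
  proof -
    have "C * (1 / sqrt (real n)) \<le> max C 1 * (1 / sqrt (real n))" by (rule mult_right_mono) auto
    then show ?thesis using N0[of n] that unfolding T_def \<mu>2 by simp
  qed
  then show ?thesis by (intro exI[of _ "max C 1"] exI[of _ "max N0 1"]) auto
qed

end
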